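(* Let $(R,\mathfrak m)$ be a $d$-dimensional regular local ring with $d\ge 2$, let $V$ be a zero-dimensional real valuation domain birationally dominating $R$ with corresponding valuation $v$, and let $R=R_0\subset R_1\subset R_2\subset\cdots\subset V$ be the infinite sequence of local quadratic transforms $(R_n,\mathfrak m_n)$ of $R$ along $V$. Let $s=\sum_{i=0}^\infty v(\mathfrak m_i)$. Assume that $\mathfrak m=(x_1,\dots,x_d)R$ where $v(x_1),\dots,v(x_d)$ are rationally independent. Then: (1) $$s=\sum_{i=0}^\infty v(\mathfrak m_i)\le\frac{v(x_1)+v(x_2)+\cdots+v(x_d)}{d-1}.$$ In particular, $s$ is finite. (2) The following are equivalent: (a) Equality holds in (1). (b) The sequence $\{(R_n,\mathfrak m_n)\}_{n\ge0}$ switches strongly infinitely often. (c) $\lim_{n\to\infty}v(x_{n,k})=0$ for each $k\in\{1,\dots,d\}$, where $x_{n,1},\dots,x_{n,d}$ are the variables of $R_n$ induced by $x_1,\dots,x_d$.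
   Context: A valuation domain $(V,\mathfrak m_V)$ birationally dominates a local domain $(R,\mathfrak m)$ if $R\subset V\subset\operatorname{Frac}(R)$ and $\mathfrak m_V\cap R=\mathfrak m$; it is zero-dimensional over $R$ if $V/\mathfrak m_V$ is algebraic over $R/\mathfrak m$; it is real if it has rank (Krull dimension) one, with $v$ taking values in $\mathbb R$. Rationally independent means linearly independent over $\mathbb Q$. For an ideal $I$ of $R_i$, $v(I)=\min\{v(a):a\in I\}$. The sequence of local quadratic transforms of $R$ along $V$: $R_0=R$ and, given $R_n$ with maximal ideal $\mathfrak m_n$, choose $a\in\mathfrak m_n$ with $aV=\mathfrak m_nV$; then $R_{n+1}=R_n[\mathfrak m_n/a]_Q$, where $Q=\mathfrak m_V\cap R_n[\mathfrak m_n/a]$ (this is independent of the choice of $a$). Induced variables: since $v(x_1),\dots,v(x_d)$ are rationally independent, the sequence is monomial in these parameters: $x_{0,k}=x_k$, and for each $n\ge0$ one has $\mathfrak m_n=(x_{n,1},\dots,x_{n,d})R_n$, there is a unique index $k$ with $v(x_{n,k})=\min_l v(x_{n,l})=v(\mathfrak m_n)$, and $x_{n+1,k}=x_{n,k}$, $x_{n+1,l}=x_{n,l}/x_{n,k}$ for $l\neq k$. The sequence switches strongly infinitely often if there do not exist an integer $j\ge0$ and a height one prime ideal $\mathfrak p_j$ of $R_j$ with $\bigcup_{n\ge0}R_n\subset(R_j)_{\mathfrak p_j}$. *)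

theory Defs
  imports "HOL-Algebra.Algebra" "HOL-Library.Extended_Real"
begin

text \<open>All rings in a tower \<open>R \<subseteq> R\<^sub>1 \<subseteq> \<dots> \<subseteq> V \<subseteq> Frac R\<close> are given by their carriers, as subrings
  of one ambient field \<open>K = Frac R\<close>; \<open>K\<lparr>carrier := S\<rparr>\<close> is such a subring viewed as a ring.\<close>

subsection \<open>Commutative algebra\<close>

definition local_ring :: "('a, 'b) ring_scheme \<Rightarrow> bool" where
  "local_ring A \<longleftrightarrow> cring A \<and> (\<exists>!M. maximalideal M A)"

definition max_ideal :: "('a, 'b) ring_scheme \<Rightarrow> 'a set" where
  "max_ideal A = (THE M. maximalideal M A)"

definition prime_chain :: "('a, 'b) ring_scheme \<Rightarrow> nat \<Rightarrow> (nat \<Rightarrow> 'a set) \<Rightarrow> bool" where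
  "prime_chain A n P \<longleftrightarrow> (\<forall>i\<le>n. primeideal (P i) A) \<and> (\<forall>i<n. P i \<subset> P (Suc i))"

definition krull_dim :: "('a, 'b) ring_scheme \<Rightarrow> enat" where
  "krull_dim A = Sup {enat n | n. \<exists>P. prime_chain A n P}"

definition height :: "('a, 'b) ring_scheme \<Rightarrow> 'a set \<Rightarrow> enat" where
  "height A Q = Sup {enat n | n. \<exists>P. prime_chain A n P \<and> P n = Q}"

definition regular_local_ring :: "('a, 'b) ring_scheme \<Rightarrow> bool" where
  "regular_local_ring A \<longleftrightarrow> local_ring A \<and> noetherian_ring A \<and>
     krull_dim A = enat (LEAST n. \<exists>S \<subseteq> carrier A. finite S \<and> card S = n \<and> Idl\<^bsub>A\<^esub> S = max_ideal A)"

definition valuation_domain :: "('a, 'b) ring_scheme \<Rightarrow> bool" where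
  "valuation_domain A \<longleftrightarrow> domain A \<and>
     (\<forall>a \<in> carrier A. \<forall>b \<in> carrier A. a divides\<^bsub>A\<^esub> b \<or> b divides\<^bsub>A\<^esub> a)"

text \<open>The localization \<open>S\<^sub>Q\<close>, for a subring \<open>S\<close> of the field \<open>K\<close> and a prime ideal \<open>Q\<close> of \<open>S\<close>,
  inside \<open>K\<close>.\<close>

definition localization :: "('a, 'b) ring_scheme \<Rightarrow> 'a set \<Rightarrow> 'a set \<Rightarrow> 'a set" where
  "localization K S Q = {a \<otimes>\<^bsub>K\<^esub> inv\<^bsub>K\<^esub> b | a b. a \<in> S \<and> b \<in> S - Q}"

definition fraction_field_of :: "('a, 'b) ring_scheme \<Rightarrow> 'a set \<Rightarrow> bool" where
  "fraction_field_of K S \<longleftrightarrow> field K \<and> subring S K \<and> localization K S {\<zero>\<^bsub>K\<^esub>} = carrier K"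

subsection \<open>Valuations\<close>

text \<open>The condition \<open>V \<subseteq> Frac R\<close> is the inclusion of \<open>V\<close> in \<open>carrier K\<close>.\<close>

definition birationally_dominates :: "('a, 'b) ring_scheme \<Rightarrow> 'a set \<Rightarrow> 'a set \<Rightarrow> bool" where
  "birationally_dominates K V R \<longleftrightarrow> fraction_field_of K R \<and> subring V K \<and> R \<subseteq> V \<and>
     max_ideal (K\<lparr>carrier := V\<rparr>) \<inter> R = max_ideal (K\<lparr>carrier := R\<rparr>)"

text \<open>The residue field of \<open>R\<close> is taken as its image in the residue field of \<open>V\<close>,
  which is injective by domination.\<close>

definition zero_dimensional_over :: "('a, 'b) ring_scheme \<Rightarrow> 'a set \<Rightarrow> 'a set \<Rightarrow> bool" where
  "zero_dimensional_over K V R \<longleftrightarrow>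
     (let A = K\<lparr>carrier := V\<rparr>; M = max_ideal A; F = A Quot M
      in \<forall>z \<in> carrier F. ring.algebraic F ((\<lambda>r. M +>\<^bsub>A\<^esub> r) ` R) z)"

text \<open>The value at zero, conventionally \<open>\<infinity>\<close>, is left unspecified and never used.\<close>

definition valuation :: "('a, 'b) ring_scheme \<Rightarrow> ('a \<Rightarrow> real) \<Rightarrow> bool" where
  "valuation K v \<longleftrightarrow> (\<forall>a \<in> carrier K - {\<zero>\<^bsub>K\<^esub>}. \<forall>b \<in> carrier K - {\<zero>\<^bsub>K\<^esub>}.
     v (a \<otimes>\<^bsub>K\<^esub> b) = v a + v b \<and> (a \<oplus>\<^bsub>K\<^esub> b \<noteq> \<zero>\<^bsub>K\<^esub> \<longrightarrow> min (v a) (v b) \<le> v (a \<oplus>\<^bsub>K\<^esub> b)))"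

definition valuation_ring :: "('a, 'b) ring_scheme \<Rightarrow> ('a \<Rightarrow> real) \<Rightarrow> 'a set" where
  "valuation_ring K v = insert \<zero>\<^bsub>K\<^esub> {a \<in> carrier K - {\<zero>\<^bsub>K\<^esub>}. 0 \<le> v a}"

definition real_valuation_domain ::
  "('a, 'b) ring_scheme \<Rightarrow> 'a set \<Rightarrow> ('a \<Rightarrow> real) \<Rightarrow> bool" where
  "real_valuation_domain K V v \<longleftrightarrow> valuation_domain (K\<lparr>carrier := V\<rparr>) \<and>
     krull_dim (K\<lparr>carrier := V\<rparr>) = 1 \<and> valuation K v \<and> valuation_ring K v = V"

text \<open>The minimum \<open>v(I)\<close> of the values on an ideal; \<open>LEAST\<close> is the minimum whenever it is attained.\<close>

definition ideal_value :: "('a, 'b) ring_scheme \<Rightarrow> ('a \<Rightarrow> real) \<Rightarrow> 'a set \<Rightarrow> real" where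
  "ideal_value K v I = (LEAST t. t \<in> v ` (I - {\<zero>\<^bsub>K\<^esub>}))"

definition rationally_independent :: "'i set \<Rightarrow> ('i \<Rightarrow> real) \<Rightarrow> bool" where
  "rationally_independent I f \<longleftrightarrow>
     (\<forall>c :: 'i \<Rightarrow> rat. (\<Sum>i\<in>I. of_rat (c i) * f i) = 0 \<longrightarrow> (\<forall>i\<in>I. c i = 0))"

subsection \<open>Local quadratic transforms\<close>

definition local_quadratic_transform ::
  "('a, 'b) ring_scheme \<Rightarrow> 'a set \<Rightarrow> 'a set \<Rightarrow> 'a set \<Rightarrow> bool" where
  "local_quadratic_transform K V S S' \<longleftrightarrow>
     (\<exists>a \<in> max_ideal (K\<lparr>carrier := S\<rparr>).
        PIdl\<^bsub>K\<lparr>carrier := V\<rparr>\<^esub> a = Idl\<^bsub>K\<lparr>carrier := V\<rparr>\<^esub> (max_ideal (K\<lparr>carrier := S\<rparr>)) \<and>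
        (let B = generate_ring K (S \<union> (\<lambda>y. y \<otimes>\<^bsub>K\<^esub> inv\<^bsub>K\<^esub> a) ` max_ideal (K\<lparr>carrier := S\<rparr>))
         in S' = localization K B (max_ideal (K\<lparr>carrier := V\<rparr>) \<inter> B)))"

definition local_quadratic_sequence ::
  "('a, 'b) ring_scheme \<Rightarrow> 'a set \<Rightarrow> 'a set \<Rightarrow> (nat \<Rightarrow> 'a set) \<Rightarrow> bool" where
  "local_quadratic_sequence K V R Rs \<longleftrightarrow>
     Rs 0 = R \<and> (\<forall>n. local_quadratic_transform K V (Rs n) (Rs (Suc n)))"

text \<open>\<open>induced_vars K v d x n k\<close> is \<open>x\<^sub>n\<^sub>,\<^sub>k\<close> for \<open>k \<in> {1..d}\<close>; the index of minimal value
  is unique when \<open>v(x\<^sub>1), \<dots>, v(x\<^sub>d)\<close> are rationally independent.\<close>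

primrec induced_vars ::
  "('a, 'b) ring_scheme \<Rightarrow> ('a \<Rightarrow> real) \<Rightarrow> nat \<Rightarrow> (nat \<Rightarrow> 'a) \<Rightarrow> nat \<Rightarrow> nat \<Rightarrow> 'a" where
  "induced_vars K v d x 0 = x"
| "induced_vars K v d x (Suc n) =
     (let y = induced_vars K v d x n;
          k = (THE k. k \<in> {1..d} \<and> (\<forall>l \<in> {1..d}. v (y k) \<le> v (y l)))
      in (\<lambda>l. if l = k then y k else y l \<otimes>\<^bsub>K\<^esub> inv\<^bsub>K\<^esub> (y k)))"

definition switches_strongly_infinitely_often ::
  "('a, 'b) ring_scheme \<Rightarrow> (nat \<Rightarrow> 'a set) \<Rightarrow> bool" where
  "switches_strongly_infinitely_often K Rs \<longleftrightarrow>
     \<not> (\<exists>j P. primeideal P (K\<lparr>carrier := Rs j\<rparr>) \<and> height (K\<lparr>carrier := Rs j\<rparr>) P = 1 \<and>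
            (\<Union>n. Rs n) \<subseteq> localization K (Rs j) P)"

end

theory Submission
  imports Defs
begin

text \<open>The variables induced on \<open>R\<^sub>n\<close> generate its maximal ideal and keep values that are linearly
  independent over the integers. Hence distinct monomials in them have distinct values, and every
  nonzero element of \<open>R\<^sub>n\<close> is a unit times a monomial plus an element of larger value
  (\<open>leading_term\<close>). In particular the value of the maximal ideal is the least \<open>v(x\<^sub>n\<^sub>,\<^sub>k)\<close>,
  and one quadratic transform subtracts this minimum from all the other values. The sum of the \<open>d\<close>
  values therefore drops by \<open>d - 1\<close> times the minimum, and \<open>s\<close> is the total drop divided by
  \<open>d - 1\<close>: this gives the bound, with equality exactly if the sum of the values tends to zero
  (\<open>value_sums\<close>).

  Suppose that some \<open>v(x\<^sub>n\<^sub>,\<^sub>k)\<close> does not tend to zero. The minima do, so from some stage \<open>j\<close> on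
  the index \<open>k\<close> is never minimal, and the denominators introduced after \<open>j\<close> have values in the group
  generated by the \<open>v(x\<^sub>j\<^sub>,\<^sub>l)\<close> with \<open>l \<noteq> k\<close>. No element of \<open>x\<^sub>j\<^sub>,\<^sub>k R\<^sub>j\<close> has such a value, so the union
  of the rings lies in the localization of \<open>R\<^sub>j\<close> at this ideal
  (\<open>never_minimal_imp_not_switching\<close>). That the ideal is a prime of height one is again a matter of
  leading monomials, provided that it is closed in the topology of the valuation. Monomial ideals
  of the noetherian ring \<open>R\<close> are closed by Krull's argument (\<open>noetherian_monomially_closed\<close>), and
  the property passes through a quadratic transform (\<open>monomially_closed_step\<close>).

  Suppose conversely that all \<open>v(x\<^sub>n\<^sub>,\<^sub>k)\<close> tend to zero. Independence then makes every index minimal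
  infinitely often. The key point is that every Laurent monomial of positive value in the variables
  of \<open>R\<^sub>j\<close> has nonnegative exponents in the variables of \<open>R\<^sub>n\<close> for large \<open>n\<close>
  (\<open>exponents_eventually_nonneg\<close>). So each nonzero element of a height one prime \<open>P\<close> of \<open>R\<^sub>j\<close> is a
  monomial in the variables of \<open>R\<^sub>j\<close> times a unit of some \<open>R\<^sub>n\<close>. If the union of the rings were
  contained in the localization at \<open>P\<close>, some \<open>x\<^sub>j\<^sub>,\<^sub>i\<close> would lie in \<open>P\<close>; all later \<open>x\<^sub>n\<^sub>,\<^sub>i\<close> would stay in
  the maximal ideal of the localization, whereas the variables of minimal value are units there
  (\<open>vanishing_imp_switching\<close>).\<close>

section \<open>Real valuations on a field\<close>

locale real_valued_field = field K for K (structure) +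
  fixes v :: "'a \<Rightarrow> real"
  assumes valuation: "valuation K v"
begin

text \<open>The value of zero is unspecified, so lower bounds for values are predicates that hold at zero.\<close>

definition val_ge :: "real \<Rightarrow> 'a \<Rightarrow> bool" where
  "val_ge t a \<longleftrightarrow> a \<in> carrier K \<and> (a = \<zero> \<or> t \<le> v a)"

definition val_gt :: "real \<Rightarrow> 'a \<Rightarrow> bool" where
  "val_gt t a \<longleftrightarrow> a \<in> carrier K \<and> (a = \<zero> \<or> t < v a)"

lemma nonzero_mult: "a \<in> carrier K \<Longrightarrow> b \<in> carrier K \<Longrightarrow> a \<noteq> \<zero> \<Longrightarrow> b \<noteq> \<zero> \<Longrightarrow> a \<otimes> b \<noteq> \<zero>"
  using integral by blast

lemma inv_closed_K [simp]: "a \<in> carrier K \<Longrightarrow> a \<noteq> \<zero> \<Longrightarrow> inv a \<in> carrier K"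
  by (simp add: field_Units)

lemma inv_right [simp]: "a \<in> carrier K \<Longrightarrow> a \<noteq> \<zero> \<Longrightarrow> a \<otimes> inv a = \<one>"
  by (simp add: field_Units)

lemma inv_left [simp]: "a \<in> carrier K \<Longrightarrow> a \<noteq> \<zero> \<Longrightarrow> inv a \<otimes> a = \<one>"
  by (simp add: field_Units)

lemma inv_nonzero [simp]: "a \<in> carrier K \<Longrightarrow> a \<noteq> \<zero> \<Longrightarrow> inv a \<noteq> \<zero>"
  by (metis inv_left inv_closed_K l_null one_not_zero)

lemma inv_cancel: "a \<in> carrier K \<Longrightarrow> b \<in> carrier K \<Longrightarrow> b \<noteq> \<zero> \<Longrightarrow> (a \<otimes> inv b) \<otimes> b = a"
  by (simp add: m_assoc)

lemma inv_cancel': "a \<in> carrier K \<Longrightarrow> b \<in> carrier K \<Longrightarrow> b \<noteq> \<zero> \<Longrightarrow> (a \<otimes> b) \<otimes> inv b = a"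
  by (simp add: m_assoc)

lemma inv_cancel_left:
  "a \<in> carrier K \<Longrightarrow> b \<in> carrier K \<Longrightarrow> b \<noteq> \<zero> \<Longrightarrow> inv b \<otimes> (a \<otimes> b) = a"
  by (simp add: m_lcomm)

lemma inv_mult_K:
  assumes "a \<in> carrier K" "b \<in> carrier K" "a \<noteq> \<zero>" "b \<noteq> \<zero>"
  shows "inv (a \<otimes> b) = inv a \<otimes> inv b"
proof -
  have mid: "(a \<otimes> b) \<otimes> (c \<otimes> e) = (a \<otimes> c) \<otimes> (b \<otimes> e)" if "c \<in> carrier K" "e \<in> carrier K" for c e
    using assms that by (simp add: m_ac)
  have "(a \<otimes> b) \<otimes> (inv a \<otimes> inv b) = (a \<otimes> inv a) \<otimes> (b \<otimes> inv b)"
    using assms by (intro mid) auto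
  then have "(a \<otimes> b) \<otimes> (inv a \<otimes> inv b) = \<one>" using assms by simp
  then show ?thesis using assms by (intro comm_inv_char) auto
qed

lemma inv_inv_K: "a \<in> carrier K \<Longrightarrow> a \<noteq> \<zero> \<Longrightarrow> inv (inv a) = a"
  by (rule comm_inv_char) auto

lemma v_mult: "a \<in> carrier K \<Longrightarrow> b \<in> carrier K \<Longrightarrow> a \<noteq> \<zero> \<Longrightarrow> b \<noteq> \<zero> \<Longrightarrow> v (a \<otimes> b) = v a + v b"
  using valuation unfolding valuation_def by blast

lemma v_add: "a \<in> carrier K \<Longrightarrow> b \<in> carrier K \<Longrightarrow> a \<noteq> \<zero> \<Longrightarrow> b \<noteq> \<zero> \<Longrightarrow> a \<oplus> b \<noteq> \<zero> \<Longrightarrow>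
    min (v a) (v b) \<le> v (a \<oplus> b)"
  using valuation unfolding valuation_def by blast

lemma v_one [simp]: "v \<one> = 0"
  using v_mult[of \<one> \<one>] by simp

lemma v_inv: "a \<in> carrier K \<Longrightarrow> a \<noteq> \<zero> \<Longrightarrow> v (inv a) = - v a"
  using v_mult[of a "inv a"] by simp

lemma v_minus_one: "v (\<ominus> \<one>) = 0"
proof -
  have "v ((\<ominus> \<one>) \<otimes> (\<ominus> \<one>)) = v (\<ominus> \<one>) + v (\<ominus> \<one>)"
    by (rule v_mult) (auto simp: local.add.inv_eq_1_iff)
  then show ?thesis by (simp add: l_minus)
qed

lemma v_minus: "a \<in> carrier K \<Longrightarrow> a \<noteq> \<zero> \<Longrightarrow> v (\<ominus> a) = v a"
proof -
  assume a: "a \<in> carrier K" "a \<noteq> \<zero>"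
  have "v ((\<ominus> \<one>) \<otimes> a) = v (\<ominus> \<one>) + v a"
    by (rule v_mult) (use a in \<open>auto simp: local.add.inv_eq_1_iff\<close>)
  then show ?thesis using a by (simp add: l_minus v_minus_one)
qed

lemma val_ge_carrier: "val_ge t a \<Longrightarrow> a \<in> carrier K"
  and val_gt_carrier: "val_gt t a \<Longrightarrow> a \<in> carrier K"
  by (simp_all add: val_ge_def val_gt_def)

lemma val_ge_zero [simp]: "val_ge t \<zero>"
  and val_gt_zero [simp]: "val_gt t \<zero>"
  by (simp_all add: val_ge_def val_gt_def)

lemma val_gt_imp_ge: "val_gt t a \<Longrightarrow> val_ge t a"
  by (auto simp: val_ge_def val_gt_def)

lemma val_ge_add: "val_ge t a \<Longrightarrow> val_ge t b \<Longrightarrow> val_ge t (a \<oplus> b)"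
  using v_add[of a b] by (cases "a = \<zero>"; cases "b = \<zero>"; cases "a \<oplus> b = \<zero>") (auto simp: val_ge_def)

lemma val_gt_add: "val_gt t a \<Longrightarrow> val_gt t b \<Longrightarrow> val_gt t (a \<oplus> b)"
  using v_add[of a b] by (cases "a = \<zero>"; cases "b = \<zero>"; cases "a \<oplus> b = \<zero>") (auto simp: val_gt_def)

lemma val_ge_uminus: "val_ge t a \<Longrightarrow> val_ge t (\<ominus> a)"
  using v_minus[of a] by (cases "a = \<zero>") (auto simp: val_ge_def)

lemma val_gt_uminus: "val_gt t a \<Longrightarrow> val_gt t (\<ominus> a)"
  using v_minus[of a] by (cases "a = \<zero>") (auto simp: val_gt_def)

lemma val_gt_minus: "val_gt t a \<Longrightarrow> val_gt t b \<Longrightarrow> val_gt t (a \<ominus> b)"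
  by (simp add: a_minus_def val_gt_add val_gt_uminus)

lemma val_ge_mult: "val_ge s a \<Longrightarrow> val_ge t b \<Longrightarrow> val_ge (s + t) (a \<otimes> b)"
  using v_mult[of a b] by (cases "a = \<zero>"; cases "b = \<zero>") (auto simp: val_ge_def)

lemma val_gt_ge_mult: "val_gt s a \<Longrightarrow> val_ge t b \<Longrightarrow> val_gt (s + t) (a \<otimes> b)"
  using v_mult[of a b] by (cases "a = \<zero>"; cases "b = \<zero>") (auto simp: val_ge_def val_gt_def)

lemma val_ge_gt_mult: "val_ge s a \<Longrightarrow> val_gt t b \<Longrightarrow> val_gt (s + t) (a \<otimes> b)"
  using v_mult[of a b] by (cases "a = \<zero>"; cases "b = \<zero>") (auto simp: val_ge_def val_gt_def)

lemma val_ge_self: "a \<in> carrier K \<Longrightarrow> t \<le> v a \<Longrightarrow> val_ge t a"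
  by (simp add: val_ge_def)

lemma v_add_dominant:
  assumes "a \<in> carrier K" "a \<noteq> \<zero>" "val_gt (v a) b"
  shows "a \<oplus> b \<noteq> \<zero>" "v (a \<oplus> b) = v a"
proof -
  have b: "b \<in> carrier K" using assms by (simp add: val_gt_def)
  have e: "a = (a \<oplus> b) \<ominus> b" using assms b by algebra
  show nz: "a \<oplus> b \<noteq> \<zero>"
  proof
    assume "a \<oplus> b = \<zero>"
    then have "b = \<ominus> a" using assms b by (metis local.minus_equality a_comm)
    then have "val_gt (v a) (\<ominus> a)" using assms by simp
    then have "val_gt (v a) a" using val_gt_uminus[of "v a" "\<ominus> a"] assms by simp
    then show False using assms by (simp add: val_gt_def)
  qed
  have "val_ge (v a) (a \<oplus> b)"
    using assms val_ge_add[OF val_ge_self[of a "v a"] val_gt_imp_ge[OF assms(3)]] by simp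
  then have 1: "v a \<le> v (a \<oplus> b)" using nz by (simp add: val_ge_def)
  have 2: "v (a \<oplus> b) \<le> v a"
  proof (rule ccontr)
    assume "\<not> ?thesis"
    then have "val_gt (v a) (a \<oplus> b)" using assms b by (simp add: val_gt_def)
    then have "val_gt (v a) a" using val_gt_minus[of "v a" "a \<oplus> b" b] e assms(3) by simp
    then show False using assms by (simp add: val_gt_def)
  qed
  show "v (a \<oplus> b) = v a" using 1 2 by simp
qed

end

section \<open>Spans, ideals and rings of fractions in a field\<close>

context field
begin

abbreviation sub :: "'a set \<Rightarrow> ('a, 'b) ring_scheme" where
  "sub S \<equiv> R\<lparr>carrier := S\<rparr>"

text \<open>The generators range over the whole field: products with the inverse of a parameter lead out of
  the ring of coefficients.\<close>

inductive_set span_over :: "'a set \<Rightarrow> 'a set \<Rightarrow> 'a set" for S G where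
  zero: "\<zero> \<in> span_over S G"
| add: "s \<in> S \<Longrightarrow> g \<in> G \<Longrightarrow> f \<in> span_over S G \<Longrightarrow> (s \<otimes> g) \<oplus> f \<in> span_over S G"

lemma span_over_carrier:
  assumes "subring S R" "G \<subseteq> carrier R" "f \<in> span_over S G"
  shows "f \<in> carrier R"
  using assms(3) by induct (use assms subringE(1)[OF assms(1)] in auto)

lemma span_over_mono:
  assumes "f \<in> span_over S G" "S \<subseteq> S'" "G \<subseteq> G'"
  shows "f \<in> span_over S' G'"
  using assms(1) by induct (use assms in \<open>auto intro: span_over.intros\<close>)

lemma span_over_add:
  assumes "subring S R" "G \<subseteq> carrier R" "f \<in> span_over S G" "g \<in> span_over S G"
  shows "f \<oplus> g \<in> span_over S G"
  using assms(3)
proof induct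
  case zero
  then show ?case using assms span_over_carrier by simp
next
  case (add s h f)
  have "(s \<otimes> h \<oplus> f) \<oplus> g = s \<otimes> h \<oplus> (f \<oplus> g)"
    using add assms subringE(1)[OF assms(1)] span_over_carrier[OF assms(1,2)]
    by (intro a_assoc) (auto simp: subset_iff)
  then show ?case using add by (auto intro: span_over.intros)
qed

lemma span_over_mult:
  assumes "subring S R" "G \<subseteq> carrier R" "f \<in> span_over S G" "c \<in> carrier R"
    and "\<And>s g. s \<in> S \<Longrightarrow> g \<in> G \<Longrightarrow> c \<otimes> (s \<otimes> g) \<in> span_over S' G'"
    and "subring S' R" "G' \<subseteq> carrier R"
  shows "c \<otimes> f \<in> span_over S' G'"
  using assms(3)
proof induct
  case zero
  then show ?case using assms span_over.zero by simp
next
  case (add s h f)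
  have "c \<otimes> (s \<otimes> h \<oplus> f) = c \<otimes> (s \<otimes> h) \<oplus> c \<otimes> f"
    using add assms subringE(1)[OF assms(1)] span_over_carrier[OF assms(1,2)]
    by (intro r_distr) (auto simp: subset_iff)
  then show ?case using add assms span_over_add[OF assms(6,7)] by auto
qed

lemma span_over_single:
  assumes "G \<subseteq> carrier R" "subring S R" "s \<in> S" "g \<in> G"
  shows "s \<otimes> g \<in> span_over S G"
  using span_over.add[OF assms(3,4) span_over.zero] assms subringE(1)[OF assms(2)]
  by (metis m_closed r_zero subset_iff)

lemma span_over_base:
  assumes "G \<subseteq> carrier R" "subring S R" "g \<in> G"
  shows "g \<in> span_over S G"
  using span_over_single[OF assms(1,2) subringE(3)[OF assms(2)] assms(3)] assms by auto

lemma span_over_smult: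
  assumes "subring S R" "G \<subseteq> carrier R" "f \<in> span_over S G" "c \<in> S"
  shows "c \<otimes> f \<in> span_over S G"
proof (rule span_over_mult[OF assms(1,2,3) _ _ assms(1,2)])
  show "c \<in> carrier R" using assms subringE(1) by blast
  fix s g assume "s \<in> S" "g \<in> G"
  then have "c \<otimes> (s \<otimes> g) = (c \<otimes> s) \<otimes> g"
    using assms subringE(1)[OF assms(1)] by (metis m_assoc subset_iff)
  then show "c \<otimes> (s \<otimes> g) \<in> span_over S G"
    using \<open>s \<in> S\<close> \<open>g \<in> G\<close> assms subringE(6)[OF assms(1)] span_over_single by auto
qed

lemma span_over_uminus:
  assumes "subring S R" "G \<subseteq> carrier R" "f \<in> span_over S G"
  shows "\<ominus> f \<in> span_over S G"
proof -
  have "\<ominus> \<one> \<in> S" using subringE(3,5)[OF assms(1)] by blast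
  then have "(\<ominus> \<one>) \<otimes> f \<in> span_over S G" using span_over_smult assms by blast
  then show ?thesis using span_over_carrier[OF assms] by (simp add: l_minus)
qed

lemma span_over_minus:
  assumes "subring S R" "G \<subseteq> carrier R" "f \<in> span_over S G" "g \<in> span_over S G"
  shows "f \<ominus> g \<in> span_over S G"
  using assms by (simp add: a_minus_def span_over_add span_over_uminus)

lemma span_over_least:
  assumes "f \<in> span_over S G" "\<zero> \<in> M" "\<And>s g h. s \<in> S \<Longrightarrow> g \<in> G \<Longrightarrow> h \<in> M \<Longrightarrow> s \<otimes> g \<oplus> h \<in> M"
  shows "f \<in> M"
  using assms(1) by induct (use assms in auto)

lemma ideal_subring_iff:
  assumes S: "subring S R"
  shows "ideal I (sub S) \<longleftrightarrow> I \<subseteq> S \<and> \<zero> \<in> I \<and> (\<forall>a\<in>I. \<forall>b\<in>I. a \<oplus> b \<in> I)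
    \<and> (\<forall>s\<in>S. \<forall>a\<in>I. s \<otimes> a \<in> I)" (is "?l \<longleftrightarrow> ?r")
proof
  assume ?l
  then have l: "ideal I (sub S)" .
  note add = ideal.axioms(1)[OF l]
  show ?r
    using additive_subgroup.a_subset[OF add] additive_subgroup.zero_closed[OF add]
      additive_subgroup.a_closed[OF add] ideal.I_l_closed[OF l] by auto
next
  assume r: ?r
  have A: "ring (sub S)" using subring_is_ring[OF S] .
  have grp: "group (add_monoid (sub S))"
    using abelian_group.a_group[OF ring.is_abelian_group[OF A]] .
  have mone: "\<ominus> \<one> \<in> S" using subringE(3,5)[OF S] by blast
  have car: "a \<in> carrier R" if "a \<in> S" for a using that subringE(1)[OF S] by auto
  show ?l
  proof (rule idealI)
    show "ring (sub S)" by (rule A)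
    show "subgroup I (add_monoid (sub S))"
    proof (rule group.subgroupI[OF grp])
      fix a assume a: "a \<in> I"
      have "(\<ominus> \<one>) \<otimes> a \<in> I" using r mone a by blast
      then have 1: "\<ominus> a \<in> I" using a r car by (simp add: l_minus subset_iff)
      have "inv\<^bsub>add_monoid (sub S)\<^esub> a = \<ominus> a"
      proof -
        have "a \<oplus> \<ominus> a = \<zero>" using a r car by (simp add: r_neg subset_iff)
        then show ?thesis using 1 a r 
          by (intro group.inv_equality[OF grp]) (auto simp: subset_iff car l_neg)
      qed
      then show "inv\<^bsub>add_monoid (sub S)\<^esub> a \<in> I" using 1 by simp
    qed (use r in auto)
  next
    fix a x assume "a \<in> I" "x \<in> carrier (sub S)"
    then show "x \<otimes>\<^bsub>sub S\<^esub> a \<in> I" "a \<otimes>\<^bsub>sub S\<^esub> x \<in> I"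
      using r m_comm car by (auto simp: subset_iff)
  qed
qed

lemma subring_cring:
  assumes "subring S R" shows "cring (sub S)"
  using subcring_iff subcringI'[OF assms] subringE(1)[OF assms] by blast

end

context real_valued_field
begin

text \<open>The denominators are selected by their values, which makes them a multiplicative set when \<open>G\<close> is
  a group. For \<open>G = {0}\<close> this is the localization at the ideal of the elements of positive value
  when \<open>S\<close> lies in the valuation ring; larger groups give upper bounds for all rings of a tower at once.\<close>

definition value_fractions :: "'a set \<Rightarrow> real set \<Rightarrow> 'a set" where
  "value_fractions S G = {a \<otimes> inv b | a b. a \<in> S \<and> b \<in> S \<and> b \<noteq> \<zero> \<and> v b \<in> G}"

lemma value_fractionsI:
  "a \<in> S \<Longrightarrow> b \<in> S \<Longrightarrow> b \<noteq> \<zero> \<Longrightarrow> v b \<in> G \<Longrightarrow> a \<otimes> inv b \<in> value_fractions S G"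
  by (auto simp: value_fractions_def)

lemma value_fractionsE:
  assumes "c \<in> value_fractions S G"
  obtains a b where "a \<in> S" "b \<in> S" "b \<noteq> \<zero>" "v b \<in> G" "c = a \<otimes> inv b"
  using assms by (auto simp: value_fractions_def)

definition additive_group :: "real set \<Rightarrow> bool" where
  "additive_group G \<longleftrightarrow> 0 \<in> G \<and> (\<forall>s\<in>G. \<forall>t\<in>G. s + t \<in> G) \<and> (\<forall>s\<in>G. - s \<in> G)"

lemma additive_group_zero [simp]: "additive_group {0}"
  by (simp add: additive_group_def)

lemma value_fractions_incl:
  assumes "subring S K" "additive_group G"
  shows "S \<subseteq> value_fractions S G"
proof
  fix s assume s: "s \<in> S"
  have "s \<otimes> inv \<one> \<in> value_fractions S G"
    using s assms subringE(3)[OF assms(1)] by (intro value_fractionsI) (auto simp: additive_group_def)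
  then show "s \<in> value_fractions S G" using s subringE(1)[OF assms(1)] by auto
qed

lemma value_fractions_subring:
  assumes S: "subring S K" and G: "additive_group G"
  shows "subring (value_fractions S G) K"
proof -
  note car = subsetD[OF subringE(1)[OF S]]
  show ?thesis
  proof (rule subringI)
    show "value_fractions S G \<subseteq> carrier K" using car by (auto elim!: value_fractionsE)
    show "\<one> \<in> value_fractions S G"
      using value_fractions_incl[OF S G] subringE(3)[OF S] by blast
  next
    fix h assume "h \<in> value_fractions S G"
    then obtain a b where ab: "a \<in> S" "b \<in> S" "b \<noteq> \<zero>" "v b \<in> G" "h = a \<otimes> inv b"
      by (rule value_fractionsE)
    then have "\<ominus> h = (\<ominus> a) \<otimes> inv b" using car by (simp add: l_minus)
    then show "\<ominus> h \<in> value_fractions S G"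
      using ab subringE(5)[OF S] by (auto intro: value_fractionsI)
  next
    fix h k assume "h \<in> value_fractions S G" "k \<in> value_fractions S G"
    then obtain a b c e where ab: "a \<in> S" "b \<in> S" "b \<noteq> \<zero>" "v b \<in> G" "h = a \<otimes> inv b"
      and ce: "c \<in> S" "e \<in> S" "e \<noteq> \<zero>" "v e \<in> G" "k = c \<otimes> inv e"
      by (metis value_fractionsE)
    have be: "b \<otimes> e \<in> S" "b \<otimes> e \<noteq> \<zero>" "v (b \<otimes> e) \<in> G"
      using ab ce car nonzero_mult v_mult subringE(6)[OF S] G by (auto simp: additive_group_def)
    have i: "inv b \<in> carrier K" "inv e \<in> carrier K" using ab ce car by auto
    have "h \<otimes> k = (a \<otimes> c) \<otimes> (inv b \<otimes> inv e)"
      using ab ce car i by (simp add: m_ac)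
    then have "h \<otimes> k = (a \<otimes> c) \<otimes> inv (b \<otimes> e)"
      using inv_mult_K[of b e] ab ce car by simp
    then show "h \<otimes> k \<in> value_fractions S G"
      using be ab ce subringE(6)[OF S] by (auto intro: value_fractionsI)
    have "(a \<otimes> e \<oplus> c \<otimes> b) \<otimes> (inv b \<otimes> inv e) = a \<otimes> inv b \<otimes> (e \<otimes> inv e) \<oplus> c \<otimes> inv e \<otimes> (b \<otimes> inv b)"
      using ab(1,2) ce(1,2) i by (subst l_distr) (simp_all add: car m_ac)
    then have "(a \<otimes> e \<oplus> c \<otimes> b) \<otimes> inv (b \<otimes> e) = h \<oplus> k"
      using inv_mult_K[of b e] ab ce car by simp
    moreover have "a \<otimes> e \<oplus> c \<otimes> b \<in> S" using ab ce subringE(6,7)[OF S] by auto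
    ultimately show "h \<oplus> k \<in> value_fractions S G"
      using be value_fractionsI[of _ S "b \<otimes> e" G] by metis
  qed
qed

lemma value_fractions_inv:
  assumes S: "subring S K" and G: "additive_group G"
    and "t \<in> value_fractions S G" "t \<noteq> \<zero>" "v t \<in> G"
  shows "inv t \<in> value_fractions S G"
proof -
  note car = subsetD[OF subringE(1)[OF S]]
  obtain a b where ab: "a \<in> S" "b \<in> S" "b \<noteq> \<zero>" "v b \<in> G" "t = a \<otimes> inv b"
    using assms(3) by (rule value_fractionsE)
  have a0: "a \<noteq> \<zero>" using ab assms(4) car by auto
  have "v t = v a - v b" using ab a0 car by (simp add: v_mult v_inv)
  then have "v a = v t + v b" by simp
  then have "v a \<in> G" using G ab(4) assms(5) by (auto simp: additive_group_def)
  moreover have "inv t = b \<otimes> inv a"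
    using ab a0 car by (simp add: inv_mult_K m_comm inv_inv_K)
  ultimately show ?thesis using ab a0 by (auto intro: value_fractionsI)
qed

lemma value_fractions_least:
  assumes "subring T K" "S \<subseteq> T" "\<And>t. t \<in> T \<Longrightarrow> t \<noteq> \<zero> \<Longrightarrow> v t \<in> G \<Longrightarrow> inv t \<in> T"
  shows "value_fractions S G \<subseteq> T"
proof
  fix c assume "c \<in> value_fractions S G"
  then obtain a b where ab: "a \<in> S" "b \<in> S" "b \<noteq> \<zero>" "v b \<in> G" "c = a \<otimes> inv b"
    by (rule value_fractionsE)
  then have "a \<in> T" "inv b \<in> T" using assms(2,3) by auto
  then show "c \<in> T" using subringE(6)[OF assms(1)] ab(5) by blast
qed

section \<open>Local rings dominated by the valuation\<close>

text \<open>Closure under the inverses of elements of value zero says that the nonunits are the elements of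
  positive value, so that \<open>S\<close> is local and dominated by the valuation ring.\<close>

definition dominated :: "'a set \<Rightarrow> bool" where
  "dominated S \<longleftrightarrow> subring S K \<and> (\<forall>s\<in>S. val_ge 0 s) \<and> (\<forall>s\<in>S. s \<noteq> \<zero> \<longrightarrow> v s = 0 \<longrightarrow> inv s \<in> S)"

lemma val_ge_0_cases: "val_ge 0 s \<Longrightarrow> \<not> val_gt 0 s \<Longrightarrow> s \<noteq> \<zero> \<and> v s = 0"
  by (auto simp: val_ge_def val_gt_def)

lemma max_ideal_dominated:
  assumes "dominated S"
  shows "max_ideal (sub S) = {s \<in> S. val_gt 0 s}"
proof -
  let ?M = "{s \<in> S. val_gt 0 s}"
  have S: "subring S K" and nn: "\<And>s. s \<in> S \<Longrightarrow> val_ge 0 s"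
    and un: "\<And>s. s \<in> S \<Longrightarrow> s \<noteq> \<zero> \<Longrightarrow> v s = 0 \<Longrightarrow> inv s \<in> S"
    using assms by (auto simp: dominated_def)
  have car: "\<And>s. s \<in> S \<Longrightarrow> s \<in> carrier K" using subringE(1)[OF S] by blast
  have M: "ideal ?M (sub S)"
    unfolding ideal_subring_iff[OF S]
  proof (intro conjI ballI)
    fix a b assume "a \<in> ?M" "b \<in> ?M"
    then show "a \<oplus> b \<in> ?M" using subringE(7)[OF S] val_gt_add by auto
  next
    fix s a assume "s \<in> S" "a \<in> ?M"
    then show "s \<otimes> a \<in> ?M" using subringE(6)[OF S] val_ge_gt_mult[of 0 s 0 a] nn by auto
  qed (use subringE(2)[OF S] in auto)
  have whole: "I = S" if I: "ideal I (sub S)" and i: "i \<in> I" "i \<notin> ?M" for I i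
  proof -
    have iS: "i \<in> S" and mult: "\<And>s a. s \<in> S \<Longrightarrow> a \<in> I \<Longrightarrow> s \<otimes> a \<in> I" and sub: "I \<subseteq> S"
      using I i unfolding ideal_subring_iff[OF S] by auto
    have "inv i \<in> S" "i \<noteq> \<zero>" using val_ge_0_cases nn iS i un by auto
    then have one: "\<one> \<in> I" using mult[of "inv i" i] i car[OF iS] by simp
    have "s \<in> I" if "s \<in> S" for s using mult[OF that one] car[OF that] by simp
    then show ?thesis using sub by blast
  qed
  have notS: "\<one> \<notin> ?M" "\<one> \<in> S" using subringE(3)[OF S] by (auto simp: val_gt_def)
  have max: "maximalideal ?M (sub S)"
  proof (rule maximalidealI[OF M])
    show "carrier (sub S) \<noteq> ?M" using notS by auto
    fix J assume J: "ideal J (sub S)" "?M \<subseteq> J" "J \<subseteq> carrier (sub S)"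
    show "J = ?M \<or> J = carrier (sub S)"
    proof (cases "J \<subseteq> ?M")
      case True
      then show ?thesis using J(2) by blast
    next
      case False
      then obtain i where "i \<in> J" "i \<notin> ?M" by blast
      then show ?thesis using whole[OF J(1)] by simp
    qed
  qed
  have uniq: "N = ?M" if "maximalideal N (sub S)" for N
  proof -
    have N: "ideal N (sub S)" "S \<noteq> N"
      using maximalideal.axioms(1)[OF that] maximalideal.I_notcarr[OF that] by auto
    have "N \<subseteq> ?M"
    proof
      fix i assume "i \<in> N"
      then show "i \<in> ?M" using whole[OF N(1), of i] N(2) by blast
    qed
    then have "?M = N \<or> ?M = S" using maximalideal.I_maximal[OF that M] by auto
    then show ?thesis using notS by auto
  qed
  show "max_ideal (sub S) = ?M"
    unfolding max_ideal_def by (rule the_equality, rule max, rule uniq)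
qed

lemma valuation_ring_eq: "valuation_ring K v = {a. val_ge 0 a}"
  by (auto simp: valuation_ring_def val_ge_def)

lemma valuation_ring_subring: "subring (valuation_ring K v) K"
  unfolding valuation_ring_eq
proof (rule subringI)
  show "\<one> \<in> {a. val_ge 0 a}" by (simp add: val_ge_def)
next
  fix a b assume "a \<in> {a. val_ge 0 a}" "b \<in> {a. val_ge 0 a}"
  then show "a \<otimes> b \<in> {a. val_ge 0 a}" using val_ge_mult[of 0 a 0 b] by simp
qed (auto simp: val_ge_carrier val_ge_uminus val_ge_add)

lemma valuation_ring_dominated: "dominated (valuation_ring K v)"
  using valuation_ring_subring unfolding dominated_def valuation_ring_eq
  by (auto simp: v_inv val_ge_def)

lemma value_fractions_dominated:
  assumes "subring B K" "\<And>b. b \<in> B \<Longrightarrow> val_ge 0 b"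
  shows "dominated (value_fractions B {0})"
  unfolding dominated_def
proof (intro conjI ballI impI)
  show "subring (value_fractions B {0}) K" using value_fractions_subring assms by simp
next
  fix s assume "s \<in> value_fractions B {0}"
  then obtain a b where ab: "a \<in> B" "b \<in> B" "b \<noteq> \<zero>" "v b = 0" "s = a \<otimes> inv b"
    by (auto elim!: value_fractionsE)
  have "val_ge (0 + 0) (a \<otimes> inv b)"
    by (rule val_ge_mult) (use ab assms subringE(1)[OF assms(1)] in \<open>auto simp: val_ge_def v_inv\<close>)
  then show "val_ge 0 s" using ab by simp
next
  fix s assume "s \<in> value_fractions B {0}" "s \<noteq> \<zero>" "v s = 0"
  then show "inv s \<in> value_fractions B {0}" using value_fractions_inv[of B "{0}" s] assms by simp
qed

definition chart :: "'a set \<Rightarrow> 'a \<Rightarrow> 'a set" where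
  "chart S a = generate_ring K (S \<union> (\<lambda>u. u \<otimes> inv a) ` {u \<in> S. val_gt 0 u})"

text \<open>The element \<open>a\<close> of the definition has the least value in the maximal ideal, so the chart lies in
  the valuation ring, and localizing it means inverting its elements of value zero.\<close>

lemma local_quadratic_transform_fractions:
  assumes S: "dominated S" and tr: "local_quadratic_transform K (valuation_ring K v) S S'"
    and w: "w \<in> S" "val_gt 0 w" "w \<noteq> \<zero>"
  obtains a B where "a \<in> S" "val_gt 0 a" "a \<noteq> \<zero>" "\<And>u. u \<in> S \<Longrightarrow> val_gt 0 u \<Longrightarrow> val_ge (v a) u"
    "B = chart S a"
    "subring B K" "\<And>b. b \<in> B \<Longrightarrow> val_ge 0 b" "S' = value_fractions B {0}"
proof -
  let ?V = "valuation_ring K v" let ?m = "{s \<in> S. val_gt 0 s}"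
  note V = subring_is_ring[OF valuation_ring_subring]
  have Ss: "subring S K" and SV: "S \<subseteq> ?V" using S by (auto simp: dominated_def valuation_ring_eq)
  have car: "S \<subseteq> carrier K" using subringE(1)[OF Ss] .
  obtain a where a: "a \<in> ?m" "PIdl\<^bsub>sub ?V\<^esub> a = Idl\<^bsub>sub ?V\<^esub> ?m"
    "S' = (let B = generate_ring K (S \<union> (\<lambda>u. u \<otimes> inv a) ` ?m) in
       localization K B (max_ideal (sub ?V) \<inter> B))"
    using tr unfolding local_quadratic_transform_def max_ideal_dominated[OF S] Let_def by auto
  have mult: "\<exists>r\<in>?V. u = r \<otimes> a" if "u \<in> S" "val_gt 0 u" for u
  proof -
    have "u \<in> Idl\<^bsub>sub ?V\<^esub> ?m" using ring.genideal_self[OF V, of ?m] SV that by auto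
    then have "u \<in> PIdl\<^bsub>sub ?V\<^esub> a" unfolding a(2) .
    then show ?thesis unfolding cgenideal_def by auto
  qed
  have a0: "a \<noteq> \<zero>" using mult[OF w(1,2)] w(3) valuation_ring_subring subringE(1) by fastforce
  have ac: "a \<in> carrier K" using a car by auto
  have least: "val_ge (v a) u" if u: "u \<in> S" "val_gt 0 u" for u
  proof -
    obtain r where r: "r \<in> ?V" "u = r \<otimes> a" using mult[OF u] by blast
    show ?thesis using val_ge_mult[of 0 r "v a" a] r ac by (simp add: valuation_ring_eq val_ge_def)
  qed
  define B where "B = chart S a"
  have gens: "S \<union> (\<lambda>u. u \<otimes> inv a) ` ?m \<subseteq> ?V"
  proof -
    have "val_ge 0 (u \<otimes> inv a)" if "u \<in> S" "val_gt 0 u" for u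
      using val_ge_mult[OF least[OF that], of "- v a" "inv a"] ac a0 by (simp add: val_ge_def v_inv)
    then show ?thesis using SV by (auto simp: valuation_ring_eq)
  qed
  have gc: "S \<union> (\<lambda>u. u \<otimes> inv a) ` ?m \<subseteq> carrier K"
    using gens subringE(1)[OF valuation_ring_subring] by blast
  have Bs: "subring B K" unfolding B_def chart_def by (rule generate_ring_is_subring[OF gc])
  have "B \<subseteq> ?V" unfolding B_def chart_def
    by (rule generate_ring_min_subring1[OF gc valuation_ring_subring gens])
  then have BV: "\<And>b. b \<in> B \<Longrightarrow> val_ge 0 b" by (auto simp: valuation_ring_eq)
  have "S' = localization K B ({s \<in> ?V. val_gt 0 s} \<inter> B)"
    using a(3) unfolding B_def chart_def max_ideal_dominated[OF valuation_ring_dominated] Let_def .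
  also have "\<dots> = value_fractions B {0}"
  proof -
    have "b \<in> B - ({s \<in> ?V. val_gt 0 s} \<inter> B) \<longleftrightarrow> b \<in> B \<and> b \<noteq> \<zero> \<and> v b \<in> {0}" for b
      using BV[of b] by (auto simp: valuation_ring_eq val_ge_def val_gt_def)
    then show ?thesis unfolding localization_def value_fractions_def by blast
  qed
  finally have S': "S' = value_fractions B {0}" .
  show thesis
    using that[OF _ _ a0 least B_def Bs BV S'] a by auto
qed

end

section \<open>Parameters of independent values\<close>

locale independent_parameters = real_valued_field K v for K (structure) and v +
  fixes I :: "nat set" and S :: "'a set" and y :: "nat \<Rightarrow> 'a"
  assumes finite_I: "finite I"
    and dominated: "dominated S"
    and y_in: "\<And>l. l \<in> I \<Longrightarrow> y l \<in> S"
    and y_pos: "\<And>l. l \<in> I \<Longrightarrow> val_gt 0 (y l)"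
    and y_nonzero: "\<And>l. l \<in> I \<Longrightarrow> y l \<noteq> \<zero>"
    and generate: "\<And>s. s \<in> S \<Longrightarrow> val_gt 0 s \<Longrightarrow> s \<in> span_over S (y ` I)"
    and independent: "\<And>c :: nat \<Rightarrow> int. (\<Sum>l\<in>I. of_int (c l) * v (y l)) = 0 \<Longrightarrow> \<forall>l\<in>I. c l = 0"
begin

definition mon :: "(nat \<Rightarrow> nat) \<Rightarrow> 'a" where
  "mon a = (\<Otimes>l\<in>I. y l [^] a l)"

definition wt :: "(nat \<Rightarrow> nat) \<Rightarrow> real" where
  "wt a = (\<Sum>l\<in>I. real (a l) * v (y l))"

definition up_closed :: "(nat \<Rightarrow> nat) set \<Rightarrow> bool" where
  "up_closed U \<longleftrightarrow> (\<forall>a\<in>U. \<forall>b. (\<forall>l\<in>I. a l \<le> b l) \<longrightarrow> b \<in> U)"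

lemma subring_S: "subring S K" using dominated by (simp add: dominated_def)

lemma S_carrier: "s \<in> S \<Longrightarrow> s \<in> carrier K" using subringE(1)[OF subring_S] by blast

lemma S_zero: "\<zero> \<in> S" and S_one: "\<one> \<in> S"
  using subringE(2,3)[OF subring_S] by blast+

lemmas S_neg = subringE(5)[OF subring_S]

lemmas S_mult = subringE(6)[OF subring_S]

lemmas S_add = subringE(7)[OF subring_S]

lemma S_val: "s \<in> S \<Longrightarrow> val_ge 0 s" using dominated by (simp add: dominated_def)

lemma S_inv: "s \<in> S \<Longrightarrow> s \<noteq> \<zero> \<Longrightarrow> v s = 0 \<Longrightarrow> inv s \<in> S" using dominated by (simp add: dominated_def)

lemma y_carrier: "l \<in> I \<Longrightarrow> y l \<in> carrier K" using y_in S_carrier by blast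

lemma v_y_pos: "l \<in> I \<Longrightarrow> 0 < v (y l)"
  using y_pos y_nonzero by (auto simp: val_gt_def)

lemma pow_nonzero: "z \<in> carrier K \<Longrightarrow> z \<noteq> \<zero> \<Longrightarrow> z [^] (n::nat) \<noteq> \<zero>"
  by (induct n) (auto simp: nonzero_mult)

lemma v_pow: "z \<in> carrier K \<Longrightarrow> z \<noteq> \<zero> \<Longrightarrow> v (z [^] (n::nat)) = real n * v z"
  by (induct n) (auto simp: v_mult pow_nonzero algebra_simps)

lemma prod_pow_props:
  assumes "finite J" "J \<subseteq> I"
  shows "(\<Otimes>l\<in>J. y l [^] a l) \<in> S \<and> (\<Otimes>l\<in>J. y l [^] a l) \<noteq> \<zero> \<and>
    v (\<Otimes>l\<in>J. y l [^] (a l :: nat)) = (\<Sum>l\<in>J. real (a l) * v (y l))"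
  using assms
proof (induct J)
  case empty
  then show ?case using S_one by simp
next
  case (insert j J)
  have pc: "y l [^] n \<in> S" if "l \<in> I" for l and n :: nat
    using that by (induct n) (auto simp: S_one intro: S_mult y_in)
  have "(\<Otimes>l\<in>insert j J. y l [^] a l) = y j [^] a j \<otimes> (\<Otimes>l\<in>J. y l [^] a l)"
    using insert y_carrier by (intro finprod_insert) auto
  then show ?case
    using insert pc[of j "a j"] y_nonzero[of j] y_carrier[of j]
    by (simp add: S_mult nonzero_mult S_carrier v_mult pow_nonzero v_pow)
qed

lemma mon_in: "mon a \<in> S"
  and mon_nonzero: "mon a \<noteq> \<zero>"
  and v_mon: "v (mon a) = wt a"
  using prod_pow_props[OF finite_I subset_refl, of a] by (auto simp: mon_def wt_def)

lemma mon_carrier: "mon a \<in> carrier K" using mon_in S_carrier by blast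

lemma mon_cong: "(\<And>l. l \<in> I \<Longrightarrow> a l = b l) \<Longrightarrow> mon a = mon b"
  unfolding mon_def by (rule finprod_cong') (auto simp: y_carrier)

lemma mon_add: "mon (\<lambda>l. a l + b l) = mon a \<otimes> mon b"
proof -
  have "mon (\<lambda>l. a l + b l) = (\<Otimes>l\<in>I. y l [^] a l \<otimes> y l [^] b l)"
    unfolding mon_def by (rule finprod_cong') (auto simp: y_carrier nat_pow_mult)
  also have "\<dots> = mon a \<otimes> mon b" unfolding mon_def
    by (rule finprod_multf) (auto simp: y_carrier)
  finally show ?thesis .
qed

lemma mon_zero: "mon (\<lambda>l. 0) = \<one>"
  unfolding mon_def by (simp add: finprod_one_eqI)

lemma mon_unit: "k \<in> I \<Longrightarrow> mon (\<lambda>l. if l = k then 1 else 0) = y k"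
proof -
  assume k: "k \<in> I"
  have "mon (\<lambda>l. if l = k then 1 else 0) = (\<Otimes>l\<in>I. if k = l then y l else \<one>)"
    unfolding mon_def by (rule finprod_cong') (auto simp: y_carrier)
  also have "\<dots> = y k" by (rule finprod_singleton) (use k finite_I y_carrier in auto)
  finally show ?thesis .
qed

lemma wt_add: "wt (\<lambda>l. a l + b l) = wt a + wt b"
  by (simp add: wt_def sum.distrib algebra_simps)

lemma wt_nonneg: "0 \<le> wt a"
  unfolding wt_def by (intro sum_nonneg) (simp add: less_imp_le v_y_pos)

text \<open>This is where independence enters: a monomial is determined by its value.\<close>

lemma wt_eq_imp: "wt a = wt b \<Longrightarrow> l \<in> I \<Longrightarrow> a l = b l"
proof -
  assume e: "wt a = wt b" and l: "l \<in> I"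
  have "(\<Sum>l\<in>I. of_int (int (a l) - int (b l)) * v (y l)) = wt a - wt b"
    by (simp add: wt_def sum_subtractf left_diff_distrib)
  then have "\<forall>l\<in>I. int (a l) - int (b l) = 0" using e by (intro independent) simp
  then show ?thesis using l by simp
qed

lemma wt_bound: "l \<in> I \<Longrightarrow> real (a l) * v (y l) \<le> wt a"
  unfolding wt_def using finite_I
  by (intro member_le_sum) (auto simp: less_imp_le v_y_pos)

text \<open>All parameters have positive value, so a bound on the weight bounds each exponent. The weights
  below a bound thus serve as a measure for inductions on leading terms.\<close>

lemma finite_weights: "finite {wt a | a. wt a \<le> t}"
proof -
  define N where "N = (\<Sum>l\<in>I. nat \<lceil>t / v (y l)\<rceil>)"
  have "{wt a | a. wt a \<le> t} \<subseteq> wt ` (I \<rightarrow>\<^sub>E {..N})"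
  proof safe
    fix a assume a: "wt a \<le> t"
    have "a l \<le> N" if l: "l \<in> I" for l
    proof -
      have "real (a l) * v (y l) \<le> t" using wt_bound[OF l, of a] a by simp
      then have "real (a l) \<le> t / v (y l)" using v_y_pos[OF l] by (simp add: field_simps)
      then have "a l \<le> nat \<lceil>t / v (y l)\<rceil>" by linarith
      also have "\<dots> \<le> N" unfolding N_def using l finite_I by (intro member_le_sum) auto
      finally show ?thesis .
    qed
    then have "restrict a I \<in> I \<rightarrow>\<^sub>E {..N}" by auto
    moreover have "wt (restrict a I) = wt a" unfolding wt_def by (rule sum.cong) auto
    ultimately show "wt a \<in> wt ` (I \<rightarrow>\<^sub>E {..N})" by (metis imageI)
  qed
  then show ?thesis using finite_I by (meson finite_PiE finite_atMost finite_imageI finite_subset)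
qed

section \<open>Leading monomials\<close>

lemma up_closedD: "up_closed U \<Longrightarrow> a \<in> U \<Longrightarrow> (\<And>l. l \<in> I \<Longrightarrow> a l \<le> b l) \<Longrightarrow> b \<in> U"
  unfolding up_closed_def by blast

definition Mon :: "(nat \<Rightarrow> nat) set \<Rightarrow> 'a set" where
  "Mon U = span_over S (mon ` U)"

lemma mon_image: "mon ` U \<subseteq> carrier K" using mon_carrier by blast

lemmas Mon_zero = span_over.zero[of S "mon ` U" for U, folded Mon_def]
lemmas Mon_add = span_over_add[OF subring_S mon_image, folded Mon_def]
lemmas Mon_minus = span_over_minus[OF subring_S mon_image, folded Mon_def]
lemmas Mon_smult = span_over_smult[OF subring_S mon_image, folded Mon_def]
lemmas Mon_carrier = span_over_carrier[OF subring_S mon_image, folded Mon_def]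

lemma Mon_mono: "f \<in> Mon U \<Longrightarrow> U \<subseteq> U' \<Longrightarrow> f \<in> Mon U'"
  unfolding Mon_def by (rule span_over_mono) auto

lemma Mon_single: "s \<in> S \<Longrightarrow> a \<in> U \<Longrightarrow> s \<otimes> mon a \<in> Mon U"
  unfolding Mon_def by (rule span_over_single[OF mon_image subring_S]) auto

lemma Mon_least:
  assumes "f \<in> Mon U" "\<zero> \<in> M" "\<And>s a h. s \<in> S \<Longrightarrow> a \<in> U \<Longrightarrow> h \<in> M \<Longrightarrow> s \<otimes> mon a \<oplus> h \<in> M"
  shows "f \<in> M"
  using span_over_least[of f S "mon ` U" M] assms unfolding Mon_def by blast

lemma Mon_subset: "f \<in> Mon U \<Longrightarrow> f \<in> S"
  by (erule Mon_least) (auto simp: S_zero S_mult S_add mon_in)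

lemma Mon_UNIV: "f \<in> S \<Longrightarrow> f \<in> Mon UNIV"
  using Mon_single[of f "\<lambda>l. 0" UNIV] by (simp add: mon_zero S_carrier)

lemma Mon_val_gt: "f \<in> Mon U \<Longrightarrow> (\<And>a. a \<in> U \<Longrightarrow> t < wt a) \<Longrightarrow> val_gt t f"
proof -
  assume f: "f \<in> Mon U" and t: "\<And>a. a \<in> U \<Longrightarrow> t < wt a"
  have "f \<in> {f. val_gt t f}"
  proof (rule Mon_least[OF f], goal_cases)
    case (2 s a h)
    have "val_gt (0 + t) (s \<otimes> mon a)"
      using 2 t by (intro val_ge_gt_mult S_val) (auto simp: val_gt_def v_mon mon_carrier)
    then show ?case using 2 by (auto intro: val_gt_add)
  qed auto
  then show ?thesis by simp
qed

lemma Mon_split: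
  assumes "f \<in> Mon U"
  obtains s g where "s \<in> S" "g \<in> Mon {a \<in> U. wt a \<noteq> wt a0}" "f = s \<otimes> mon a0 \<oplus> g"
proof -
  let ?U = "{a \<in> U. wt a \<noteq> wt a0}"
  have "f \<in> {f. \<exists>s\<in>S. \<exists>g\<in>Mon ?U. f = s \<otimes> mon a0 \<oplus> g}"
  proof (rule Mon_least[OF assms], goal_cases)
    case 1
    have "\<zero> = \<zero> \<otimes> mon a0 \<oplus> \<zero>" using mon_carrier by simp
    then show ?case using S_zero Mon_zero by blast
  next
    case (2 s a h)
    then obtain t g where t: "t \<in> S" "g \<in> Mon ?U" "h = t \<otimes> mon a0 \<oplus> g" by auto
    have car: "s \<in> carrier K" "t \<in> carrier K" "g \<in> carrier K" "mon a \<in> carrier K" "mon a0 \<in> carrier K"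
      using 2 t S_carrier Mon_carrier mon_carrier by auto
    show ?case
    proof (cases "wt a = wt a0")
      case True
      then have "mon a = mon a0" using wt_eq_imp by (intro mon_cong)
      then have "s \<otimes> mon a \<oplus> h = (s \<oplus> t) \<otimes> mon a0 \<oplus> g"
        using t(3) car by (simp add: l_distr a_assoc)
      then show ?thesis using t 2 S_add by blast
    next
      case False
      have "s \<otimes> mon a \<oplus> h = t \<otimes> mon a0 \<oplus> (s \<otimes> mon a \<oplus> g)"
        using t(3) car by (simp add: a_lcomm)
      moreover have "s \<otimes> mon a \<oplus> g \<in> Mon ?U" using 2 t False by (intro Mon_add Mon_single) auto
      ultimately show ?thesis using t by blast
    qed
  qed
  then show thesis using that by blast
qed

text \<open>A coefficient of positive value is a combination of the parameters, hence it moves a term to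
  larger weights.\<close>

lemma Mon_shift_up:
  assumes "s \<in> S" "val_gt 0 s" "up_closed U" "a \<in> U"
  shows "s \<otimes> mon a \<in> Mon {b \<in> U. wt a < wt b}"
proof -
  have "mon a \<otimes> s \<in> Mon {b \<in> U. wt a < wt b}"
    unfolding Mon_def
  proof (rule span_over_mult[OF subring_S _ generate[OF assms(1,2)]])
    fix s g assume s: "s \<in> S" "g \<in> y ` I"
    then obtain l where l: "l \<in> I" "g = y l" by blast
    let ?b = "\<lambda>k. a k + (if k = l then 1 else 0)"
    have eq: "mon a \<otimes> (s \<otimes> g) = s \<otimes> mon ?b"
      unfolding mon_add mon_unit[OF l(1)] using s l by (simp add: m_lcomm mon_carrier S_carrier y_carrier)
    have "wt ?b = wt a + v (y l)" unfolding wt_add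
      using l v_mon mon_unit by metis
    then have "wt a < wt ?b" using v_y_pos[OF l(1)] by simp
    moreover have "?b \<in> U" by (rule up_closedD[OF assms(3,4)]) simp
    ultimately show "mon a \<otimes> (s \<otimes> g) \<in> span_over S (mon ` {b \<in> U. wt a < wt b})"
      unfolding eq Mon_def[symmetric] by (intro Mon_single s) auto
  qed (use mon_carrier y_carrier subring_S in auto)
  then show ?thesis using assms(1) by (simp add: m_comm mon_carrier S_carrier)
qed

text \<open>Consider the terms of least weight. They share one monomial, so they add up to a single
  coefficient. If it has positive value, the sum is absorbed into terms of larger weight, which can
  happen only finitely often below \<open>v f\<close>. Otherwise the coefficient is a unit, and the remaining
  terms have larger value, so the least weight is \<open>v f\<close>.\<close>

lemma leading_value:
  assumes "up_closed U" "f \<in> Mon U" "f \<noteq> \<zero>"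
  shows "f \<in> Mon {a \<in> U. v f \<le> wt a} \<and> (\<exists>a\<in>U. wt a = v f)"
proof -
  define W where "W t = {wt a | a. a \<in> U \<and> t < wt a \<and> wt a \<le> v f}" for t
  have finW: "finite (W t)" for t
    by (rule finite_subset[OF _ finite_weights[of "v f"]]) (auto simp: W_def)
  have fc: "f \<in> carrier K" using Mon_carrier assms by blast
  have "?thesis" if "f \<in> Mon {a \<in> U. t < wt a}" "card (W t) = n" for n t
    using that
  proof (induct n arbitrary: t rule: less_induct)
    case (less n)
    have "W t \<noteq> {}"
    proof
      assume e: "W t = {}"
      have "val_gt (v f) f" by (rule Mon_val_gt[OF less(2)]) (use e in \<open>force simp: W_def\<close>)
      then show False using assms by (simp add: val_gt_def)
    qed
    then have min: "Min (W t) \<in> W t" using finW by simp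
    then obtain a0 where a0: "Min (W t) = wt a0" "a0 \<in> U" "t < wt a0" "wt a0 \<le> v f"
      unfolding W_def by blast
    have lb: "wt a0 \<le> wt a" if "a \<in> U" "t < wt a" for a
    proof (cases "wt a \<le> v f")
      case True
      then have "wt a \<in> W t" using that by (auto simp: W_def)
      then show ?thesis unfolding a0(1)[symmetric] using finW by (intro Min_le)
    qed (use a0 in simp)
    obtain s g where s: "s \<in> S" and g: "g \<in> Mon {a \<in> {a \<in> U. t < wt a}. wt a \<noteq> wt a0}"
      and f: "f = s \<otimes> mon a0 \<oplus> g" by (rule Mon_split[OF less(2)])
    have g': "g \<in> Mon {a \<in> U. wt a0 < wt a}"
      by (rule Mon_mono[OF g]) (use lb in force)
    show ?case
    proof (cases "val_gt 0 s")
      case True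
      have "f \<in> Mon {a \<in> U. wt a0 < wt a}" unfolding f
        by (rule Mon_add[OF Mon_shift_up[OF s True assms(1) a0(2)] g'])
      moreover have "W (wt a0) \<subset> W t"
      proof
        show "W (wt a0) \<subseteq> W t" using a0 unfolding W_def by auto
        have "wt a0 \<notin> W (wt a0)" unfolding W_def by auto
        moreover have "wt a0 \<in> W t" using min a0(1) by simp
        ultimately show "W (wt a0) \<noteq> W t" by metis
      qed
      then have "card (W (wt a0)) < n" using psubset_card_mono[OF finW] less(3) by blast
      ultimately show ?thesis using less(1) by blast
    next
      case False
      then have s0: "s \<noteq> \<zero>" "v s = 0" using val_ge_0_cases[OF S_val[OF s]] by auto
      have nz: "s \<otimes> mon a0 \<noteq> \<zero>" "v (s \<otimes> mon a0) = wt a0"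
        using s s0 by (simp_all add: nonzero_mult S_carrier mon_carrier mon_nonzero v_mult v_mon)
      have "val_gt (wt a0) g" by (rule Mon_val_gt[OF g']) simp
      then have vf: "v f = wt a0" unfolding f
        using v_add_dominant(2)[of "s \<otimes> mon a0" g] nz s by (simp add: S_carrier mon_carrier)
      have "f \<in> Mon {a \<in> U. v f \<le> wt a}"
        by (rule Mon_mono[OF less(2)]) (use lb vf in auto)
      then show ?thesis using vf a0 by metis
    qed
  qed
  \<comment> \<open>weights are nonnegative, so the bound -1 is no restriction\<close>
  moreover have "f \<in> Mon {a \<in> U. -1 < wt a}"
    by (rule Mon_mono[OF assms(2)]) (use wt_nonneg in \<open>force intro: less_le_trans[of "-1" 0]\<close>)
  ultimately show ?thesis by blast
qed

lemma leading_term: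
  assumes "up_closed U" "f \<in> Mon U" "f \<noteq> \<zero>"
  obtains a c r where "a \<in> U" "wt a = v f" "c \<in> S" "c \<noteq> \<zero>" "v c = 0"
    "r \<in> Mon {b \<in> U. v f < wt b}" "f = c \<otimes> mon a \<oplus> r"
proof -
  obtain a where a: "a \<in> U" "wt a = v f" and f: "f \<in> Mon {a \<in> U. v f \<le> wt a}"
    using leading_value[OF assms] by blast
  obtain c r where c: "c \<in> S" and r: "r \<in> Mon {b \<in> {a \<in> U. v f \<le> wt a}. wt b \<noteq> wt a}"
    and feq: "f = c \<otimes> mon a \<oplus> r" by (rule Mon_split[OF f])
  have r': "r \<in> Mon {b \<in> U. v f < wt b}"
    by (rule Mon_mono[OF r]) (use a in auto)
  have "\<not> val_gt 0 c"
  proof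
    assume "val_gt 0 c"
    then have "f \<in> Mon {b \<in> U. v f < wt b}" unfolding feq
      using Mon_add[OF Mon_shift_up[OF c _ assms(1) a(1)]] r' a(2) feq by simp
    then have "val_gt (v f) f" by (rule Mon_val_gt) simp
    then show False using assms(3) by (simp add: val_gt_def)
  qed
  then show thesis using that[OF a c _ _ r' feq] val_ge_0_cases[OF S_val[OF c]] by blast
qed

lemma up_closed_UNIV: "up_closed UNIV"
  by (simp add: up_closed_def)

lemma val_ge_imp_Mon:
  assumes "f \<in> S" "val_ge t f"
  shows "f \<in> Mon {a. t \<le> wt a}"
proof (cases "f = \<zero>")
  case False
  then have "f \<in> Mon {a \<in> UNIV. v f \<le> wt a}"
    using leading_value[OF up_closed_UNIV Mon_UNIV[OF assms(1)]] by blast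
  then show ?thesis
    by (rule Mon_mono) (use assms False in \<open>auto simp: val_ge_def\<close>)
qed (simp add: Mon_zero)

text \<open>Membership in the closure of the ideal \<open>Mon U\<close> for the topology of the valuation: no reduction
  of \<open>f\<close> by the ideal has a leading monomial outside \<open>U\<close>.\<close>

definition leads_in :: "(nat \<Rightarrow> nat) set \<Rightarrow> 'a \<Rightarrow> bool" where
  "leads_in U f \<longleftrightarrow> (\<forall>j\<in>Mon U. f \<ominus> j = \<zero> \<or> (\<exists>a\<in>U. v (f \<ominus> j) = wt a))"

text \<open>Subtracting leading terms, all of which lie in the ideal, raises the value beyond any bound,
  because only finitely many weights are below it.\<close>

lemma leads_in_approx:
  assumes f: "f \<in> S" and lead: "leads_in U f"
  shows "\<exists>j\<in>Mon U. val_ge t (f \<ominus> j)"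
proof -
  define W where "W j = {wt a | a. v (f \<ominus> j) \<le> wt a \<and> wt a < t}" for j
  have finW: "finite (W j)" for j
    by (rule finite_subset[OF _ finite_weights[of t]]) (auto simp: W_def)
  have fc: "f \<in> carrier K" using S_carrier f by blast
  have "?thesis" if "j \<in> Mon U" "card (W j) = n" for n j
    using that
  proof (induct n arbitrary: j rule: less_induct)
    case (less n)
    have jc: "j \<in> carrier K" using Mon_carrier less by blast
    show ?case
    proof (cases "val_ge t (f \<ominus> j)")
      case False
      then have nz: "f \<ominus> j \<noteq> \<zero>" "v (f \<ominus> j) < t" using fc jc by (auto simp: val_ge_def)
      have fj: "f \<ominus> j \<in> S"
        using f Mon_subset[OF less(2)] S_neg S_add by (simp add: a_minus_def)
      obtain a c r where acr: "wt a = v (f \<ominus> j)" "c \<in> S" "r \<in> Mon {b \<in> UNIV. v (f \<ominus> j) < wt b}"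
        "f \<ominus> j = c \<otimes> mon a \<oplus> r"
        by (rule leading_term[OF up_closed_UNIV Mon_UNIV[OF fj] nz(1)])
      obtain a' where a': "a' \<in> U" "wt a' = v (f \<ominus> j)"
        using lead less(2) nz(1) unfolding leads_in_def by force
      then have ma: "mon a = mon a'" using acr(1) by (intro mon_cong wt_eq_imp) auto
      define j' where "j' = j \<oplus> c \<otimes> mon a"
      have j': "j' \<in> Mon U" unfolding j'_def ma
        using less(2) acr(2) a'(1) by (intro Mon_add Mon_single)
      have rc: "r \<in> carrier K" using Mon_carrier acr(3) by blast
      have mc: "c \<otimes> mon a \<in> carrier K" using acr(2) S_carrier mon_carrier by simp
      have "f \<ominus> j' = (f \<ominus> j) \<ominus> c \<otimes> mon a" unfolding j'_def
        using fc jc mc by (simp add: a_minus_def minus_add a_assoc)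
      also have "\<dots> = r" unfolding acr(4) using mc rc by (simp add: a_minus_def a_ac r_neg)
      finally have fj': "f \<ominus> j' = r" .
      have rgt: "val_gt (v (f \<ominus> j)) r" by (rule Mon_val_gt[OF acr(3)]) simp
      show ?thesis
      proof (cases "r = \<zero>")
        case True
        then show ?thesis using j' fj' by (intro bexI[of _ j']) auto
      next
        case False
        then have lt: "v (f \<ominus> j) < v (f \<ominus> j')" using rgt fj' by (simp add: val_gt_def)
        have "W j' \<subset> W j"
        proof
          show "W j' \<subseteq> W j" unfolding W_def using lt by force
          have "wt a \<in> W j" unfolding W_def by (intro CollectI exI[of _ a]) (use acr(1) nz(2) in auto)
          moreover have "wt a \<notin> W j'" unfolding W_def using acr(1) lt by auto
          ultimately show "W j' \<noteq> W j" by blast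
        qed
        then have "card (W j') < n" using psubset_card_mono[OF finW] less(3) by blast
        then show ?thesis using less(1) j' by blast
      qed
    qed (use less(2) in blast)
  qed
  then show ?thesis using Mon_zero by blast
qed

text \<open>The consequence of Krull's intersection theorem that is transported along the tower, in place of
  the noetherian property.\<close>

definition monomially_closed :: bool where
  "monomially_closed \<longleftrightarrow> (\<forall>U f. up_closed U \<longrightarrow> f \<in> S \<longrightarrow> leads_in U f \<longrightarrow> f \<in> Mon U)"

end

section \<open>Krull's argument for monomial ideals\<close>

lemma (in field) noetherian_maximal:
  assumes "noetherian_ring (sub S)" "F \<noteq> {}" "\<And>J. J \<in> F \<Longrightarrow> ideal J (sub S)"
  obtains M where "M \<in> F" "\<And>J. J \<in> F \<Longrightarrow> M \<subseteq> J \<Longrightarrow> J = M"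
proof -
  have "\<exists>M\<in>F. \<forall>J\<in>F. M \<subseteq> J \<longrightarrow> J = M"
  proof (rule subset_Zorn_nonempty[OF assms(2)])
    fix C assume C: "C \<noteq> {}" "subset.chain F C"
    have mono: "subset.chain B D" if "subset.chain A D" "A \<subseteq> B" for A B D :: "'a set set"
      using that unfolding pred_on.chain_def by blast
    have "F \<subseteq> {J. ideal J (sub S)}" by (rule subsetI) (simp add: assms(3))
    then have "subset.chain {J. ideal J (sub S)} C" by (rule mono[OF C(2)])
    then have "\<Union>C \<in> C" using noetherian_ring.ideal_chain_is_trivial[OF assms(1) C(1)] by blast
    then show "\<Union>C \<in> F" using C(2) unfolding pred_on.chain_def by blast
  qed
  then show thesis using that by blast
qed

context independent_parameters
begin

lemma mon_pow: "k \<in> I \<Longrightarrow> mon (\<lambda>l. if l = k then n else 0) = y k [^] n"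
proof -
  assume k: "k \<in> I"
  have "mon (\<lambda>l. if l = k then n else 0) = (\<Otimes>l\<in>I. if k = l then y l [^] n else \<one>)"
    unfolding mon_def by (rule finprod_cong') (auto simp: y_carrier)
  also have "\<dots> = y k [^] n"
    using finprod_singleton[of k I "\<lambda>l. y l [^] n"] k finite_I y_carrier by auto
  finally show ?thesis .
qed

lemma y_pow_in: "k \<in> I \<Longrightarrow> y k [^] (n::nat) \<in> S"
  using mon_in mon_pow by metis

text \<open>Choose an ideal \<open>C\<close> that is maximal among those that contain \<open>Mon U\<close> and omit \<open>f\<close>. Maximality
  forces \<open>x f\<close> into \<open>C\<close> for every nonunit \<open>x\<close>, and then a power of each parameter. So \<open>C\<close> contains
  all elements of sufficiently large value, among them \<open>f\<close> minus a good approximation from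
  \<open>Mon U\<close>; but then \<open>f\<close> lies in \<open>C\<close>.\<close>

theorem noetherian_monomially_closed:
  assumes noeth: "noetherian_ring (sub S)"
  shows "monomially_closed"
  unfolding monomially_closed_def
proof (intro allI impI)
  fix U f assume U: "up_closed U" and fS: "f \<in> S" and lead: "leads_in U f"
  let ?ideal = "\<lambda>J. ideal J (sub S)"
  note iff = ideal_subring_iff[OF subring_S]
  show "f \<in> Mon U"
  proof (rule ccontr)
    assume notin: "f \<notin> Mon U"
    define F where "F = {J. ?ideal J \<and> Mon U \<subseteq> J \<and> f \<notin> J}"
    have "?ideal (Mon U)" unfolding iff using Mon_subset Mon_zero Mon_add Mon_smult by blast
    then have "Mon U \<in> F" using notin unfolding F_def by simp
    then have "F \<noteq> {}" by auto
    then obtain C where C: "C \<in> F" and maxC: "\<And>J. J \<in> F \<Longrightarrow> C \<subseteq> J \<Longrightarrow> J = C"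
      by (rule noetherian_maximal[OF noeth]) (auto simp: F_def)
    have C_sub: "C \<subseteq> S" and C_zero: "\<zero> \<in> C" and C_add: "\<And>a b. a \<in> C \<Longrightarrow> b \<in> C \<Longrightarrow> a \<oplus> b \<in> C"
      and C_mult: "\<And>s a. s \<in> S \<Longrightarrow> a \<in> C \<Longrightarrow> s \<otimes> a \<in> C" and JC: "Mon U \<subseteq> C" and fC: "f \<notin> C"
      using C unfolding F_def iff by auto
    have C_car: "\<And>a. a \<in> C \<Longrightarrow> a \<in> carrier K" using C_sub S_carrier by blast
    have C_neg: "\<ominus> a \<in> C" if "a \<in> C" for a
      using C_mult[of "\<ominus> \<one>" a] S_one S_neg that C_car by (auto simp: l_minus)
    have adjoin: "\<exists>c\<in>C. \<exists>s\<in>S. f = c \<oplus> s \<otimes> x" if x: "x \<in> S" "x \<notin> C" for x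
    proof (rule ccontr)
      assume n: "\<not> ?thesis"
      let ?J = "{c \<oplus> s \<otimes> x | c s. c \<in> C \<and> s \<in> S}"
      have xc: "x \<in> carrier K" using x S_carrier by blast
      have "?ideal ?J" unfolding iff
      proof (intro conjI ballI)
        show "?J \<subseteq> S" using C_sub x S_mult S_add by auto
        have "\<zero> = \<zero> \<oplus> \<zero> \<otimes> x" using xc by simp
        then show "\<zero> \<in> ?J" using C_zero S_zero by blast
      next
        fix a b assume "a \<in> ?J" "b \<in> ?J"
        then obtain c s c' s' where *: "c \<in> C" "s \<in> S" "a = c \<oplus> s \<otimes> x" "c' \<in> C" "s' \<in> S" "b = c' \<oplus> s' \<otimes> x"
          by blast
        have "a \<oplus> b = (c \<oplus> c') \<oplus> (s \<oplus> s') \<otimes> x"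
          using * xc by (simp add: C_car S_carrier l_distr a_ac)
        then show "a \<oplus> b \<in> ?J" using * C_add S_add by blast
      next
        fix t a assume t: "t \<in> S" and "a \<in> ?J"
        then obtain c s where *: "c \<in> C" "s \<in> S" "a = c \<oplus> s \<otimes> x" by blast
        have "t \<otimes> a = t \<otimes> c \<oplus> (t \<otimes> s) \<otimes> x"
          using * xc t by (simp add: C_car S_carrier r_distr m_assoc)
        then show "t \<otimes> a \<in> ?J" using * t C_mult S_mult by blast
      qed
      moreover have CJ: "C \<subseteq> ?J"
      proof
        fix c assume "c \<in> C"
        moreover then have "c = c \<oplus> \<zero> \<otimes> x" using xc C_car by simp
        ultimately show "c \<in> ?J" using S_zero by blast
      qed
      moreover have "f \<notin> ?J" using n by blast
      ultimately have "?J \<in> F" using JC unfolding F_def by (simp only: mem_Collect_eq) simp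
      then have "?J = C" using maxC CJ by blast
      moreover have "x = \<zero> \<oplus> \<one> \<otimes> x" using xc by simp
      then have "x \<in> ?J" using C_zero S_one by blast
      ultimately show False using x by blast
    qed
    have fc: "f \<in> carrier K" using fS S_carrier by blast
    \<comment> \<open>otherwise \<open>(1 - s x) f\<close> lies in \<open>C\<close> for some \<open>s\<close>, and \<open>1 - s x\<close> is a unit\<close>
    have step: "x \<otimes> f \<in> C" if x: "x \<in> S" "val_gt 0 x" for x
    proof (rule ccontr)
      assume n: "x \<otimes> f \<notin> C"
      have "x \<otimes> f \<in> S" using x fS S_mult by blast
      then obtain c s where c: "c \<in> C" "s \<in> S" "f = c \<oplus> s \<otimes> (x \<otimes> f)" using adjoin n by blast
      define u where "u = \<one> \<oplus> \<ominus> (s \<otimes> x)"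
      have sx: "s \<otimes> x \<in> S" "val_gt 0 (s \<otimes> x)"
        using c x S_mult val_ge_gt_mult[OF S_val[OF c(2)] x(2)] by auto
      have u: "u \<in> S" unfolding u_def using sx S_one S_neg S_add by blast
      have u0: "u \<noteq> \<zero>" "v u = 0"
        using v_add_dominant[of \<one> "\<ominus> (s \<otimes> x)"] val_gt_uminus[OF sx(2)] unfolding u_def by auto
      have sc: "s \<in> carrier K" "x \<in> carrier K" "c \<in> carrier K" using c x S_carrier C_car by auto
      have "u \<otimes> f = f \<ominus> s \<otimes> (x \<otimes> f)" unfolding u_def
        using sc fc by (simp add: l_distr l_minus a_minus_def m_assoc)
      also have "\<dots> = (c \<oplus> s \<otimes> (x \<otimes> f)) \<ominus> s \<otimes> (x \<otimes> f)" using c(3) by simp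
      also have "\<dots> = c" using sc fc by (simp add: a_minus_def a_assoc r_neg)
      finally have uf: "u \<otimes> f = c" .
      have uc: "u \<in> carrier K" using u S_carrier by blast
      have "inv u \<otimes> (u \<otimes> f) = f" using uc u0 fc by (simp add: m_assoc[symmetric])
      then have "f \<in> C" using C_mult[OF S_inv[OF u u0] c(1)] uf by simp
      then show False using fC by simp
    qed
    have pow: "\<exists>n. y l [^] (n::nat) \<in> C" if l: "l \<in> I" for l
    proof -
      \<comment> \<open>the ascending colon ideals of the powers of \<open>y l\<close>, which become stationary\<close>
      define Q where "Q n = {r \<in> S. y l [^] (n::nat) \<otimes> r \<in> C}" for n
      have yc: "y l \<in> carrier K" using l y_carrier by blast
      have Qi: "?ideal (Q n)" for n unfolding iff
      proof (intro conjI ballI)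
        show "Q n \<subseteq> S" by (auto simp: Q_def)
        show "\<zero> \<in> Q n" using yc C_zero S_zero by (simp add: Q_def)
      next
        fix a b assume "a \<in> Q n" "b \<in> Q n"
        then show "a \<oplus> b \<in> Q n"
          using C_add S_add yc by (simp add: Q_def r_distr S_carrier)
      next
        fix s a assume sa: "s \<in> S" "a \<in> Q n"
        then have "s \<otimes> (y l [^] n \<otimes> a) \<in> C" using C_mult by (simp add: Q_def)
        moreover have "s \<otimes> (y l [^] n \<otimes> a) = y l [^] n \<otimes> (s \<otimes> a)"
          using sa yc by (intro m_lcomm) (auto simp: Q_def S_carrier)
        ultimately show "s \<otimes> a \<in> Q n" using sa S_mult by (simp add: Q_def)
      qed
      obtain M where "M \<in> range Q" and max: "\<And>J. J \<in> range Q \<Longrightarrow> M \<subseteq> J \<Longrightarrow> J = M"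
        by (rule noetherian_maximal[OF noeth, of "range Q"]) (auto simp: Qi)
      then obtain n where M: "M = Q n" by blast
      have yl: "y l [^] Suc n \<otimes> r = y l \<otimes> (y l [^] n \<otimes> r)" if "r \<in> carrier K" for r
        using yc that by (simp add: m_ac)
      have "Q n \<subseteq> Q (Suc n)"
        using C_mult[OF y_in[OF l]] yl S_carrier by (auto simp: Q_def)
      then have stable: "Q (Suc n) = Q n" using max[of "Q (Suc n)"] M by blast
      have "y l [^] n \<in> C"
      proof (rule ccontr)
        assume n: "y l [^] n \<notin> C"
        then obtain c s where c: "c \<in> C" "s \<in> S" "f = c \<oplus> s \<otimes> (y l [^] n)"
          using adjoin y_pow_in[OF l] by blast
        have car: "c \<in> carrier K" "s \<in> carrier K" "y l [^] n \<in> carrier K" using c C_car S_carrier yc by auto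
        have "y l \<otimes> f \<in> C" using step[OF y_in y_pos] l by blast
        then have "y l \<otimes> f \<oplus> \<ominus> (y l \<otimes> c) \<in> C" using C_add C_neg C_mult[OF y_in[OF l] c(1)] by blast
        moreover have "y l \<otimes> f \<oplus> \<ominus> (y l \<otimes> c) = y l \<otimes> (y l [^] n \<otimes> s)"
          unfolding c(3) using car yc by (simp add: r_distr a_ac r_neg r_neg2 m_comm del: nat_pow_Suc)
        ultimately have "y l [^] Suc n \<otimes> s \<in> C" using yl car by simp
        then have "s \<in> Q n" using stable c(2) by (auto simp: Q_def)
        then have "s \<otimes> y l [^] n \<in> C" using car by (simp add: Q_def m_comm)
        then show False using c(1,3) C_add fC by simp
      qed
      then show ?thesis by blast
    qed
    then obtain e where e: "\<And>l. l \<in> I \<Longrightarrow> y l [^] (e l :: nat) \<in> C" by metis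
    \<comment> \<open>a monomial of at least this weight has some exponent \<open>a l \<ge> e l\<close>; the summand 1 covers the equality case\<close>
    define t where "t = (\<Sum>l\<in>I. real (e l) * v (y l)) + 1"
    have "Mon {a. t \<le> wt a} \<subseteq> C"
    proof
      fix g assume "g \<in> Mon {a. t \<le> wt a}"
      then show "g \<in> C"
      proof (rule Mon_least[OF _ C_zero])
        fix s a h assume s: "s \<in> S" and a: "a \<in> {a. t \<le> wt a}" and h: "h \<in> C"
        have "\<exists>l\<in>I. e l \<le> a l"
        proof (rule ccontr)
          assume "\<not> ?thesis"
          then have "wt a \<le> (\<Sum>l\<in>I. real (e l) * v (y l))"
            unfolding wt_def by (intro sum_mono mult_right_mono) (auto simp: v_y_pos less_imp_le not_le)
          then show False using a by (simp add: t_def)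
        qed
        then obtain l where l: "l \<in> I" "e l \<le> a l" by blast
        have "mon a = mon (\<lambda>k. (a(l := a l - e l)) k + (if k = l then e l else 0))"
          by (rule mon_cong) (use l in auto)
        then have "mon a = mon (a(l := a l - e l)) \<otimes> y l [^] e l" by (simp only: mon_add mon_pow[OF l(1)])
        then have "mon a \<in> C" using C_mult mon_in e[OF l(1)] by simp
        then show "s \<otimes> mon a \<oplus> h \<in> C" using s h C_add C_mult by blast
      qed
    qed
    moreover obtain j where j: "j \<in> Mon U" "val_ge t (f \<ominus> j)"
      using leads_in_approx[OF fS lead] by blast
    moreover have "f \<ominus> j \<in> S"
      using fS Mon_subset[OF j(1)] S_neg S_add by (simp add: a_minus_def)
    ultimately have "f \<ominus> j \<in> C" using val_ge_imp_Mon by blast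
    then have "(f \<ominus> j) \<oplus> j \<in> C" using C_add JC j(1) by blast
    moreover have "(f \<ominus> j) \<oplus> j = f" using fc C_car JC j(1) by (simp add: a_minus_def a_assoc l_neg subset_iff)
    ultimately show False using fC by simp
  qed
qed

section \<open>One local quadratic transform\<close>

lemma v_y_inj: "k \<in> I \<Longrightarrow> l \<in> I \<Longrightarrow> v (y k) = v (y l) \<Longrightarrow> k = l"
proof (rule ccontr)
  assume kl: "k \<in> I" "l \<in> I" "v (y k) = v (y l)" "k \<noteq> l"
  have "wt (\<lambda>i. if i = k then 1 else 0) = wt (\<lambda>i. if i = l then 1 else 0)"
    using kl mon_unit v_mon by metis
  from wt_eq_imp[OF this kl(1)] show False using kl by simp
qed

lemma unique_minimum:
  assumes "I \<noteq> {}"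
  defines "m \<equiv> THE k. k \<in> I \<and> (\<forall>l\<in>I. v (y k) \<le> v (y l))"
  shows "m \<in> I" "\<And>l. l \<in> I \<Longrightarrow> v (y m) \<le> v (y l)"
proof -
  obtain k where k: "k \<in> I" "\<And>l. l \<in> I \<Longrightarrow> v (y k) \<le> v (y l)"
    using arg_min_if_finite[OF finite_I assms(1), of "\<lambda>l. v (y l)"] by (metis not_le)
  have "m = k" unfolding m_def
    by (rule the_equality) (use k v_y_inj antisym in \<open>blast+\<close>)
  then show "m \<in> I" "\<And>l. l \<in> I \<Longrightarrow> v (y m) \<le> v (y l)" using k by auto
qed

lemma Mon_mult:
  assumes f: "f \<in> Mon U" and g: "g \<in> Mon U'"
    and UU: "\<And>a b. a \<in> U \<Longrightarrow> b \<in> U' \<Longrightarrow> (\<lambda>l. a l + b l) \<in> U''"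
  shows "f \<otimes> g \<in> Mon U''"
proof -
  have "g \<otimes> f \<in> span_over S (mon ` U'')"
  proof (rule span_over_mult[OF subring_S mon_image f[unfolded Mon_def] Mon_carrier[OF g] _ subring_S mon_image])
    fix s h assume s: "s \<in> S" and "h \<in> mon ` U"
    then obtain a where a: "a \<in> U" "h = mon a" by blast
    have "(s \<otimes> h) \<otimes> g \<in> span_over S (mon ` U'')"
    proof (rule span_over_mult[OF subring_S mon_image g[unfolded Mon_def] _ _ subring_S mon_image])
      show "s \<otimes> h \<in> carrier K" using s a S_carrier mon_carrier by simp
      fix t k assume t: "t \<in> S" and "k \<in> mon ` U'"
      then obtain b where b: "b \<in> U'" "k = mon b" by blast
      have "(s \<otimes> h) \<otimes> (t \<otimes> k) = (s \<otimes> t) \<otimes> mon (\<lambda>l. a l + b l)"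
        unfolding mon_add a(2) b(2) using s t by (simp add: m_ac S_carrier mon_carrier)
      also have "\<dots> \<in> Mon U''" using s t UU a b S_mult by (intro Mon_single) auto
      finally show "(s \<otimes> h) \<otimes> (t \<otimes> k) \<in> span_over S (mon ` U'')" by (simp add: Mon_def)
    qed
    then show "g \<otimes> (s \<otimes> h) \<in> span_over S (mon ` U'')"
      using s a Mon_carrier[OF g] by (simp add: m_comm S_carrier mon_carrier)
  qed
  then show ?thesis using Mon_carrier f g by (simp add: Mon_def m_comm)
qed

end

locale quadratic_step = independent_parameters +
  fixes m :: nat and S' :: "'a set"
  assumes m_in: "m \<in> I" and m_min: "\<And>l. l \<in> I \<Longrightarrow> v (y m) \<le> v (y l)"
    and transform: "local_quadratic_transform K (valuation_ring K v) S S'"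
begin

definition z :: "nat \<Rightarrow> 'a" where
  "z = (\<lambda>l. if l = m then y m else y l \<otimes> inv (y m))"

lemma ym: "y m \<in> carrier K" "y m \<noteq> \<zero>" "y m \<in> S" "val_gt 0 (y m)"
  using m_in y_carrier y_nonzero y_in y_pos by auto

lemma m_less: "l \<in> I \<Longrightarrow> l \<noteq> m \<Longrightarrow> v (y m) < v (y l)"
  using m_min[of l] v_y_inj[OF m_in, of l] by force

lemma z_carrier: "l \<in> I \<Longrightarrow> z l \<in> carrier K"
  using ym y_carrier by (simp add: z_def)

lemma z_nonzero: "l \<in> I \<Longrightarrow> z l \<noteq> \<zero>"
  using ym y_carrier y_nonzero by (simp add: z_def nonzero_mult)

lemma v_z: "l \<in> I \<Longrightarrow> v (z l) = (if l = m then v (y m) else v (y l) - v (y m))"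
  using ym y_carrier y_nonzero by (simp add: z_def v_mult v_inv)

lemma y_eq_z: "l \<in> I \<Longrightarrow> y l = z l \<otimes> (if l = m then \<one> else z m)"
  using ym y_carrier by (simp add: z_def inv_cancel)

text \<open>Isolates the coefficient at the parameter of least value; it is a unit exactly when the element
  has the least value possible.\<close>

lemma max_ideal_split:
  assumes "s \<in> S" "val_gt 0 s"
  obtains c g where "c \<in> S" "g \<in> span_over S (y ` (I - {m}))" "s = c \<otimes> y m \<oplus> g"
proof -
  let ?G = "y ` (I - {m})"
  have Gc: "?G \<subseteq> carrier K" using y_carrier by auto
  have "s \<in> {s. \<exists>c\<in>S. \<exists>g\<in>span_over S ?G. s = c \<otimes> y m \<oplus> g}"
  proof (rule span_over_least[OF generate[OF assms]], goal_cases)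
    case 1
    have "\<zero> = \<zero> \<otimes> y m \<oplus> \<zero>" using ym by simp
    then show ?case using S_zero span_over.zero by blast
  next
    case (2 s h f)
    then obtain l where l: "l \<in> I" "h = y l" by blast
    obtain c g where c: "c \<in> S" "g \<in> span_over S ?G" "f = c \<otimes> y m \<oplus> g" using 2 by blast
    have car: "s \<in> carrier K" "c \<in> carrier K" "g \<in> carrier K" "y l \<in> carrier K"
      using 2 c l S_carrier y_carrier span_over_carrier[OF subring_S Gc] by auto
    show ?case
    proof (cases "l = m")
      case True
      have "s \<otimes> h \<oplus> f = (s \<oplus> c) \<otimes> y m \<oplus> g"
        unfolding l(2) c(3) True using car ym by (simp add: l_distr a_assoc)
      then show ?thesis using 2(1) c S_add by blast
    next
      case False
      then have "s \<otimes> y l \<oplus> g \<in> span_over S ?G" using 2(1) c(2) l(1) by (intro span_over.add) auto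
      moreover have "s \<otimes> h \<oplus> f = c \<otimes> y m \<oplus> (s \<otimes> y l \<oplus> g)"
        unfolding l(2) c(3) using car ym by (simp add: a_lcomm)
      ultimately show ?thesis using c by blast
    qed
  qed
  then show thesis using that by blast
qed

lemma val_gt_rest:
  assumes "g \<in> span_over S (y ` (I - {m}))"
  shows "val_gt (v (y m)) g"
proof -
  have "g \<in> {g. val_gt (v (y m)) g}"
  proof (rule span_over_least[OF assms], goal_cases)
    case (2 s h f)
    then obtain l where l: "l \<in> I" "l \<noteq> m" "h = y l" by blast
    have "val_gt (0 + v (y m)) (s \<otimes> y l)"
      using m_less[OF l(1,2)] y_carrier[OF l(1)] 2(1) by (intro val_ge_gt_mult S_val) (auto simp: val_gt_def)
    then show ?case using 2 l by (auto intro: val_gt_add)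
  qed auto
  then show ?thesis by simp
qed

lemma max_ideal_val: "s \<in> S \<Longrightarrow> val_gt 0 s \<Longrightarrow> val_ge (v (y m)) s"
proof -
  assume s: "s \<in> S" "val_gt 0 s"
  obtain c g where "c \<in> S" "g \<in> span_over S (y ` (I - {m}))" "s = c \<otimes> y m \<oplus> g"
    by (rule max_ideal_split[OF s])
  moreover from this have "val_ge (0 + v (y m)) (c \<otimes> y m)"
    using ym by (intro val_ge_mult S_val val_ge_self) auto
  ultimately show ?thesis using val_gt_rest val_gt_imp_ge by (auto intro: val_ge_add)
qed

lemma ideal_value_eq:
  "ideal_value K v (max_ideal (sub S)) = v (y m)"
proof -
  have "y m \<in> {s \<in> S. val_gt 0 s} - {\<zero>}" using ym by simp
  then show ?thesis unfolding ideal_value_def max_ideal_dominated[OF dominated]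
    by (intro Least_equality) (use max_ideal_val in \<open>auto simp: val_ge_def\<close>)
qed

lemma transform_fractions:
  obtains a B where "a \<in> S" "val_gt 0 a" "a \<noteq> \<zero>" "v a = v (y m)"
    "B = chart S a"
    "subring B K" "\<And>b. b \<in> B \<Longrightarrow> val_ge 0 b" "S' = value_fractions B {0}"
proof -
  show thesis
  proof (rule local_quadratic_transform_fractions[OF dominated transform ym(3,4,2)])
    fix a B assume a: "a \<in> S" "val_gt 0 a" "a \<noteq> \<zero>" "\<And>u. u \<in> S \<Longrightarrow> val_gt 0 u \<Longrightarrow> val_ge (v a) u"
      and B: "B = chart S a"
      "subring B K" "\<And>b. b \<in> B \<Longrightarrow> val_ge 0 b" "S' = value_fractions B {0}"
    have "v a = v (y m)"
      using a(4)[OF ym(3,4)] max_ideal_val[OF a(1,2)] ym(2) a(3) by (simp add: val_ge_def)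
    from that[OF a(1,2,3) this B] show thesis .
  qed
qed

lemma S'_dominated: "dominated S'"
proof (rule transform_fractions)
  fix B assume "subring B K" "\<And>b. b \<in> B \<Longrightarrow> val_ge 0 b" "S' = value_fractions B {0}"
  then show ?thesis using value_fractions_dominated by simp
qed

lemma S_subset_S': "S \<subseteq> S'"
proof -
  obtain a B where a: "a \<in> S" "val_gt 0 a" "a \<noteq> \<zero>"
    and B: "B = chart S a"
    "subring B K" "S' = value_fractions B {0}"
    by (rule transform_fractions)
  have "S \<subseteq> B" unfolding B(1) chart_def by (auto intro: generate_ring.incl)
  then show ?thesis using value_fractions_incl[OF B(2), of "{0}"] B(3) by auto
qed

text \<open>The universal property behind all upper bounds for the transform. The defining element of the
  chart is known only up to its value, so quotients by every element of least value are tested.\<close>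

lemma S'_least:
  assumes T: "subring T K" "S \<subseteq> T" and inv: "\<And>t. t \<in> T \<Longrightarrow> t \<noteq> \<zero> \<Longrightarrow> v t = 0 \<Longrightarrow> inv t \<in> T"
    and quot: "\<And>a u. a \<in> S \<Longrightarrow> a \<noteq> \<zero> \<Longrightarrow> v a = v (y m) \<Longrightarrow> u \<in> S \<Longrightarrow> val_gt 0 u \<Longrightarrow> u \<otimes> inv a \<in> T"
  shows "S' \<subseteq> T"
proof -
  obtain a B where a: "a \<in> S" "val_gt 0 a" "a \<noteq> \<zero>" "v a = v (y m)"
    and B: "B = chart S a"
    "subring B K" "S' = value_fractions B {0}"
    by (rule transform_fractions)
  have gens: "S \<union> (\<lambda>u. u \<otimes> inv a) ` {u \<in> S. val_gt 0 u} \<subseteq> T"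
    using T(2) quot[OF a(1,3,4)] by auto
  have gc: "S \<union> (\<lambda>u. u \<otimes> inv a) ` {u \<in> S. val_gt 0 u} \<subseteq> carrier K"
    using gens subringE(1)[OF T(1)] by (rule subset_trans)
  have "B \<subseteq> T" unfolding B(1) chart_def
    by (rule generate_ring_min_subring1[OF gc T(1) gens])
  then show ?thesis unfolding B(3) using T(1) inv by (intro value_fractions_least) auto
qed

lemma S'_subring: "subring S' K" using S'_dominated by (simp add: dominated_def)

lemmas S'_mult = subringE(6)[OF S'_subring]

lemma S'_inv: "s \<in> S' \<Longrightarrow> s \<noteq> \<zero> \<Longrightarrow> v s = 0 \<Longrightarrow> inv s \<in> S'"
  using S'_dominated by (simp add: dominated_def)

text \<open>The transform does not depend on the element of least value that defines the chart, since the
  quotient of two such elements is a unit in it.\<close>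

lemma quot_in_S':
  assumes a: "a \<in> S" "a \<noteq> \<zero>" "v a = v (y m)" and u: "u \<in> S" "val_gt 0 u"
  shows "u \<otimes> inv a \<in> S'"
proof -
  obtain b B where b: "b \<in> S" "val_gt 0 b" "b \<noteq> \<zero>" "v b = v (y m)"
    and B: "B = chart S b"
    "subring B K" "S' = value_fractions B {0}"
    by (rule transform_fractions)
  have q: "w \<otimes> inv b \<in> S'" if "w \<in> S" "val_gt 0 w" for w
  proof -
    have "w \<otimes> inv b \<in> B" unfolding B(1) chart_def using that by (auto intro!: generate_ring.incl)
    then show ?thesis using value_fractions_incl[OF B(2), of "{0}"] B(3) by auto
  qed
  have car: "a \<in> carrier K" "b \<in> carrier K" "u \<in> carrier K" using a b u S_carrier by auto
  have "0 < v (y m)" using v_y_pos[OF m_in] .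
  then have "val_gt 0 a" using a car by (simp add: val_gt_def)
  then have ab: "a \<otimes> inv b \<in> S'" using q a by blast
  have ab0: "a \<otimes> inv b \<noteq> \<zero>" "v (a \<otimes> inv b) = 0" using car a b by (simp_all add: nonzero_mult v_mult v_inv)
  have "inv (a \<otimes> inv b) = b \<otimes> inv a" using car a b by (simp add: inv_mult_K inv_inv_K m_comm)
  then have ba: "b \<otimes> inv a \<in> S'" using S'_inv[OF ab ab0] by simp
  have "(u \<otimes> inv b) \<otimes> (b \<otimes> inv a) = u \<otimes> inv a"
    using car a b by (simp add: m_assoc[symmetric] inv_cancel)
  then show ?thesis using S'_mult[OF q[OF u] ba] by simp
qed

lemma z_in: "l \<in> I \<Longrightarrow> z l \<in> S'"
  using quot_in_S'[OF ym(3,2), of "y l"] y_in y_pos S_subset_S' by (auto simp: z_def)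

lemma z_pos: "l \<in> I \<Longrightarrow> val_gt 0 (z l)"
  using z_carrier[of l] v_z[of l] m_less[of l] v_y_pos[OF m_in] by (auto simp: val_gt_def)

lemma z_image: "z ` I \<subseteq> carrier K" using z_carrier by blast

lemma rest_div_span:
  assumes "g \<in> span_over S (y ` (I - {m}))"
  shows "inv (y m) \<otimes> g \<in> span_over S' (z ` I)"
proof (rule span_over_mult[OF subring_S _ assms _ _ S'_subring z_image])
  show "y ` (I - {m}) \<subseteq> carrier K" using y_carrier by auto
  show "inv (y m) \<in> carrier K" using ym by simp
  fix s h assume s: "s \<in> S" and "h \<in> y ` (I - {m})"
  then obtain l where l: "l \<in> I" "l \<noteq> m" "h = y l" by blast
  have "inv (y m) \<otimes> (s \<otimes> h) = s \<otimes> z l" unfolding z_def l(3)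
    using l s ym y_carrier by (simp add: m_ac S_carrier)
  then show "inv (y m) \<otimes> (s \<otimes> h) \<in> span_over S' (z ` I)"
    using span_over_single[OF z_image S'_subring, of s "z l"] s S_subset_S' l by auto
qed

lemma max_ideal_in_span:
  assumes "s \<in> S" "val_gt 0 s"
  shows "s \<in> span_over S' (z ` I)"
proof (rule span_over_least[OF generate[OF assms] span_over.zero])
  fix s g h assume s: "s \<in> S" and "g \<in> y ` I" and h: "h \<in> span_over S' (z ` I)"
  then obtain l where l: "l \<in> I" "g = y l" by blast
  define t where "t = (if l = m then \<one> else z m)"
  have t: "t \<in> S'" using z_in[OF m_in] subringE(3)[OF S'_subring] by (simp add: t_def)
  have "s \<otimes> g = (s \<otimes> t) \<otimes> z l" unfolding l(2) y_eq_z[OF l(1)] t_def[symmetric]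
    using s t z_carrier[OF l(1)] subringE(1)[OF S'_subring] by (simp add: m_ac S_carrier subset_iff)
  moreover have "s \<otimes> t \<in> S'" using s t S_subset_S' S'_mult by blast
  ultimately show "s \<otimes> g \<oplus> h \<in> span_over S' (z ` I)" using l h by (auto intro: span_over.add)
qed

text \<open>Modulo the new parameters every element of the chart comes from \<open>S\<close>. The elements with this
  property form a ring. A generator \<open>w / a\<close> is the product of \<open>w / y\<^sub>m\<close>, which is congruent to the
  coefficient of \<open>w\<close> at \<open>y\<^sub>m\<close>, and of \<open>y\<^sub>m / a\<close>, which is congruent to the inverse of the coefficient
  of \<open>a\<close> at \<open>y\<^sub>m\<close>.\<close>

lemma S'_mod_span:
  assumes "b \<in> chart S a"
    and a: "a \<in> S" "val_gt 0 a" "a \<noteq> \<zero>" "v a = v (y m)"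
  shows "\<exists>c\<in>S. b \<ominus> c \<in> span_over S' (z ` I)"
proof -
  let ?N = "span_over S' (z ` I)"
  define W where "W = {b \<in> S'. \<exists>c\<in>S. b \<ominus> c \<in> ?N}"
  note N_add = span_over_add[OF S'_subring z_image]
  note N_smult = span_over_smult[OF S'_subring z_image]
  note N_uminus = span_over_uminus[OF S'_subring z_image]
  note S'_carrier = subsetD[OF subringE(1)[OF S'_subring]]
  have SX: "S \<subseteq> W" unfolding W_def
    using S_subset_S' S_carrier span_over.zero[of S' "z ` I"] by (auto simp: a_minus_def r_neg intro!: bexI)
  have X_mult: "b \<otimes> b' \<in> W" if b: "b \<in> W" "b' \<in> W" for b b'
  proof -
    obtain c c' where c: "c \<in> S" "b \<ominus> c \<in> ?N" "c' \<in> S" "b' \<ominus> c' \<in> ?N" "b \<in> S'" "b' \<in> S'"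
      using b unfolding W_def by blast
    have "b \<otimes> b' \<ominus> c \<otimes> c' = b \<otimes> (b' \<ominus> c') \<oplus> c' \<otimes> (b \<ominus> c)"
      using c by (simp add: S_carrier S'_carrier a_minus_def r_distr r_minus a_ac m_comm r_neg1 r_neg2)
    moreover have "b \<otimes> (b' \<ominus> c') \<oplus> c' \<otimes> (b \<ominus> c) \<in> ?N"
      using c S_subset_S' by (intro N_add N_smult) auto
    ultimately have "b \<otimes> b' \<ominus> c \<otimes> c' \<in> ?N" by simp
    moreover have "b \<otimes> b' \<in> S'" "c \<otimes> c' \<in> S"
      using c S'_mult S_mult by auto
    ultimately show ?thesis unfolding W_def by blast
  qed
  have W: "subring W K"
  proof (rule subringI)
    show "W \<subseteq> carrier K" using S'_carrier by (auto simp: W_def)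
    show "\<one> \<in> W" using SX S_one by blast
  next
    fix h assume "h \<in> W"
    moreover have "\<ominus> \<one> \<in> W" using SX S_one S_neg by blast
    ultimately have "\<ominus> \<one> \<otimes> h \<in> W" "h \<in> carrier K" using X_mult S'_carrier by (auto simp: W_def)
    then show "\<ominus> h \<in> W" by (simp add: l_minus)
  next
    fix b b' assume b: "b \<in> W" "b' \<in> W"
    then obtain c c' where c: "c \<in> S" "b \<ominus> c \<in> ?N" "c' \<in> S" "b' \<ominus> c' \<in> ?N" "b \<in> S'" "b' \<in> S'"
      unfolding W_def by blast
    have "(b \<oplus> b') \<ominus> (c \<oplus> c') = (b \<ominus> c) \<oplus> (b' \<ominus> c')"
      using c by (simp add: S_carrier S'_carrier a_minus_def a_ac minus_add)
    then have "(b \<oplus> b') \<ominus> (c \<oplus> c') \<in> ?N" using c N_add by simp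
    moreover have "b \<oplus> b' \<in> S'" "c \<oplus> c' \<in> S"
      using c subringE(7)[OF S'_subring] S_add by auto
    ultimately show "b \<oplus> b' \<in> W" unfolding W_def by blast
    show "b \<otimes> b' \<in> W" using X_mult b by blast
  qed
  have ac: "a \<in> carrier K" using a S_carrier by blast
  have div: "w \<otimes> inv (y m) \<in> W" if w: "w \<in> S" "val_gt 0 w" for w
  proof -
    obtain c g where c: "c \<in> S" "g \<in> span_over S (y ` (I - {m}))" "w = c \<otimes> y m \<oplus> g"
      by (rule max_ideal_split[OF w])
    have gc: "g \<in> carrier K" using val_gt_rest[OF c(2)] val_gt_carrier by blast
    have "w \<otimes> inv (y m) = c \<oplus> inv (y m) \<otimes> g"
      unfolding c(3) using ym gc c(1) by (simp add: l_distr S_carrier inv_cancel' m_comm[of g])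
    then have "w \<otimes> inv (y m) \<ominus> c = inv (y m) \<otimes> g"
      using ym gc c(1) by (simp add: a_minus_def S_carrier a_ac r_neg1 r_neg2)
    then have "w \<otimes> inv (y m) \<ominus> c \<in> ?N" using rest_div_span[OF c(2)] by simp
    then show ?thesis unfolding W_def using quot_in_S'[OF ym(3,2) refl w] c(1) by blast
  qed
  define u where "u = y m \<otimes> inv a"
  have u: "u \<in> S'" unfolding u_def by (rule quot_in_S'[OF a(1,3,4) ym(3,4)])
  have uc: "u \<in> carrier K" using u S'_carrier by blast
  obtain c g where c: "c \<in> S" "g \<in> span_over S (y ` (I - {m}))" "a = c \<otimes> y m \<oplus> g"
    by (rule max_ideal_split[OF a(1,2)])
  have cc: "c \<in> carrier K" and gc: "g \<in> carrier K"
    using c S_carrier val_gt_rest[OF c(2)] val_gt_carrier by auto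
  have "\<not> val_gt 0 c"
  proof
    assume "val_gt 0 c"
    then have "val_gt (0 + v (y m)) (c \<otimes> y m)" using ym by (intro val_gt_ge_mult val_ge_self) auto
    then have "val_gt (v (y m)) a" unfolding c(3) using val_gt_rest[OF c(2)] by (auto intro: val_gt_add)
    then show False using a by (simp add: val_gt_def)
  qed
  then have c0: "c \<noteq> \<zero>" "v c = 0" using val_ge_0_cases[OF S_val[OF c(1)]] by auto
  define n where "n = inv (y m) \<otimes> g"
  have n: "n \<in> ?N" unfolding n_def by (rule rest_div_span[OF c(2)])
  have nc: "n \<in> carrier K" using ym gc by (simp add: n_def)
  have "u \<otimes> (c \<oplus> n) = \<one>"
  proof -
    have "y m \<otimes> (c \<oplus> n) = a"
      unfolding c(3) n_def using ym gc cc by (simp add: r_distr m_assoc[symmetric] m_comm[of c])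
    moreover have "u \<otimes> (c \<oplus> n) = (y m \<otimes> (c \<oplus> n)) \<otimes> inv a"
      unfolding u_def using ym ac a cc nc by (simp add: m_ac)
    ultimately show ?thesis using ac a by simp
  qed
  then have uc1: "u \<otimes> c \<oplus> u \<otimes> n = \<one>" using uc cc nc by (simp add: r_distr)
  have "u \<ominus> inv c = \<ominus> (inv c \<otimes> u \<otimes> n)"
  proof -
    have "inv c = inv c \<otimes> (u \<otimes> c \<oplus> u \<otimes> n)" using uc1 cc c0 by simp
    also have "\<dots> = (inv c \<otimes> c) \<otimes> u \<oplus> inv c \<otimes> u \<otimes> n"
    proof -
      have e: "inv c \<in> carrier K" using cc c0 by simp
      show ?thesis using e uc cc nc by (simp only: r_distr m_ac m_closed)
    qed
    finally have "inv c = u \<oplus> inv c \<otimes> u \<otimes> n" using cc c0 uc by simp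
    then have "u \<ominus> inv c = u \<ominus> (u \<oplus> inv c \<otimes> u \<otimes> n)" by simp
    then show ?thesis using cc c0 uc nc by (simp add: a_minus_def minus_add a_assoc[symmetric] r_neg)
  qed
  moreover have "inv c \<otimes> u \<otimes> n \<in> ?N"
    using S_inv[OF c(1) c0] S_subset_S' u n S'_mult by (intro N_smult) auto
  ultimately have "u \<ominus> inv c \<in> ?N" using N_uminus by simp
  then have uX: "u \<in> W" unfolding W_def using u S_inv[OF c(1) c0] by blast
  have gens: "S \<union> (\<lambda>u. u \<otimes> inv a) ` {u \<in> S. val_gt 0 u} \<subseteq> W"
  proof -
    have "w \<otimes> inv a \<in> W" if w: "w \<in> S" "val_gt 0 w" for w
    proof -
      have "(w \<otimes> inv (y m)) \<otimes> u = (w \<otimes> inv (y m) \<otimes> y m) \<otimes> inv a"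
        unfolding u_def using w ym ac a by (simp add: m_assoc[symmetric] S_carrier)
      then have "(w \<otimes> inv (y m)) \<otimes> u = w \<otimes> inv a" using w ym by (simp add: inv_cancel S_carrier)
      then show ?thesis using X_mult[OF div[OF w] uX] by simp
    qed
    then show ?thesis using SX by auto
  qed
  have "chart S a \<subseteq> W" unfolding chart_def
    by (rule generate_ring_min_subring1[OF subset_trans[OF gens subringE(1)[OF W]] W gens])
  then show ?thesis using assms(1) by (auto simp: W_def)
qed

lemma generate_S':
  assumes "s \<in> S'" "val_gt 0 s"
  shows "s \<in> span_over S' (z ` I)"
proof -
  let ?N = "span_over S' (z ` I)"
  obtain a B where a: "a \<in> S" "val_gt 0 a" "a \<noteq> \<zero>" "v a = v (y m)"
    and B: "B = chart S a"
    "subring B K" "S' = value_fractions B {0}"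
    by (rule transform_fractions)
  obtain b e where be: "b \<in> B" "e \<in> B" "e \<noteq> \<zero>" "v e = 0" "s = b \<otimes> inv e"
    using assms(1) unfolding B(3) by (auto elim!: value_fractionsE)
  have car: "b \<in> carrier K" "e \<in> carrier K" using be subringE(1)[OF B(2)] by auto
  have eS: "e \<in> S'" using be value_fractions_incl[OF B(2), of "{0}"] B(3) by auto
  have "b = s \<otimes> e" unfolding be(5) using car be by (simp add: inv_cancel)
  then have bpos: "val_gt 0 b"
    using val_gt_ge_mult[OF assms(2), of 0 e] be car by (simp add: val_ge_def)
  obtain c where c: "c \<in> S" "b \<ominus> c \<in> ?N" using S'_mod_span[OF _ a] be(1) B(1) by blast
  have cc: "c \<in> carrier K" using c S_carrier by blast
  have "b \<ominus> c \<in> {f. val_gt 0 f}"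
  proof (rule span_over_least[OF c(2)], goal_cases)
    case (2 s g h)
    have "val_ge 0 s" using 2 S'_dominated by (simp add: dominated_def)
    then have "val_gt (0 + 0) (s \<otimes> g)" using 2 z_pos by (intro val_ge_gt_mult) auto
    then show ?case using 2 by (auto intro: val_gt_add)
  qed auto
  then have "val_gt 0 (b \<ominus> (b \<ominus> c))" using val_gt_minus[OF bpos, of "b \<ominus> c"] by simp
  moreover have cb: "b \<ominus> (b \<ominus> c) = c" using car cc by (simp add: a_minus_def minus_add a_assoc[symmetric] r_neg)
  ultimately have "c \<in> ?N" using max_ideal_in_span c(1) by simp
  then have "(b \<ominus> c) \<oplus> c \<in> ?N" using c(2) by (intro span_over_add[OF S'_subring z_image])
  then have "b \<in> ?N" using car cc by (simp add: a_minus_def a_assoc l_neg)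
  then have "inv e \<otimes> b \<in> ?N" using S'_inv[OF eS be(3,4)] by (intro span_over_smult[OF S'_subring z_image])
  then show ?thesis unfolding be(5) using car be by (simp add: m_comm)
qed

text \<open>The exponents with respect to the new and to the old parameters differ by a unimodular
  transformation.\<close>

lemma independent_z:
  fixes c :: "nat \<Rightarrow> int"
  assumes "(\<Sum>l\<in>I. of_int (c l) * v (z l)) = 0"
  shows "\<forall>l\<in>I. c l = 0"
proof -
  define e where "e l = (if l = m then c m - (\<Sum>l\<in>I - {m}. c l) else c l)" for l
  have "(\<Sum>l\<in>I. of_int (c l) * v (z l)) = c m * v (y m) + (\<Sum>l\<in>I - {m}. of_int (c l) * (v (y l) - v (y m)))"
    using m_in finite_I by (subst sum.remove[of _ m]) (auto simp: v_z intro!: sum.cong)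
  also have "\<dots> = (c m - (\<Sum>l\<in>I - {m}. c l)) * v (y m) + (\<Sum>l\<in>I - {m}. of_int (c l) * v (y l))"
    by (simp add: right_diff_distrib sum_subtractf sum_distrib_right left_diff_distrib)
  also have "\<dots> = (\<Sum>l\<in>I. of_int (e l) * v (y l))"
    using m_in finite_I by (subst (2) sum.remove[of _ m]) (auto simp: e_def intro!: sum.cong)
  finally have "\<forall>l\<in>I. e l = 0" using assms independent by simp
  then have rest: "\<forall>l\<in>I - {m}. c l = 0" and "e m = 0" using m_in by (auto simp: e_def split: if_splits)
  moreover have "(\<Sum>l\<in>I - {m}. c l) = 0" using rest by simp
  ultimately have "c m = 0" by (simp add: e_def)
  then show ?thesis using rest by auto
qed

sublocale Z: independent_parameters K v I S' z
  using finite_I S'_dominated z_in z_pos z_nonzero generate_S' independent_z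
  by unfold_locales

section \<open>Monomial ideals under a local quadratic transform\<close>

text \<open>The total transform: \<open>y\<^sub>l = z\<^sub>l z\<^sub>m\<close> for \<open>l \<noteq> m\<close>, so the exponent of \<open>z\<^sub>m\<close> becomes the degree.\<close>

definition lift_exp :: "(nat \<Rightarrow> nat) \<Rightarrow> nat \<Rightarrow> nat" where
  "lift_exp a = a(m := sum a I)"

lemma mon_lift: "mon a = Z.mon (lift_exp a)"
proof -
  have prod: "(\<Otimes>l\<in>J. (if l = m then \<one> else z m) [^] a l) = z m [^] (sum a (J - {m}))"
    if "finite J" for J
    using that
  proof (induct J)
    case (insert j J)
    have zc: "z m \<in> carrier K" using z_carrier m_in by blast
    have "(\<Otimes>l\<in>insert j J. (if l = m then \<one> else z m) [^] a l)
      = (if j = m then \<one> else z m) [^] a j \<otimes> (\<Otimes>l\<in>J. (if l = m then \<one> else z m) [^] a l)"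
      using insert zc by (intro finprod_insert) auto
    then show ?case using insert zc by (simp add: insert_Diff_if nat_pow_mult)
  qed simp
  have "mon a = (\<Otimes>l\<in>I. z l [^] a l \<otimes> (if l = m then \<one> else z m) [^] a l)"
    unfolding mon_def
  proof (rule finprod_cong')
    fix l assume l: "l \<in> I"
    have "z l \<in> carrier K" "(if l = m then \<one> else z m) \<in> carrier K" using z_carrier l m_in by auto
    then show "y l [^] a l = z l [^] a l \<otimes> (if l = m then \<one> else z m) [^] a l"
      unfolding y_eq_z[OF l] by (rule nat_pow_distrib)
  qed (use z_carrier m_in in auto)
  also have "\<dots> = Z.mon a \<otimes> z m [^] (sum a (I - {m}))"
    unfolding Z.mon_def prod[OF finite_I, symmetric]
    by (rule finprod_multf) (use z_carrier m_in in auto)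
  also have "\<dots> = Z.mon (\<lambda>l. a l + (if l = m then sum a (I - {m}) else 0))"
    by (simp only: Z.mon_add Z.mon_pow[OF m_in])
  also have "\<dots> = Z.mon (lift_exp a)"
    by (rule Z.mon_cong) (use finite_I m_in in \<open>auto simp: lift_exp_def sum.remove\<close>)
  finally show ?thesis .
qed

definition deg_ge :: "nat \<Rightarrow> (nat \<Rightarrow> nat) set" where
  "deg_ge N = {a. N \<le> sum a I}"

text \<open>The exponents of the strict transform, in which the factor \<open>y\<^sub>m\<^sup>N\<close> is removed.\<close>

definition strict_exp :: "nat \<Rightarrow> (nat \<Rightarrow> nat) \<Rightarrow> nat \<Rightarrow> nat" where
  "strict_exp N a = a(m := sum a I - N)"

lemma pow_ym: "y m [^] (N::nat) \<in> carrier K" "y m [^] N \<noteq> \<zero>" "v (y m [^] N) = real N * v (y m)"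
  using ym pow_nonzero v_pow by auto

lemma mon_strict: "a \<in> deg_ge N \<Longrightarrow> mon a = Z.mon (strict_exp N a) \<otimes> y m [^] N"
proof -
  assume a: "a \<in> deg_ge N"
  have "Z.mon (strict_exp N a) \<otimes> z m [^] N = Z.mon (\<lambda>l. strict_exp N a l + (if l = m then N else 0))"
    by (simp only: Z.mon_add Z.mon_pow[OF m_in])
  also have "\<dots> = Z.mon (lift_exp a)"
    by (rule Z.mon_cong) (use a in \<open>auto simp: strict_exp_def lift_exp_def deg_ge_def\<close>)
  finally show ?thesis by (simp add: mon_lift z_def)
qed

lemma wt_strict: "a \<in> deg_ge N \<Longrightarrow> wt a = Z.wt (strict_exp N a) + real N * v (y m)"
  using mon_strict[of a N] v_mon[of a] v_mult[of "Z.mon (strict_exp N a)" "y m [^] N"]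
    Z.mon_carrier Z.mon_nonzero Z.v_mon pow_ym by simp

lemma Mon_div:
  assumes f: "f \<in> Mon U" and U: "U \<subseteq> deg_ge N" and U': "\<And>a. a \<in> U \<Longrightarrow> strict_exp N a \<in> U'"
  shows "inv (y m [^] N) \<otimes> f \<in> Z.Mon U'"
  unfolding Z.Mon_def
proof (rule span_over_mult[OF subring_S mon_image f[unfolded Mon_def] _ _ S'_subring Z.mon_image])
  show i: "inv (y m [^] N) \<in> carrier K" using pow_ym by simp
  fix s h assume s: "s \<in> S" and "h \<in> mon ` U"
  then obtain a where a: "a \<in> U" "h = mon a" by blast
  have "h = Z.mon (strict_exp N a) \<otimes> y m [^] N" using mon_strict a U by blast
  then have "inv (y m [^] N) \<otimes> (s \<otimes> h) = s \<otimes> (Z.mon (strict_exp N a) \<otimes> y m [^] N \<otimes> inv (y m [^] N))"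
    using i s pow_ym(1)[of N] Z.mon_carrier[of "strict_exp N a"] by (simp add: m_ac S_carrier)
  also have "\<dots> = s \<otimes> Z.mon (strict_exp N a)" using pow_ym Z.mon_carrier by (simp add: inv_cancel')
  also have "\<dots> \<in> Z.Mon U'" using s a U' S_subset_S' by (intro Z.Mon_single) auto
  finally show "inv (y m [^] N) \<otimes> (s \<otimes> h) \<in> span_over S' (Z.mon ` U')" by (simp add: Z.Mon_def)
qed

text \<open>The chart at \<open>y\<^sub>m\<close>, described through the powers of the maximal ideal so that its elements can be
  moved back to \<open>S\<close>.\<close>

definition blowup :: "'a set" where
  "blowup = {f \<in> carrier K. \<exists>N. f \<otimes> y m [^] N \<in> Mon (deg_ge N)}"

lemma deg_ge_mult: "f \<in> Mon (deg_ge N) \<Longrightarrow> g \<in> Mon (deg_ge N') \<Longrightarrow> f \<otimes> g \<in> Mon (deg_ge (N + N'))"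
  by (erule Mon_mult) (auto simp: deg_ge_def sum.distrib)

lemma pow_deg_ge: "y m [^] N \<in> Mon (deg_ge N)"
proof -
  have "\<one> \<otimes> mon (\<lambda>l. if l = m then N else 0) \<in> Mon (deg_ge N)"
    using S_one m_in finite_I by (intro Mon_single) (auto simp: deg_ge_def)
  then show ?thesis using mon_pow[OF m_in] pow_ym by simp
qed

lemma blowup_subring: "subring blowup K"
proof (rule subringI)
  show "blowup \<subseteq> carrier K" by (auto simp: blowup_def)
  have "\<one> \<otimes> y m [^] (0::nat) \<in> Mon (deg_ge 0)" using pow_deg_ge[of 0] by simp
  then show "\<one> \<in> blowup" unfolding blowup_def by blast
next
  fix h assume "h \<in> blowup"
  then obtain N where N: "h \<in> carrier K" "h \<otimes> y m [^] N \<in> Mon (deg_ge N)" by (auto simp: blowup_def)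
  have "(\<ominus> \<one>) \<otimes> (h \<otimes> y m [^] N) \<in> Mon (deg_ge N)"
    using S_one S_neg by (intro Mon_smult N) auto
  then have "(\<ominus> h) \<otimes> y m [^] N \<in> Mon (deg_ge N)" using N pow_ym by (simp add: l_minus)
  then show "\<ominus> h \<in> blowup" using N by (auto simp: blowup_def)
next
  fix f g assume "f \<in> blowup" "g \<in> blowup"
  then obtain N M where f: "f \<in> carrier K" "f \<otimes> y m [^] N \<in> Mon (deg_ge N)"
    and g: "g \<in> carrier K" "g \<otimes> y m [^] M \<in> Mon (deg_ge M)" by (auto simp: blowup_def)
  have p: "y m [^] (N + M) = y m [^] N \<otimes> y m [^] M" using ym by (simp add: nat_pow_mult)
  have "(f \<otimes> g) \<otimes> y m [^] (N + M) = (f \<otimes> y m [^] N) \<otimes> (g \<otimes> y m [^] M)"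
    unfolding p using f(1) g(1) pow_ym(1)[of N] pow_ym(1)[of M] by (simp add: m_ac)
  then have "(f \<otimes> g) \<otimes> y m [^] (N + M) \<in> Mon (deg_ge (N + M))" using deg_ge_mult[OF f(2) g(2)] by simp
  then show "f \<otimes> g \<in> blowup" using f g unfolding blowup_def by blast
  have 1: "(f \<otimes> y m [^] N) \<otimes> y m [^] M \<in> Mon (deg_ge (N + M))"
    by (rule deg_ge_mult[OF f(2) pow_deg_ge])
  have 2: "(g \<otimes> y m [^] M) \<otimes> y m [^] N \<in> Mon (deg_ge (N + M))"
    using deg_ge_mult[OF g(2) pow_deg_ge, of N] by (simp add: add.commute)
  have "(f \<oplus> g) \<otimes> y m [^] (N + M) = (f \<otimes> y m [^] N) \<otimes> y m [^] M \<oplus> (g \<otimes> y m [^] M) \<otimes> y m [^] N"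
    unfolding p using f(1) g(1) pow_ym(1)[of N] pow_ym(1)[of M] by (subst l_distr) (simp_all add: m_ac)
  then have "(f \<oplus> g) \<otimes> y m [^] (N + M) \<in> Mon (deg_ge (N + M))" using Mon_add[OF 1 2] by simp
  then show "f \<oplus> g \<in> blowup" using f g unfolding blowup_def by blast
qed

lemma S_subset_blowup: "S \<subseteq> blowup"
proof
  fix s assume s: "s \<in> S"
  have "s \<otimes> y m [^] (0::nat) \<in> Mon (deg_ge 0)" by (rule Mon_smult[OF pow_deg_ge s])
  then show "s \<in> blowup" using s S_carrier unfolding blowup_def by blast
qed

lemma max_ideal_deg: "s \<in> S \<Longrightarrow> val_gt 0 s \<Longrightarrow> s \<in> Mon (deg_ge 1)"
proof -
  assume s: "s \<in> S" "val_gt 0 s"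
  show ?thesis
  proof (rule span_over_least[OF generate[OF s]])
    fix s g h assume s: "s \<in> S" and "g \<in> y ` I" and h: "h \<in> Mon (deg_ge 1)"
    then obtain l where l: "l \<in> I" "g = y l" by blast
    have "s \<otimes> mon (\<lambda>k. if k = l then 1 else 0) \<in> Mon (deg_ge 1)"
      using s l(1) finite_I by (intro Mon_single) (auto simp: deg_ge_def)
    then show "s \<otimes> g \<oplus> h \<in> Mon (deg_ge 1)" using h l mon_unit Mon_add by simp
  qed (rule Mon_zero)
qed

lemma div_in_blowup: "w \<in> S \<Longrightarrow> val_gt 0 w \<Longrightarrow> w \<otimes> inv (y m) \<in> blowup"
proof -
  assume w: "w \<in> S" "val_gt 0 w"
  have c: "w \<otimes> inv (y m) \<in> carrier K" using w ym S_carrier by simp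
  have "w \<otimes> inv (y m) \<otimes> y m [^] (1::nat) = w" using w ym S_carrier by (simp add: inv_cancel)
  then have "w \<otimes> inv (y m) \<otimes> y m [^] (1::nat) \<in> Mon (deg_ge 1)" using max_ideal_deg[OF w] by simp
  then show ?thesis using c unfolding blowup_def by blast
qed

lemma blowup_subset_S': "blowup \<subseteq> S'"
proof
  fix f assume "f \<in> blowup"
  then obtain N where f: "f \<in> carrier K" "f \<otimes> y m [^] N \<in> Mon (deg_ge N)" by (auto simp: blowup_def)
  have "inv (y m [^] N) \<otimes> (f \<otimes> y m [^] N) \<in> Z.Mon UNIV" by (rule Mon_div[OF f(2)]) auto
  then show "f \<in> S'" using Z.Mon_subset inv_cancel_left[OF f(1) pow_ym(1,2)[of N]] by metis
qed

lemma S'_fractions: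
  assumes "F \<in> S'"
  obtains f g where "f \<in> blowup" "g \<in> blowup" "g \<noteq> \<zero>" "v g = 0" "F = f \<otimes> inv g"
proof -
  let ?L = "value_fractions blowup {0}"
  note L = value_fractions_subring[OF blowup_subring, of "{0}"]
  have bL: "blowup \<subseteq> ?L" by (rule value_fractions_incl[OF blowup_subring]) simp
  have "S' \<subseteq> ?L"
  proof (rule S'_least)
    show "subring ?L K" using L by simp
    show "S \<subseteq> ?L" using S_subset_blowup bL by blast
  next
    fix t assume "t \<in> ?L" "t \<noteq> \<zero>" "v t = 0"
    then show "inv t \<in> ?L" using value_fractions_inv[OF blowup_subring, of "{0}" t] by simp
  next
    fix a u assume a: "a \<in> S" "a \<noteq> \<zero>" "v a = v (y m)" and u: "u \<in> S" "val_gt 0 u"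
    have car: "a \<in> carrier K" "u \<in> carrier K" using a u S_carrier by auto
    have "val_gt 0 a" using a car v_y_pos[OF m_in] by (simp add: val_gt_def)
    then have 1: "a \<otimes> inv (y m) \<in> blowup" "u \<otimes> inv (y m) \<in> blowup" using div_in_blowup a u by auto
    have 2: "a \<otimes> inv (y m) \<noteq> \<zero>" "v (a \<otimes> inv (y m)) = 0"
      using a car ym by (simp_all add: nonzero_mult v_mult v_inv)
    have "inv (a \<otimes> inv (y m)) = y m \<otimes> inv a"
      using a car ym by (simp add: inv_mult_K inv_inv_K m_comm[of "inv a"])
    then have "(u \<otimes> inv (y m)) \<otimes> inv (a \<otimes> inv (y m)) = u \<otimes> inv (y m) \<otimes> y m \<otimes> inv a"
      using a car ym by (simp add: m_assoc[symmetric])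
    also have "\<dots> = u \<otimes> inv a" using car ym by (simp add: inv_cancel)
    finally show "u \<otimes> inv a \<in> ?L" using value_fractionsI[OF 1(2,1) 2(1), of "{0}"] 2(2) by simp
  qed
  then have "F \<in> ?L" using assms by blast
  then show thesis by (rule value_fractionsE) (use that in auto)
qed

text \<open>After multiplication by a unit of the transform and by a power \<open>y\<^sub>m\<^sup>N\<close>, an element \<open>F\<close> of the
  closure of \<open>Z.Mon U\<close> becomes an element \<open>G\<close> of the \<open>N\<close>-th power of the maximal ideal of \<open>S\<close>. The
  leading monomial of every reduction of \<open>G\<close> has degree at least \<open>N\<close>, and its strict transform has
  the same value as a monomial of \<open>U\<close>, hence equals it. So \<open>G\<close> lies in the closure of the monomial
  ideal of \<open>S\<close> with the exponents \<open>U1\<close>, which is closed, and dividing by \<open>y\<^sub>m\<^sup>N\<close> leads back.\<close>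

theorem monomially_closed_step:
  assumes closed: monomially_closed
  shows "Z.monomially_closed"
  unfolding Z.monomially_closed_def
proof (intro allI impI)
  fix U F assume U: "Z.up_closed U" and F: "F \<in> S'" and lead: "Z.leads_in U F"
  obtain f g where f: "f \<in> blowup" and g: "g \<in> blowup" "g \<noteq> \<zero>" "v g = 0" and Ffg: "F = f \<otimes> inv g"
    by (rule S'_fractions[OF F])
  obtain N where N: "f \<in> carrier K" "f \<otimes> y m [^] N \<in> Mon (deg_ge N)" using f by (auto simp: blowup_def)
  define p where "p = y m [^] N"
  have p: "p \<in> carrier K" "p \<noteq> \<zero>" "v p = real N * v (y m)" using pow_ym by (auto simp: p_def)
  have gS: "g \<in> S'" using g blowup_subset_S' by blast
  have gc: "g \<in> carrier K" using gS Z.S_carrier by blast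
  have igS: "inv g \<in> S'" using S'_inv[OF gS g(2,3)] .
  define G where "G = f \<otimes> p"
  have G: "G \<in> Mon (deg_ge N)" using N(2) by (simp add: G_def p_def)
  have Gc: "G \<in> carrier K" using Mon_carrier[OF G] .
  define U1 where "U1 = {a \<in> deg_ge N. strict_exp N a \<in> U}"
  have U1N: "U1 \<subseteq> deg_ge N" by (auto simp: U1_def)
  have up: "up_closed U1"
    unfolding up_closed_def
  proof (intro ballI allI impI)
    fix a b assume a: "a \<in> U1" and ab: "\<forall>l\<in>I. a l \<le> b l"
    have le: "sum a I \<le> sum b I" using ab by (intro sum_mono) auto
    have "strict_exp N b \<in> U"
      by (rule Z.up_closedD[OF U, of "strict_exp N a"]) (use a ab le in \<open>auto simp: U1_def strict_exp_def\<close>)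
    then show "b \<in> U1" using a le by (auto simp: U1_def deg_ge_def)
  qed
  have div: "inv p \<otimes> j \<in> Z.Mon U" if "j \<in> Mon U1" for j
    unfolding p_def by (rule Mon_div[OF that U1N]) (simp add: U1_def)
  have "leads_in U1 G"
    unfolding leads_in_def
  proof (intro ballI)
    fix j assume j: "j \<in> Mon U1"
    have jc: "j \<in> carrier K" using Mon_carrier[OF j] .
    show "G \<ominus> j = \<zero> \<or> (\<exists>a\<in>U1. v (G \<ominus> j) = wt a)"
    proof (cases "G \<ominus> j = \<zero>")
      case False
      define e where "e = inv g \<otimes> (inv p \<otimes> j)"
      have e: "e \<in> Z.Mon U" unfolding e_def by (rule Z.Mon_smult[OF div[OF j] igS])
      have ec: "e \<in> carrier K" using Z.Mon_carrier[OF e] .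
      have "(F \<ominus> e) \<otimes> (g \<otimes> p) = (f \<otimes> inv g \<otimes> g) \<otimes> p \<ominus> ((inv g \<otimes> g) \<otimes> (inv p \<otimes> p) \<otimes> j)"
        unfolding Ffg e_def using N(1) gc g(2) p jc inv_closed_K[OF gc g(2)] inv_closed_K[OF p(1,2)]
        by (simp only: a_minus_def l_distr l_minus r_minus m_closed a_inv_closed m_ac)
      also have "\<dots> = G \<ominus> j" unfolding G_def using N(1) gc g(2) p jc by (simp add: inv_cancel)
      finally have eq: "(F \<ominus> e) \<otimes> (g \<otimes> p) = G \<ominus> j" .
      have Fe: "F \<ominus> e \<in> carrier K" using Z.S_carrier[OF F] ec by simp
      have Fe0: "F \<ominus> e \<noteq> \<zero>" using False eq gc p by auto
      then obtain b where b: "b \<in> U" "v (F \<ominus> e) = Z.wt b" using lead e unfolding Z.leads_in_def by blast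
      have vG: "v (G \<ominus> j) = Z.wt b + real N * v (y m)"
        unfolding eq[symmetric] using Fe Fe0 gc g p b by (simp add: v_mult nonzero_mult)
      have Gj: "G \<ominus> j \<in> Mon (deg_ge N)" by (rule Mon_minus[OF G Mon_mono[OF j U1N]])
      have "up_closed (deg_ge N)" unfolding up_closed_def deg_ge_def
        using sum_mono[of I] order_trans by (metis (mono_tags, lifting) mem_Collect_eq)
      then obtain a where a: "a \<in> deg_ge N" "wt a = v (G \<ominus> j)" using leading_value Gj False by blast
      have "Z.wt (strict_exp N a) = Z.wt b" using wt_strict[OF a(1)] a(2) vG by simp
      then have "strict_exp N a l = b l" if "l \<in> I" for l using Z.wt_eq_imp that by blast
      then have "strict_exp N a \<in> U" by (intro Z.up_closedD[OF U b(1)]) simp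
      then have "a \<in> U1" using a by (simp add: U1_def)
      then show ?thesis using a by metis
    qed simp
  qed
  then have "G \<in> Mon U1" using closed up Mon_subset[OF G] unfolding monomially_closed_def by blast
  then have "inv g \<otimes> (inv p \<otimes> G) \<in> Z.Mon U" by (intro Z.Mon_smult[OF div igS])
  moreover have "inv g \<otimes> (inv p \<otimes> G) = F"
    unfolding G_def Ffg inv_cancel_left[OF N(1) p(1,2)] using N(1) gc g(2) by (simp add: m_comm)
  ultimately show "F \<in> Z.Mon U" by simp
qed

end

section \<open>The height one prime generated by a parameter\<close>

context independent_parameters
begin

definition param_ideal :: "nat \<Rightarrow> 'a set" where
  "param_ideal k = {y k \<otimes> h | h. h \<in> S}"

lemma param_ideal_eq_Mon: "k \<in> I \<Longrightarrow> param_ideal k = Mon {a. 1 \<le> a k}"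
proof -
  assume k: "k \<in> I"
  have yc: "y k \<in> carrier K" using y_carrier k by blast
  show ?thesis
  proof
    show "param_ideal k \<subseteq> Mon {a. 1 \<le> a k}"
    proof
      fix f assume "f \<in> param_ideal k"
      then obtain h where h: "h \<in> S" "f = y k \<otimes> h" by (auto simp: param_ideal_def)
      have "h \<otimes> mon (\<lambda>l. if l = k then 1 else 0) \<in> Mon {a. 1 \<le> a k}"
        using h by (intro Mon_single) auto
      then show "f \<in> Mon {a. 1 \<le> a k}" using h yc by (simp only: mon_unit[OF k]) (simp add: m_comm S_carrier)
    qed
    show "Mon {a. 1 \<le> a k} \<subseteq> param_ideal k"
    proof
      fix f assume "f \<in> Mon {a. 1 \<le> a k}"
      then show "f \<in> param_ideal k"
      proof (rule Mon_least)
        have "\<zero> = y k \<otimes> \<zero>" using yc by simp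
        then show "\<zero> \<in> param_ideal k" unfolding param_ideal_def using S_zero by blast
      next
        fix s f and a :: "nat \<Rightarrow> nat" assume s: "s \<in> S" and a: "a \<in> {a. 1 \<le> a k}" and "f \<in> param_ideal k"
        then obtain h where h: "h \<in> S" "f = y k \<otimes> h" by (auto simp: param_ideal_def)
        have "mon a = mon (\<lambda>l. (a(k := a k - 1)) l + (if l = k then 1 else 0))"
          by (rule mon_cong) (use a in auto)
        then have "mon a = mon (a(k := a k - 1)) \<otimes> y k" by (simp only: mon_add mon_unit[OF k])
        then have "s \<otimes> mon a \<oplus> f = y k \<otimes> (s \<otimes> mon (a(k := a k - 1)) \<oplus> h)"
          using s h yc by (simp add: S_carrier mon_carrier r_distr m_ac)
        moreover have "s \<otimes> mon (a(k := a k - 1)) \<oplus> h \<in> S"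
          using s h mon_in S_mult S_add by blast
        ultimately show "s \<otimes> mon a \<oplus> f \<in> param_ideal k" unfolding param_ideal_def by blast
      qed
    qed
  qed
qed

lemma up_closed_param: "k \<in> I \<Longrightarrow> up_closed {a. 1 \<le> a k}"
  by (auto simp: up_closed_def intro: order_trans)

lemma value_is_weight: "f \<in> S \<Longrightarrow> f \<noteq> \<zero> \<Longrightarrow> \<exists>a. wt a = v f"
  using leading_value[OF up_closed_UNIV Mon_UNIV] by blast

lemma param_ideal_weight:
  "k \<in> I \<Longrightarrow> f \<in> param_ideal k \<Longrightarrow> f \<noteq> \<zero> \<Longrightarrow> \<exists>a. 1 \<le> a k \<and> wt a = v f"
  using leading_value[OF up_closed_param[of k]] by (auto simp: param_ideal_eq_Mon)

text \<open>By closedness, an element outside \<open>y\<^sub>k S\<close> has a reduction whose leading monomial is free of \<open>y\<^sub>k\<close>.\<close>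

lemma not_in_param_ideal:
  assumes closed: monomially_closed and k: "k \<in> I" and f: "f \<in> S" "f \<notin> param_ideal k"
  obtains j a where "j \<in> param_ideal k" "f \<ominus> j \<noteq> \<zero>" "a k = 0" "wt a = v (f \<ominus> j)"
proof -
  have "\<not> leads_in {a. 1 \<le> a k} f"
    using closed up_closed_param[OF k] f unfolding monomially_closed_def param_ideal_eq_Mon[OF k] by blast
  then obtain j where j: "j \<in> param_ideal k" "f \<ominus> j \<noteq> \<zero>" "\<And>a. 1 \<le> a k \<Longrightarrow> v (f \<ominus> j) \<noteq> wt a"
    unfolding leads_in_def param_ideal_eq_Mon[OF k] by blast
  have "j \<in> S" using j(1) Mon_subset by (simp add: param_ideal_eq_Mon[OF k])
  then have "f \<ominus> j \<in> S" using f(1) S_neg S_add by (simp add: a_minus_def)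
  then obtain a where a: "wt a = v (f \<ominus> j)" using value_is_weight j(2) by blast
  then have "a k = 0" using j(3)[of a] by (cases "a k") auto
  then show thesis using that j(1,2) a by blast
qed

text \<open>Of two elements outside the ideal take reductions whose leading monomials are free of \<open>y\<^sub>k\<close>. The
  leading monomial of the product of the reductions is free of \<open>y\<^sub>k\<close> as well, so this product, and
  with it the product of the given elements, is outside the ideal.\<close>

theorem param_ideal_prime:
  assumes closed: monomially_closed and k: "k \<in> I"
  shows "primeideal (param_ideal k) (sub S)"
proof (rule primeidealI)
  note iff = ideal_subring_iff[OF subring_S]
  note eq = param_ideal_eq_Mon[OF k]
  have id: "ideal (param_ideal k) (sub S)"
    unfolding iff eq using Mon_subset Mon_zero Mon_add Mon_smult by blast
  show "ideal (param_ideal k) (sub S)" by (rule id)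
  show "cring (sub S)" by (rule subring_cring[OF subring_S])
  have "\<one> \<notin> param_ideal k"
  proof
    assume "\<one> \<in> param_ideal k"
    then obtain a where a: "1 \<le> a k" "wt a = 0" using param_ideal_weight[OF k] by fastforce
    have "wt (\<lambda>l. 0) = 0" by (simp add: wt_def)
    then have "a k = 0" using wt_eq_imp[of a "\<lambda>l. 0" k] a k by simp
    then show False using a by simp
  qed
  then show "carrier (sub S) \<noteq> param_ideal k" using S_one by auto
  fix f g assume fg: "f \<in> carrier (sub S)" "g \<in> carrier (sub S)"
    "f \<otimes>\<^bsub>sub S\<^esub> g \<in> param_ideal k"
  show "f \<in> param_ideal k \<or> g \<in> param_ideal k"
  proof (rule ccontr)
    assume n: "\<not> ?thesis"
    have S: "f \<in> S" "g \<in> S" and prod: "f \<otimes> g \<in> param_ideal k" using fg by auto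
    obtain i a where i: "i \<in> param_ideal k" "f \<ominus> i \<noteq> \<zero>" "a k = 0" "wt a = v (f \<ominus> i)"
      using not_in_param_ideal[OF closed k S(1)] n by metis
    obtain j b where j: "j \<in> param_ideal k" "g \<ominus> j \<noteq> \<zero>" "b k = 0" "wt b = v (g \<ominus> j)"
      using not_in_param_ideal[OF closed k S(2)] n by metis
    have ijS: "i \<in> S" "j \<in> S" using i j Mon_subset by (auto simp: eq)
    have car: "f \<in> carrier K" "g \<in> carrier K" "i \<in> carrier K" "j \<in> carrier K"
      using S ijS S_carrier by auto
    have gj: "g \<ominus> j \<in> S" using S ijS S_neg S_add by (simp add: a_minus_def)
    have "(f \<ominus> i) \<otimes> (g \<ominus> j) = f \<otimes> g \<ominus> (f \<otimes> j \<oplus> (g \<ominus> j) \<otimes> i)"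
      using car by (simp add: a_minus_def l_distr r_distr l_minus r_minus minus_add a_ac m_ac)
    also have "\<dots> \<in> Mon {a. 1 \<le> a k}"
      using Mon_minus[OF prod[unfolded eq] Mon_add[OF Mon_smult[OF _ S(1)] Mon_smult[OF _ gj]]] i(1) j(1)
      unfolding eq by blast
    finally have in_ideal: "(f \<ominus> i) \<otimes> (g \<ominus> j) \<in> param_ideal k" by (simp add: eq)
    moreover have nz: "(f \<ominus> i) \<otimes> (g \<ominus> j) \<noteq> \<zero>" using car i j by (intro nonzero_mult) auto
    ultimately obtain c where c: "1 \<le> c k" "wt c = v ((f \<ominus> i) \<otimes> (g \<ominus> j))"
      using param_ideal_weight[OF k] by blast
    have "wt c = wt (\<lambda>l. a l + b l)" unfolding c(2) wt_add i(4) j(4)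
      using car i j by (intro v_mult) auto
    then have "c k = a k + b k" using wt_eq_imp k by blast
    then show False using c i j by simp
  qed
qed

lemma zero_prime: "primeideal {\<zero>} (sub S)"
proof (rule primeidealI)
  show "ideal {\<zero>} (sub S)"
    unfolding ideal_subring_iff[OF subring_S] using S_zero S_carrier by simp
  show "cring (sub S)" by (rule subring_cring[OF subring_S])
  show "carrier (sub S) \<noteq> {\<zero>}" using S_one by auto
qed (use integral S_carrier in auto)

text \<open>A smaller prime does not contain \<open>y\<^sub>k\<close>. Its nonzero elements could thus be divided by \<open>y\<^sub>k\<close>
  indefinitely, until their values become negative.\<close>

lemma prime_in_param_ideal:
  assumes k: "k \<in> I" and Q: "primeideal Q (sub S)" and sub: "Q \<subset> param_ideal k"
  shows "Q = {\<zero>}"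
proof (rule ccontr)
  assume ne: "Q \<noteq> {\<zero>}"
  have Qi: "ideal Q (sub S)" using Q by (rule primeideal.axioms(1))
  note Q' = Qi[unfolded ideal_subring_iff[OF subring_S]]
  then obtain f where f: "f \<in> Q" "f \<noteq> \<zero>" using ne by blast
  have yk: "y k \<notin> Q"
  proof
    assume yQ: "y k \<in> Q"
    have "param_ideal k \<subseteq> Q"
    proof
      fix g assume "g \<in> param_ideal k"
      then obtain h where h: "h \<in> S" "g = y k \<otimes> h" by (auto simp: param_ideal_def)
      have "h \<otimes> y k \<in> Q" using Q' h yQ by blast
      then show "g \<in> Q" using h k y_carrier S_carrier by (simp add: m_comm)
    qed
    then show False using sub by blast
  qed
  have div: "\<exists>h\<in>Q. h \<noteq> \<zero> \<and> v h = v g - v (y k)" if g: "g \<in> Q" "g \<noteq> \<zero>" for g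
  proof -
    obtain h where h: "h \<in> S" "g = y k \<otimes> h" using g sub by (auto simp: param_ideal_def)
    have h0: "h \<noteq> \<zero>" using g h k y_carrier by auto
    have "y k \<in> Q \<or> h \<in> Q" using primeideal.I_prime[OF Q, of "y k" h] g h k y_in by simp
    then show ?thesis using yk h h0 k y_carrier y_nonzero S_carrier by (intro bexI[of _ h]) (simp_all add: v_mult)
  qed
  have "\<exists>h\<in>Q. h \<noteq> \<zero> \<and> v h = v f - real n * v (y k)" for n
  proof (induct n)
    case (Suc n)
    then show ?case using div by (fastforce simp: algebra_simps)
  qed (use f in auto)
  moreover obtain n where "v f < real n * v (y k)" using reals_Archimedean3[OF v_y_pos[OF k]] by blast
  ultimately obtain h where h: "h \<in> Q" "h \<noteq> \<zero>" "v h < 0" by (metis diff_less_0_iff_less)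
  then have "h \<in> S" using Q' by blast
  then show False using S_val[of h] h by (simp add: val_ge_def)
qed

theorem height_param_ideal:
  assumes closed: monomially_closed and k: "k \<in> I"
  shows "height (sub S) (param_ideal k) = 1"
proof -
  let ?A = "sub S" let ?P = "param_ideal k"
  let ?E = "{enat n | n. \<exists>P. prime_chain ?A n P \<and> P n = ?P}"
  have yP: "y k \<in> ?P"
  proof -
    have "y k = y k \<otimes> \<one>" using k y_carrier by simp
    then show ?thesis using S_one unfolding param_ideal_def by blast
  qed
  have "\<zero> = y k \<otimes> \<zero>" using k y_carrier by simp
  then have "\<zero> \<in> ?P" using S_zero unfolding param_ideal_def by blast
  then have sub: "{\<zero>} \<subset> ?P" using yP y_nonzero[OF k] by blast
  have chain: "prime_chain ?A 1 (\<lambda>i. if i = 0 then {\<zero>} else ?P)"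
    unfolding prime_chain_def using zero_prime param_ideal_prime[OF closed k] sub by simp
  have "1 \<in> ?E"
    by (rule CollectI, rule exI[of _ 1], rule conjI, simp add: one_enat_def,
      rule exI[of _ "\<lambda>i. if i = 0 then {\<zero>} else ?P"], rule conjI, rule chain, simp)
  moreover have "e \<le> 1" if e: "e \<in> ?E" for e
  proof -
    obtain n P where P: "e = enat n" "prime_chain ?A n P" "P n = ?P" using e by blast
    have prime: "\<And>i. i \<le> n \<Longrightarrow> primeideal (P i) ?A" and strict: "\<And>i. i < n \<Longrightarrow> P i \<subset> P (Suc i)"
      using P(2) by (simp_all add: prime_chain_def)
    have "n \<le> 1"
    proof (rule ccontr)
      assume "\<not> n \<le> 1"
      then obtain i where i: "n = Suc (Suc i)" by (metis One_nat_def Suc_le_eq less_imp_Suc_add not_less add_Suc_right)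
      have 1: "P i \<subset> P (Suc i)" "P (Suc i) \<subset> ?P" using strict[of i] strict[of "Suc i"] P(3) i by auto
      have 2: "P (Suc i) = {\<zero>}" using prime_in_param_ideal[OF k prime 1(2)] i by simp
      have "ideal (P i) ?A" using prime[of i] i by (intro primeideal.axioms(1)) simp
      then have 3: "\<zero> \<in> P i" by (simp add: ideal_subring_iff[OF subring_S])
      show False using 1(1) 3 unfolding 2 by blast
    qed
    then show ?thesis using P(1) by (simp add: one_enat_def)
  qed
  ultimately have "Sup ?E = 1" by (intro antisym Sup_least Sup_upper)
  then show ?thesis by (simp only: height_def)
qed

text \<open>The values of the Laurent monomials that are free of \<open>y\<^sub>k\<close>.\<close>

definition span_coeffs :: "nat \<Rightarrow> real set" where
  "span_coeffs k = {\<Sum>l\<in>I - {k}. of_int (c l) * v (y l) | c :: nat \<Rightarrow> int. True}"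

lemma span_coeffs_group: "additive_group (span_coeffs k)"
  unfolding additive_group_def
proof (intro conjI ballI)
  show "0 \<in> span_coeffs k" unfolding span_coeffs_def by (intro CollectI exI[of _ "\<lambda>l. 0"]) simp
next
  fix s t assume "s \<in> span_coeffs k" "t \<in> span_coeffs k"
  then obtain c e where "s = (\<Sum>l\<in>I - {k}. of_int (c l) * v (y l))" "t = (\<Sum>l\<in>I - {k}. of_int (e l) * v (y l))"
    unfolding span_coeffs_def by blast
  then show "s + t \<in> span_coeffs k" unfolding span_coeffs_def
    by (intro CollectI exI[of _ "\<lambda>l. c l + e l"]) (simp add: sum.distrib distrib_right)
next
  fix s assume "s \<in> span_coeffs k"
  then obtain c where "s = (\<Sum>l\<in>I - {k}. of_int (c l) * v (y l))" unfolding span_coeffs_def by blast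
  then show "- s \<in> span_coeffs k" unfolding span_coeffs_def
    by (intro CollectI exI[of _ "\<lambda>l. - c l"]) (simp add: sum_negf)
qed

lemma v_y_in_span: "l \<in> I \<Longrightarrow> l \<noteq> k \<Longrightarrow> v (y l) \<in> span_coeffs k"
  unfolding span_coeffs_def using finite_I
  by (intro CollectI exI[of _ "\<lambda>i. if i = l then 1 else 0"]) (simp add: if_distrib[of of_int] if_distrib[of "\<lambda>x. x * _"] cong: if_cong)

lemma span_not_in_param_ideal:
  assumes k: "k \<in> I" and f: "f \<noteq> \<zero>" "v f \<in> span_coeffs k"
  shows "f \<notin> param_ideal k"
proof
  assume "f \<in> param_ideal k"
  then obtain a where a: "1 \<le> a k" "wt a = v f" using param_ideal_weight[OF k _ f(1)] by blast
  obtain c :: "nat \<Rightarrow> int" where c: "v f = (\<Sum>l\<in>I - {k}. of_int (c l) * v (y l))"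
    using f(2) unfolding span_coeffs_def by blast
  have "(\<Sum>l\<in>I. of_int (int (a l) - (if l = k then 0 else c l)) * v (y l)) = wt a - (\<Sum>l\<in>I - {k}. of_int (c l) * v (y l))"
    unfolding wt_def using finite_I k
    by (subst (1 2) sum.remove[of _ k]) (auto simp: left_diff_distrib sum_subtractf)
  then have "\<forall>l\<in>I. int (a l) - (if l = k then 0 else c l) = 0" using a c by (intro independent) simp
  then show False using k a by auto
qed

lemma height_one_nonzero:
  assumes "height (sub S) P = 1" "primeideal P (sub S)"
  shows "P \<noteq> {\<zero>}"
proof
  assume P: "P = {\<zero>}"
  let ?A = "sub S"
  have "e \<le> 0" if e: "e \<in> {enat n | n. \<exists>C. prime_chain ?A n C \<and> C n = P}" for e
  proof -
    obtain n C where C: "e = enat n" "prime_chain ?A n C" "C n = P" using e by blast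
    have "n = 0"
    proof (rule ccontr)
      assume "n \<noteq> 0"
      then obtain i where i: "n = Suc i" by (cases n) auto
      have 1: "C i \<subset> {\<zero>}" "primeideal (C i) ?A" using C i P by (auto simp: prime_chain_def)
      have "ideal (C i) ?A" by (rule primeideal.axioms(1)[OF 1(2)])
      then have "\<zero> \<in> C i" by (simp add: ideal_subring_iff[OF subring_S])
      then show False using 1(1) by blast
    qed
    then show ?thesis using C by (simp add: zero_enat_def)
  qed
  then have "height ?A P \<le> 0" unfolding height_def by (intro Sup_least)
  then show False using assms by simp
qed

end

section \<open>The fully subtractive algorithm\<close>

text \<open>The values of the variables evolve by the fully subtractive algorithm, in which one entry is
  subtracted from all the others.\<close>

locale fully_subtractive =
  fixes I :: "nat set" and mi :: "nat \<Rightarrow> nat" and p :: "nat \<Rightarrow> nat \<Rightarrow> real"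
  assumes fin: "finite I" and card2: "2 \<le> card I" and mi_in: "\<And>n. mi n \<in> I"
    and p_Suc: "\<And>n l. l \<in> I \<Longrightarrow> p (Suc n) l = (if l = mi n then p n l else p n l - p n (mi n))"
begin

abbreviation total :: "nat \<Rightarrow> real" where
  "total n \<equiv> (\<Sum>l\<in>I. p n l)"

lemma total_Suc: "total (Suc n) = total n - (real (card I) - 1) * p n (mi n)"
proof -
  have "total (Suc n) = p n (mi n) + (\<Sum>l\<in>I - {mi n}. p n l - p n (mi n))"
    using fin mi_in[of n] by (subst sum.remove[of _ "mi n"]) (auto simp: p_Suc intro!: sum.cong)
  also have "\<dots> = p n (mi n) + (\<Sum>l\<in>I - {mi n}. p n l) - (real (card I) - 1) * p n (mi n)"
    using fin mi_in[of n] card2 by (simp add: sum_subtractf of_nat_diff)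
  also have "p n (mi n) + (\<Sum>l\<in>I - {mi n}. p n l) = total n"
    using fin mi_in[of n] by (subst (2) sum.remove[of _ "mi n"]) auto
  finally show ?thesis .
qed

lemma sum_minima: "(real (card I) - 1) * (\<Sum>i<n. p i (mi i)) = total 0 - total n"
  by (induct n) (simp_all add: total_Suc algebra_simps)

text \<open>While \<open>k\<close> is not chosen, the sum of the other entries minus \<open>d - 2\<close> times the entry at \<open>k\<close> does not
  change; if all entries tend to zero, this difference is zero from the start. For independent
  values that is impossible.\<close>

lemma never_minimal_relation:
  assumes lim: "\<And>l. l \<in> I \<Longrightarrow> (\<lambda>n. p n l) \<longlonglongrightarrow> 0" and k: "k \<in> I"
    and never: "\<And>n. j \<le> n \<Longrightarrow> mi n \<noteq> k"
  shows "(\<Sum>l\<in>I - {k}. p j l) = (real (card I) - 2) * p j k"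
proof -
  define D where "D n = total n - (real (card I) - 1) * p n k" for n
  have DD: "D n = (\<Sum>l\<in>I - {k}. p n l) - (real (card I) - 2) * p n k" for n
    unfolding D_def using fin k by (subst sum.remove[of _ k]) (auto simp: algebra_simps)
  have "D (j + n) = D j" for n
  proof (induct n)
    case (Suc n)
    have "D (Suc (j + n)) = D (j + n)"
    proof -
      have e: "p (Suc (j + n)) k = p (j + n) k - p (j + n) (mi (j + n))"
        using p_Suc[OF k, of "j + n"] never[of "j + n"] by auto
      show ?thesis unfolding D_def total_Suc e by (simp add: algebra_simps)
    qed
    then show ?case using Suc by simp
  qed simp
  moreover have "D \<longlonglongrightarrow> (\<Sum>l\<in>I. 0) - (real (card I) - 1) * 0"
    unfolding D_def by (intro tendsto_intros lim k)
  then have "(\<lambda>n. D (n + j)) \<longlonglongrightarrow> 0" by (intro LIMSEQ_ignore_initial_segment) simp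
  ultimately have "(\<lambda>n. D j) \<longlonglongrightarrow> 0" by (simp add: add.commute)
  then have "D j = 0" by (simp add: LIMSEQ_const_iff)
  then show ?thesis using DD[of j] by simp
qed

text \<open>The dynamics dual to the subtractive one, known from Arnoux-Rauzy words: the chosen entry is added
  to all the others.\<close>

definition additive_step :: "(nat \<Rightarrow> nat \<Rightarrow> real) \<Rightarrow> bool" where
  "additive_step x \<longleftrightarrow> (\<forall>n. \<forall>l\<in>I. x (Suc n) l = x n l + (if l = mi n then 0 else x n (mi n)))"

lemma additive_stepD:
  "additive_step x \<Longrightarrow> l \<in> I \<Longrightarrow> x (Suc n) l = x n l + (if l = mi n then 0 else x n (mi n))"
  by (simp add: additive_step_def)

text \<open>In these coordinates the subtractive algorithm changes only the chosen entry, and the pairing with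
  any sequence of additive steps is invariant.\<close>

definition dual :: "nat \<Rightarrow> nat \<Rightarrow> real" where
  "dual n l = total n / (real (card I) - 1) - p n l"

lemma card_pos: "0 < real (card I) - 1" using card2 by simp

lemma dual_Suc: "l \<in> I \<Longrightarrow> dual (Suc n) l = dual n l - (if l = mi n then p n l else 0)"
  using card_pos p_Suc[of l n] by (simp add: dual_def total_Suc diff_divide_distrib)

lemma sum_dual: "(\<Sum>l\<in>I. dual n l) = total n / (real (card I) - 1)"
proof -
  define t where "t = total n"
  have "(\<Sum>l\<in>I. dual n l) = real (card I) * (t / (real (card I) - 1)) - t"
    by (simp add: dual_def sum_subtractf t_def)
  also have "\<dots> = t / (real (card I) - 1)" using card_pos by (simp add: field_simps)
  finally show ?thesis by (simp add: t_def)
qed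

lemma pairing_const:
  assumes x: "additive_step x"
  shows "(\<Sum>l\<in>I. x n l * dual n l) = (\<Sum>l\<in>I. x 0 l * dual 0 l)"
proof (induct n)
  case (Suc n)
  let ?m = "mi n"
  have rest: "(\<Sum>l\<in>I - {?m}. dual n l) = p n ?m"
    using sum_dual[of n] fin mi_in[of n] by (subst (asm) sum.remove[of _ ?m]) (auto simp: dual_def)
  have "(\<Sum>l\<in>I. x (Suc n) l * dual (Suc n) l) =
      x n ?m * (dual n ?m - p n ?m) + (\<Sum>l\<in>I - {?m}. (x n l + x n ?m) * dual n l)"
    using fin mi_in[of n] x
    by (subst sum.remove[of _ ?m]) (auto simp: additive_stepD dual_Suc intro!: sum.cong)
  also have "\<dots> = x n ?m * (dual n ?m - p n ?m) + ((\<Sum>l\<in>I - {?m}. x n l * dual n l) + x n ?m * p n ?m)"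
    unfolding rest[symmetric] by (simp add: algebra_simps sum.distrib sum_distrib_left)
  also have "\<dots> = (\<Sum>l\<in>I. x n l * dual n l)"
    using fin mi_in[of n] by (subst (2) sum.remove[of _ ?m]) (auto simp: algebra_simps)
  finally show ?case using Suc by simp
qed simp

text \<open>Let \<open>m\<close> be the index whose first choice after \<open>a\<close> comes last. When another index \<open>l\<close> is chosen
  before that, the entry at \<open>m\<close> overtakes the one at \<open>l\<close>; afterwards both grow by the same amounts,
  except that \<open>l\<close> may fall behind when it is chosen again. So at its first choice \<open>m\<close> has the largest
  entry.\<close>

lemma dominant_time:
  assumes h: "additive_step h" and pos: "\<And>n l. l \<in> I \<Longrightarrow> 0 < h n l"
    and often: "\<And>k j. k \<in> I \<Longrightarrow> \<exists>n\<ge>j. mi n = k"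
  shows "\<exists>b\<ge>a. \<forall>l\<in>I. h b l \<le> h b (mi b)"
proof -
  define t where "t l = (LEAST n. a \<le> n \<and> mi n = l)" for l
  have t: "a \<le> t l \<and> mi (t l) = l" if "l \<in> I" for l
    unfolding t_def by (rule LeastI_ex) (use often[OF that] in blast)
  have t_le: "t l \<le> n" if "a \<le> n" "mi n = l" for l n
    unfolding t_def by (rule Least_le) (use that in simp)
  have ne: "t ` I \<noteq> {}" using mi_in by auto
  define b where "b = Max (t ` I)"
  have "b \<in> t ` I" unfolding b_def using fin ne by simp
  then obtain m where m: "m \<in> I" "b = t m" by blast
  have mb: "mi b = m" "a \<le> b" using t m by auto
  have "h b l \<le> h b m" if l: "l \<in> I" "l \<noteq> m" for l
  proof -
    have "t l \<le> b" unfolding b_def using fin l by simp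
    moreover have "t l \<noteq> b" using t[OF l(1)] mb(1) l(2) by auto
    ultimately have tl: "Suc (t l) \<le> b" by simp
    have never: "mi n \<noteq> m" if "t l \<le> n" "n < b" for n
      using t_le[of n m] that t[OF l(1)] m(2) by auto
    have "n \<le> b \<Longrightarrow> h n l \<le> h n m" if "Suc (t l) \<le> n" for n
      using that
    proof (induct n rule: dec_induct)
      case base
      show ?case
        using additive_stepD[OF h, of _ "t l"] t[OF l(1)] l m(1) pos[OF m(1), of "t l"]  by auto
    next
      case (step n)
      have "mi n \<noteq> m" using never step by simp
      then have "h (Suc n) m = h n m + h n (mi n)" using additive_stepD[OF h m(1)] by simp
      moreover have "h (Suc n) l \<le> h n l + h n (mi n)"
        using additive_stepD[OF h l(1), of n] pos[OF l(1), of n] by auto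
      ultimately show ?case using step by simp
    qed
    then show ?thesis using tl by simp
  qed
  then show ?thesis using mb by (intro exI[of _ b]) auto
qed

text \<open>A step replaces the ratio \<open>x / h\<close> at each index other than the chosen one by a mean of this ratio
  and the ratio at the chosen index, weighted by \<open>h\<close>. An interval containing all ratios is therefore
  preserved, and its length is halved whenever the chosen index carries the largest weight.\<close>

lemma ratios_converge:
  assumes h: "additive_step h" and x: "additive_step x" and pos: "\<And>n l. l \<in> I \<Longrightarrow> 0 < h n l"
    and often: "\<And>k j. k \<in> I \<Longrightarrow> \<exists>n\<ge>j. mi n = k"
    and start: "\<And>l. l \<in> I \<Longrightarrow> lo * h 0 l \<le> x 0 l \<and> x 0 l \<le> (lo + w) * h 0 l"
  shows "\<exists>n c. \<forall>l\<in>I. c * h n l \<le> x n l \<and> x n l \<le> (c + w / 2 ^ i) * h n l"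
proof (induct i)
  case 0
  show ?case using start by (intro exI[of _ 0] exI[of _ lo]) simp
next
  case (Suc i)
  then obtain n c where c: "\<And>l. l \<in> I \<Longrightarrow> c * h n l \<le> x n l \<and> x n l \<le> (c + w / 2 ^ i) * h n l" by blast
  define e where "e = c + w / 2 ^ i"
  have keep: "\<forall>l\<in>I. c * h (n + k) l \<le> x (n + k) l \<and> x (n + k) l \<le> e * h (n + k) l" for k
  proof (induct k)
    case 0
    then show ?case using c by (simp add: e_def)
  next
    case (Suc k)
    then show ?case using mi_in[of "n + k"]
      by (auto simp: additive_stepD[OF h] additive_stepD[OF x] distrib_left intro!: add_mono)
  qed
  obtain b where b: "n \<le> b" "\<And>l. l \<in> I \<Longrightarrow> h b l \<le> h b (mi b)"
    using dominant_time[OF h pos often] by blast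
  let ?m = "mi b"
  have bd: "c * h b l \<le> x b l \<and> x b l \<le> e * h b l" if "l \<in> I" for l
    using keep[of "b - n"] b(1) that by simp
  define r where "r = x b ?m / h b ?m"
  have hm: "0 < h b ?m" using pos mi_in by simp
  have xm: "x b ?m = r * h b ?m" using hm by (simp add: r_def)
  have rc: "c \<le> r" "r \<le> e" using bd[OF mi_in[of b]] hm unfolding xm by simp_all
  have "(c + r) / 2 * h (Suc b) l \<le> x (Suc b) l \<and> x (Suc b) l \<le> (r + e) / 2 * h (Suc b) l"
    if l: "l \<in> I" for l
  proof (cases "l = ?m")
    case True
    have "(c + r) / 2 * h b ?m \<le> r * h b ?m" "r * h b ?m \<le> (r + e) / 2 * h b ?m"
      using rc hm by (auto intro!: mult_right_mono)
    then show ?thesis using True xm additive_stepD[OF h l, of b] additive_stepD[OF x l, of b] by simp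
  next
    case False
    have "0 \<le> (r - c) * (h b ?m - h b l)" "0 \<le> (e - r) * (h b ?m - h b l)"
      using rc b(2)[OF l] by simp_all
    then have "(c + r) / 2 * (h b l + h b ?m) \<le> c * h b l + r * h b ?m"
      "e * h b l + r * h b ?m \<le> (r + e) / 2 * (h b l + h b ?m)"
      by (simp_all add: field_simps)
    then show ?thesis using False xm bd[OF l] additive_stepD[OF h l, of b] additive_stepD[OF x l, of b] by simp
  qed
  moreover have "(r + e) / 2 = (c + r) / 2 + w / 2 ^ Suc i" by (simp add: e_def field_simps)
  ultimately show ?case by (metis (no_types, lifting))
qed

text \<open>Compare with positive weights \<open>h\<close> that start at 1. Both pairings with the dual coordinates are
  invariant, and these coordinates are nonnegative because they decrease to zero. So the quotient of
  the pairings is a positive mean of the ratios \<open>x / h\<close>, and since the ratios become arbitrarily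
  close to each other, they become positive.\<close>

lemma eventually_positive:
  assumes x: "additive_step x" and lim: "\<And>l. l \<in> I \<Longrightarrow> (\<lambda>n. p n l) \<longlonglongrightarrow> 0"
    and p_nonneg: "\<And>n l. l \<in> I \<Longrightarrow> 0 \<le> p n l"
    and often: "\<And>k j. k \<in> I \<Longrightarrow> \<exists>n\<ge>j. mi n = k"
    and pair: "0 < (\<Sum>l\<in>I. x 0 l * dual 0 l)"
  shows "\<exists>n. \<forall>l\<in>I. 0 < x n l"
proof -
  define h where "h = rec_nat (\<lambda>l. 1 :: real) (\<lambda>n g l. g l + (if l = mi n then 0 else g (mi n)))"
  have h: "additive_step h" by (simp add: additive_step_def h_def)
  have pos: "0 < h n l" for n l
    by (induct n arbitrary: l) (auto simp: h_def intro!: add_pos_pos)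
  have dual_nonneg: "0 \<le> dual n l" if l: "l \<in> I" for n l
  proof -
    have "decseq (\<lambda>n. dual n l)" by (rule decseq_SucI) (use l p_nonneg in \<open>auto simp: dual_Suc\<close>)
    moreover have "(\<lambda>n. dual n l) \<longlonglongrightarrow> (\<Sum>l\<in>I. 0) / (real (card I) - 1) - 0"
      unfolding dual_def by (intro tendsto_intros lim l) (use card_pos in auto)
    ultimately show ?thesis using decseq_ge[of "\<lambda>n. dual n l" 0 n] by simp
  qed
  define g where "g = (\<Sum>l\<in>I. x 0 l * dual 0 l)"
  define H where "H = (\<Sum>l\<in>I. h 0 l * dual 0 l)"
  define w where "w = (\<Sum>l\<in>I. \<bar>x 0 l\<bar>)"
  have bound: "\<bar>x 0 l\<bar> \<le> w" if "l \<in> I" for l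
    unfolding w_def using fin that by (intro member_le_sum) auto
  have start: "- w * h 0 l \<le> x 0 l \<and> x 0 l \<le> (- w + 2 * w) * h 0 l" if "l \<in> I" for l
    using bound[OF that] by (auto simp: h_def abs_le_iff)
  have upper: "g \<le> c * H" if "\<And>l. l \<in> I \<Longrightarrow> x n l \<le> c * h n l" for n c
  proof -
    have "(\<Sum>l\<in>I. x n l * dual n l) \<le> (\<Sum>l\<in>I. c * h n l * dual n l)"
      by (intro sum_mono mult_right_mono that dual_nonneg)
    then show ?thesis
      using pairing_const[OF x, of n] pairing_const[OF h, of n]
      by (simp add: g_def H_def sum_distrib_left[symmetric] mult.assoc)
  qed
  have "0 \<le> H" unfolding H_def using pos by (intro sum_nonneg mult_nonneg_nonneg dual_nonneg) (auto simp: less_imp_le)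
  moreover have "g \<le> w * H" using upper[of 0 w] start by simp
  moreover have g: "0 < g" using pair by (simp add: g_def)
  ultimately have H: "0 < H" by (cases "H = 0") auto
  obtain i where i: "2 * w / 2 ^ i < g / H"
  proof -
    have "(\<lambda>i. 2 * w * (1 / 2) ^ i) \<longlonglongrightarrow> 2 * w * 0"
      by (intro tendsto_intros LIMSEQ_power_zero) simp
    then have "eventually (\<lambda>i. 2 * w * (1 / 2) ^ i < g / H) sequentially"
      by (rule order_tendstoD) (use g H in simp)
    then show thesis using that by (auto simp: eventually_sequentially power_one_over divide_simps)
  qed
  obtain n c where c: "\<And>l. l \<in> I \<Longrightarrow> c * h n l \<le> x n l \<and> x n l \<le> (c + 2 * w / 2 ^ i) * h n l"
    using ratios_converge[OF h x pos often start] by blast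
  have "g \<le> (c + 2 * w / 2 ^ i) * H" by (rule upper) (use c in blast)
  then have "g / H \<le> c + 2 * w / 2 ^ i" using H by (simp add: pos_divide_le_eq)
  then have "0 < c" using i by simp
  then have "0 < x n l" if "l \<in> I" for l
    using c[OF that] pos[of n l] by (meson less_le_trans mult_pos_pos)
  then show ?thesis by blast
qed

lemma additive_step_positive:
  assumes x: "additive_step x" and pos: "\<And>l. l \<in> I \<Longrightarrow> 0 < x n l" and "n \<le> k" "l \<in> I"
  shows "0 < x k l"
  using assms(3,4)
proof (induct k arbitrary: l rule: dec_induct)
  case (step k)
  then show ?case using additive_stepD[OF x step(4), of k] mi_in[of k] by (auto intro: add_pos_pos)
qed (use pos in auto)

text \<open>\<open>e\<close> is the exponent vector of a Laurent monomial of positive value. The differences of the degree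
  and the single exponents make additive steps, so they become and remain positive; then the degree
  is positive too. An index that is chosen from then on receives the degree as its exponent.\<close>

theorem exponents_eventually_nonneg:
  assumes lim: "\<And>l. l \<in> I \<Longrightarrow> (\<lambda>n. p n l) \<longlonglongrightarrow> 0"
    and p_nonneg: "\<And>n l. l \<in> I \<Longrightarrow> 0 \<le> p n l"
    and often: "\<And>k j. k \<in> I \<Longrightarrow> \<exists>n\<ge>j. mi n = k"
    and e_Suc: "\<And>n l. l \<in> I \<Longrightarrow> e (Suc n) l = (if l = mi n then (\<Sum>l\<in>I. e n l) else e n l)"
    and value_pos: "0 < (\<Sum>l\<in>I. e 0 l * p 0 l)"
  shows "\<exists>n0. \<forall>n\<ge>n0. \<forall>l\<in>I. 0 \<le> e n l"
proof -
  define E where "E n = (\<Sum>l\<in>I. e n l)" for n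
  define x where "x n l = E n - e n l" for n l
  have E_Suc: "E (Suc n) = E n + x n (mi n)" for n
  proof -
    have "E (Suc n) = E n + (\<Sum>l\<in>I - {mi n}. e n l)"
      unfolding E_def using fin mi_in[of n]
      by (subst sum.remove[of _ "mi n"]) (auto simp: e_Suc intro!: sum.cong)
    then show ?thesis unfolding x_def E_def using fin mi_in[of n] by (simp add: sum_diff1)
  qed
  have x: "additive_step x"
    unfolding additive_step_def using E_Suc e_Suc by (auto simp: x_def E_def)
  have "(\<Sum>l\<in>I. x 0 l * dual 0 l) = E 0 * (\<Sum>l\<in>I. dual 0 l) - (\<Sum>l\<in>I. e 0 l * dual 0 l)"
    by (simp add: x_def left_diff_distrib sum_subtractf sum_distrib_left)
  also have "(\<Sum>l\<in>I. e 0 l * dual 0 l) = E 0 * (total 0 / (real (card I) - 1)) - (\<Sum>l\<in>I. e 0 l * p 0 l)"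
    by (simp add: dual_def right_diff_distrib sum_subtractf E_def sum_distrib_right sum_divide_distrib)
  finally have "(\<Sum>l\<in>I. x 0 l * dual 0 l) = (\<Sum>l\<in>I. e 0 l * p 0 l)" by (simp add: sum_dual)
  then obtain n where n: "\<And>l. l \<in> I \<Longrightarrow> 0 < x n l"
    using eventually_positive[OF x lim p_nonneg often] value_pos by auto
  have E_pos: "0 < E k" if "n \<le> k" for k
  proof -
    have "0 < (\<Sum>l\<in>I. x k l)"
      using fin mi_in additive_step_positive[OF x n that] by (intro sum_pos) auto
    also have "(\<Sum>l\<in>I. x k l) = (real (card I) - 1) * E k"
      by (simp add: x_def sum_subtractf E_def left_diff_distrib)
    finally show ?thesis using card_pos by (simp add: zero_less_mult_iff)
  qed
  have "\<exists>t. \<forall>k\<ge>t. 0 \<le> e k l" if l: "l \<in> I" for l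
  proof -
    obtain t where t: "n \<le> t" "mi t = l" using often[OF l] by blast
    have "0 \<le> e k l" if "Suc t \<le> k" for k
      using that
    proof (induct k rule: dec_induct)
      case base
      show ?case using e_Suc[OF l, of t] t E_pos[OF t(1)] by (simp add: E_def)
    next
      case (step k)
      then show ?case using e_Suc[OF l, of k] E_pos[of k] t(1) by (simp add: E_def)
    qed
    then show ?thesis by blast
  qed
  then obtain t where t: "\<And>l k. l \<in> I \<Longrightarrow> t l \<le> k \<Longrightarrow> 0 \<le> e k l" by metis
  have "t l \<le> Max (t ` I)" if "l \<in> I" for l using fin that by simp
  then show ?thesis using t by (meson order_trans)
qed

end

section \<open>Switching in sequences of local quadratic transforms\<close>

locale quadratic_sequence = real_valued_field K v for K (structure) and v +
  fixes I :: "nat set" and Rs :: "nat \<Rightarrow> 'a set" and y :: "nat \<Rightarrow> nat \<Rightarrow> 'a" and mi :: "nat \<Rightarrow> nat"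
  assumes card_I: "2 \<le> card I"
    and blowup_step: "\<And>n. quadratic_step K v I (Rs n) (y n) (mi n) (Rs (Suc n))"
    and y_Suc: "\<And>n. y (Suc n) = (\<lambda>l. if l = mi n then y n (mi n) else y n l \<otimes> inv (y n (mi n)))"
    and closed_0: "independent_parameters.monomially_closed K v I (Rs 0) (y 0)"
begin

lemma params: "independent_parameters K v I (Rs n) (y n)"
  by (rule quadratic_step.axioms(1)[OF blowup_step])

lemma z_eq: "quadratic_step.z K (y n) (mi n) = y (Suc n)"
  unfolding quadratic_step.z_def[OF blowup_step] y_Suc ..

lemma closed: "independent_parameters.monomially_closed K v I (Rs n) (y n)"
proof (induct n)
  case (Suc n)
  show ?case using quadratic_step.monomially_closed_step[OF blowup_step Suc] unfolding z_eq .
qed (rule closed_0)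

lemma Rs_mono: "n \<le> k \<Longrightarrow> Rs n \<subseteq> Rs k"
  by (induct k rule: dec_induct) (use quadratic_step.S_subset_S'[OF blowup_step] in auto)

lemma mi_in: "mi n \<in> I" by (rule quadratic_step.m_in[OF blowup_step])

lemma mi_min: "l \<in> I \<Longrightarrow> v (y n (mi n)) \<le> v (y n l)" by (rule quadratic_step.m_min[OF blowup_step])

lemma y_props: "l \<in> I \<Longrightarrow> y n l \<in> Rs n" "l \<in> I \<Longrightarrow> y n l \<in> carrier K" "l \<in> I \<Longrightarrow> y n l \<noteq> \<zero>"
    "l \<in> I \<Longrightarrow> 0 < v (y n l)"
  using independent_parameters.y_in[OF params] independent_parameters.y_carrier[OF params]
    independent_parameters.y_nonzero[OF params] independent_parameters.v_y_pos[OF params] by auto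

lemma v_Suc: "l \<in> I \<Longrightarrow> v (y (Suc n) l) = (if l = mi n then v (y n l) else v (y n l) - v (y n (mi n)))"
  using quadratic_step.v_z[OF blowup_step, of l n] unfolding z_eq by auto

sublocale subtractive: fully_subtractive I "\<lambda>i. mi (j + i)" "\<lambda>i l. v (y (j + i) l)" for j
  using independent_parameters.finite_I[OF params] card_I mi_in v_Suc by unfold_locales auto

definition M :: "nat \<Rightarrow> (nat \<Rightarrow> nat) \<Rightarrow> 'a" where
  "M n a = (\<Otimes>l\<in>I. y n l [^] a l)"

lemma mon_eq_M: "independent_parameters.mon K I (y n) a = M n a"
  unfolding M_def independent_parameters.mon_def[OF params] ..

lemma M_Suc: "M n a = M (Suc n) (a(mi n := sum a I))"
  using quadratic_step.mon_lift[OF blowup_step, of n a]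
  unfolding z_eq mon_eq_M quadratic_step.lift_exp_def[OF blowup_step] .

text \<open>All rings of the tower lie in the ring \<open>?T\<close> of fractions of \<open>Rs j\<close> whose denominators have values
  free of \<open>k\<close>: the elements of least value at a later stage have values of this kind, so they are
  invertible in \<open>?T\<close>. Such denominators avoid the prime generated by the parameter \<open>k\<close>.\<close>

theorem never_minimal_imp_not_switching:
  assumes k: "k \<in> I" and never: "\<And>n. j \<le> n \<Longrightarrow> mi n \<noteq> k"
  shows "\<not> switches_strongly_infinitely_often K Rs"
proof -
  interpret A: independent_parameters K v I "Rs j" "y j" by (rule params)
  let ?P = "A.param_ideal k" let ?G = "A.span_coeffs k" let ?T = "value_fractions (Rs j) ?G"
  note G = A.span_coeffs_group[of k]
  have T: "subring ?T K" by (rule value_fractions_subring[OF A.subring_S G])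
  have T_inv: "inv t \<in> ?T" if "t \<in> ?T" "t \<noteq> \<zero>" "v t \<in> ?G" for t
    by (rule value_fractions_inv[OF A.subring_S G that])
  have vG: "\<forall>l\<in>I - {k}. v (y n l) \<in> ?G" if "j \<le> n" for n
    using that
  proof (induct n rule: dec_induct)
    case base
    then show ?case using A.v_y_in_span by blast
  next
    case (step n)
    have "v (y n (mi n)) \<in> ?G" using step mi_in never by auto
    then have "- v (y n (mi n)) \<in> ?G" using G by (simp add: additive_group_def)
    then have "v (y n l) - v (y n (mi n)) \<in> ?G" if "l \<in> I - {k}" for l
      using step that G unfolding additive_group_def diff_conv_add_uminus by blast
    then show ?case using step by (auto simp: v_Suc)
  qed
  have sub: "Rs n \<subseteq> ?T" if "j \<le> n" for n
    using that
  proof (induct n rule: dec_induct)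
    case base
    show ?case by (rule value_fractions_incl[OF A.subring_S G])
  next
    case (step n)
    show ?case
    proof (rule quadratic_step.S'_least[OF blowup_step T step(3)])
      fix t assume "t \<in> ?T" "t \<noteq> \<zero>" "v t = 0"
      then show "inv t \<in> ?T" using T_inv[of t] G by (simp add: additive_group_def)
    next
      fix a u assume a: "a \<in> Rs n" "a \<noteq> \<zero>" "v a = v (y n (mi n))" and u: "u \<in> Rs n"
      have "v a \<in> ?G" using vG[of n] step(1) a(3) mi_in never by auto
      then have "inv a \<in> ?T" using T_inv a step(3) by blast
      then show "u \<otimes> inv a \<in> ?T" using u step(3) subringE(6)[OF T] by blast
    qed
  qed
  have "?T \<subseteq> localization K (Rs j) ?P"
    using A.span_not_in_param_ideal[OF k] unfolding value_fractions_def localization_def by blast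
  then have "Rs n \<subseteq> localization K (Rs j) ?P" for n
    using sub[of "max j n"] Rs_mono[of n "max j n"] by simp
  then have un: "(\<Union>n. Rs n) \<subseteq> localization K (Rs j) ?P" by blast
  note prime = A.param_ideal_prime[OF closed k] and ht = A.height_param_ideal[OF closed k]
  show ?thesis
    unfolding switches_strongly_infinitely_often_def not_not
    by (intro exI conjI) (rule prime, rule ht, rule un)
qed

text \<open>Along the tower the exponents of both monomials change by the same linear transformations, so
  their difference follows the dynamics of \<open>exponents_eventually_nonneg\<close>.\<close>

lemma eventually_divides:
  assumes lim: "\<And>l. l \<in> I \<Longrightarrow> (\<lambda>n. v (y n l)) \<longlonglongrightarrow> 0"
    and often: "\<And>k j. k \<in> I \<Longrightarrow> \<exists>n\<ge>j. mi n = k"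
    and less: "v (M j a) < v (M j b)"
  shows "\<exists>n0\<ge>j. \<forall>n\<ge>n0. \<exists>g\<in>Rs n. val_gt 0 g \<and> M j b = g \<otimes> M j a"
proof -
  define E :: "(nat \<Rightarrow> nat) \<Rightarrow> nat \<Rightarrow> nat \<Rightarrow> nat" where "E a i = rec_nat a (\<lambda>i e. e(mi (j + i) := sum e I)) i" for a i
  have E0: "E a 0 = a" and E_Suc: "E a (Suc i) = (E a i)(mi (j + i) := sum (E a i) I)" for a i
    by (simp_all add: E_def)
  have ME: "M j a = M (j + i) (E a i)" for a i
  proof (induct i)
    case (Suc i)
    then show ?case using M_Suc[of "j + i" "E a i"] by (simp only: E_Suc add_Suc_right)
  qed (simp add: E0)
  define e where "e i l = real (E b i l) - real (E a i l)" for i l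
  have vM: "v (M n c) = (\<Sum>l\<in>I. real (c l) * v (y n l))" for n c
    using independent_parameters.v_mon[OF params, of n c] unfolding mon_eq_M independent_parameters.wt_def[OF params] .
  have "\<exists>n0. \<forall>n\<ge>n0. \<forall>l\<in>I. 0 \<le> e n l"
  proof (rule subtractive.exponents_eventually_nonneg[where j = j])
    show "(\<lambda>n. v (y (j + n) l)) \<longlonglongrightarrow> 0" if "l \<in> I" for l
      using LIMSEQ_ignore_initial_segment[OF lim[OF that], of j] by (simp add: add.commute)
    show "0 \<le> v (y (j + n) l)" if "l \<in> I" for n l using y_props(4)[OF that] by (simp add: less_imp_le)
    show "\<exists>n\<ge>i. mi (j + n) = k" if k: "k \<in> I" for k i
    proof -
      obtain n where "j + i \<le> n" "mi n = k" using often[OF k] by blast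
      then show ?thesis by (intro exI[of _ "n - j"]) auto
    qed
    show "e (Suc n) l = (if l = mi (j + n) then (\<Sum>l\<in>I. e n l) else e n l)" for n l
      by (simp add: e_def E_Suc sum_subtractf)
    show "0 < (\<Sum>l\<in>I. e 0 l * v (y (j + 0) l))"
      using less by (simp add: e_def E0 vM left_diff_distrib sum_subtractf)
  qed
  then obtain n0 where n0: "\<And>n l. n0 \<le> n \<Longrightarrow> l \<in> I \<Longrightarrow> E a n l \<le> E b n l" unfolding e_def by force
  have "\<exists>g\<in>Rs n. val_gt 0 g \<and> M j b = g \<otimes> M j a" if n: "j + n0 \<le> n" for n
  proof -
    interpret A: independent_parameters K v I "Rs n" "y n" by (rule params)
    define i where "i = n - j"
    have i: "n = j + i" "n0 \<le> i" using n by (auto simp: i_def)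
    define c where "c l = E b i l - E a i l" for l
    have "M n (E b i) = A.mon (\<lambda>l. c l + E a i l)"
      unfolding mon_eq_M[symmetric] by (rule A.mon_cong) (use n0 i(2) in \<open>simp add: c_def\<close>)
    then have "M n (E b i) = A.mon c \<otimes> A.mon (E a i)" by (simp only: A.mon_add)
    moreover have "M n (E b i) = M j b" "A.mon (E a i) = M j a"
      using ME[of b i] ME[of a i] i(1) by (simp_all add: mon_eq_M)
    ultimately have eq: "M j b = A.mon c \<otimes> M j a" by simp
    have "M j a \<in> carrier K" "M j a \<noteq> \<zero>"
      using A.mon_carrier A.mon_nonzero ME[of a i] i(1) unfolding mon_eq_M by auto
    then have "v (M j b) = v (A.mon c) + v (M j a)"
      unfolding eq using A.mon_carrier A.mon_nonzero by (intro v_mult) auto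
    then have "val_gt 0 (A.mon c)" using less A.mon_carrier by (simp add: val_gt_def)
    then show ?thesis using eq A.mon_in by blast
  qed
  then show ?thesis by (intro exI[of _ "j + n0"]) auto
qed

text \<open>Divide the expansion of \<open>f\<close> by its leading monomial. The quotients of the finitely many other
  monomials have positive value, so they enter the maximal ideal at some stage, and \<open>f\<close> divided by
  its leading monomial becomes a unit.\<close>

lemma eventually_monomial:
  assumes lim: "\<And>l. l \<in> I \<Longrightarrow> (\<lambda>n. v (y n l)) \<longlonglongrightarrow> 0"
    and often: "\<And>k j. k \<in> I \<Longrightarrow> \<exists>n\<ge>j. mi n = k"
    and f: "f \<in> Rs j" "f \<noteq> \<zero>"
  obtains n a u where "j \<le> n" "u \<in> Rs n" "inv u \<in> Rs n" "u \<noteq> \<zero>" "f = u \<otimes> M j a"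
proof -
  interpret A: independent_parameters K v I "Rs j" "y j" by (rule params)
  obtain a c r where a: "A.wt a = v f" and c: "c \<in> Rs j" "c \<noteq> \<zero>" "v c = 0"
    and r: "r \<in> A.Mon {b \<in> UNIV. v f < A.wt b}" and feq: "f = c \<otimes> A.mon a \<oplus> r"
    by (rule A.leading_term[OF A.up_closed_UNIV A.Mon_UNIV[OF f(1)] f(2)])
  have Mc: "M j b \<in> carrier K" and M0: "M j b \<noteq> \<zero>" for b
    using A.mon_carrier A.mon_nonzero unfolding mon_eq_M by auto
  have "r \<in> {r. \<exists>n0\<ge>j. \<forall>n\<ge>n0. \<exists>g\<in>Rs n. val_gt 0 g \<and> r = g \<otimes> M j a}"
  proof (rule A.Mon_least[OF r], goal_cases)
    case 1
    have "\<exists>g\<in>Rs n. val_gt 0 g \<and> \<zero> = g \<otimes> M j a" for n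
      using subringE(2)[OF independent_parameters.subring_S[OF params]] Mc by (intro bexI[of _ \<zero>]) auto
    then show ?case by blast
  next
    case (2 s b h)
    obtain n1 where n1: "n1 \<ge> j" "\<And>n. n \<ge> n1 \<Longrightarrow> \<exists>g\<in>Rs n. val_gt 0 g \<and> h = g \<otimes> M j a" using 2(3) by blast
    have "v (M j a) < v (M j b)" using 2(2) a A.v_mon unfolding mon_eq_M by simp
    then obtain n2 where n2: "\<And>n. n \<ge> n2 \<Longrightarrow> \<exists>g\<in>Rs n. val_gt 0 g \<and> M j b = g \<otimes> M j a"
      using eventually_divides[OF lim often] by blast
    have "\<exists>g\<in>Rs n. val_gt 0 g \<and> s \<otimes> A.mon b \<oplus> h = g \<otimes> M j a" if n: "max n1 n2 \<le> n" for n
    proof -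
      interpret B: independent_parameters K v I "Rs n" "y n" by (rule params)
      obtain g1 where g1: "g1 \<in> Rs n" "val_gt 0 g1" "h = g1 \<otimes> M j a" using n1(2)[of n] n by auto
      obtain g2 where g2: "g2 \<in> Rs n" "val_gt 0 g2" "M j b = g2 \<otimes> M j a" using n2[of n] n by auto
      have sn: "s \<in> Rs n" using 2(1) Rs_mono[of j n] n n1(1) by auto
      have car: "s \<in> carrier K" "g1 \<in> carrier K" "g2 \<in> carrier K" using sn g1 g2 B.S_carrier by auto
      have "s \<otimes> A.mon b \<oplus> h = (s \<otimes> g2 \<oplus> g1) \<otimes> M j a"
        unfolding mon_eq_M g1(3) g2(3) using car Mc by (simp add: l_distr m_assoc)
      moreover have "s \<otimes> g2 \<oplus> g1 \<in> Rs n" using sn g1 g2 B.S_mult B.S_add by blast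
      moreover have "val_gt (0 + 0) (s \<otimes> g2)" by (rule val_ge_gt_mult[OF B.S_val[OF sn] g2(2)])
      then have "val_gt 0 (s \<otimes> g2 \<oplus> g1)" using g1 by (auto intro: val_gt_add)
      ultimately show ?thesis by blast
    qed
    then show ?case using n1(1) by (intro CollectI exI[of _ "max n1 n2"]) auto
  qed
  then obtain n where n: "j \<le> n" and "\<exists>g\<in>Rs n. val_gt 0 g \<and> r = g \<otimes> M j a" by blast
  then obtain g where g: "g \<in> Rs n" "val_gt 0 g" "r = g \<otimes> M j a" by blast
  interpret B: independent_parameters K v I "Rs n" "y n" by (rule params)
  have cn: "c \<in> Rs n" using c Rs_mono n by blast
  have u: "c \<oplus> g \<in> Rs n" using cn g B.S_add by blast
  have "c \<oplus> g \<noteq> \<zero>" "v (c \<oplus> g) = 0"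
    using v_add_dominant[of c g] cn B.S_carrier c(2,3) g(2) by auto
  moreover have "f = (c \<oplus> g) \<otimes> M j a"
    unfolding feq g(3) mon_eq_M using cn g B.S_carrier Mc by (simp add: l_distr)
  ultimately show thesis using that[OF n u] B.S_inv[OF u] by blast
qed

text \<open>Here \<open>?W\<close> is the localization at the prime \<open>P\<close> and \<open>N\<close> is its maximal ideal. Variables of minimal
  value are outside \<open>N\<close>: otherwise all variables of that stage, being multiples of it, would be in
  \<open>N\<close>, and inductively all variables of \<open>Rs j\<close> would be in \<open>P\<close>. But then \<open>?W\<close> would be \<open>Rs j\<close>, which
  does not contain elements of arbitrarily small positive value. On the other hand, a variable of
  \<open>Rs j\<close> in \<open>P\<close> remains in \<open>N\<close> until it is minimal. As every variable is minimal at some time, \<open>P\<close>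
  contains none of them, which contradicts the factorization of its elements.\<close>

theorem vanishing_imp_switching:
  assumes lim: "\<And>l. l \<in> I \<Longrightarrow> (\<lambda>n. v (y n l)) \<longlonglongrightarrow> 0"
  shows "switches_strongly_infinitely_often K Rs"
  unfolding switches_strongly_infinitely_often_def
proof
  assume "\<exists>j P. primeideal P (K\<lparr>carrier := Rs j\<rparr>) \<and> height (K\<lparr>carrier := Rs j\<rparr>) P = 1 \<and>
    (\<Union>n. Rs n) \<subseteq> localization K (Rs j) P"
  then obtain j P where prime: "primeideal P (K\<lparr>carrier := Rs j\<rparr>)"
    and ht: "height (K\<lparr>carrier := Rs j\<rparr>) P = 1" and un: "(\<Union>n. Rs n) \<subseteq> localization K (Rs j) P"
    by (elim exE conjE) (rule that)
  interpret A: independent_parameters K v I "Rs j" "y j" by (rule params)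
  have often: "\<exists>n\<ge>i. mi n = k" if k: "k \<in> I" for k i
  proof (rule ccontr)
    assume n: "\<not> ?thesis"
    interpret B: independent_parameters K v I "Rs i" "y i" by (rule params)
    have "(\<Sum>l\<in>I - {k}. v (y (i + 0) l)) = (real (card I) - 2) * v (y (i + 0) k)"
    proof (rule subtractive.never_minimal_relation[OF _ k])
      show "(\<lambda>n. v (y (i + n) l)) \<longlonglongrightarrow> 0" if "l \<in> I" for l
        using LIMSEQ_ignore_initial_segment[OF lim[OF that], of i] by (simp add: add.commute)
      show "mi (i + n) \<noteq> k" if "0 \<le> n" for n using n by auto
    qed
    then have "(\<Sum>l\<in>I. of_int (if l = k then - (int (card I) - 2) else 1) * v (y i l)) = 0"
      using k B.finite_I by (subst sum.remove[of _ k]) (auto simp: left_diff_distrib)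
    then have z: "\<forall>l\<in>I. (if l = k then - (int (card I) - 2) else 1) = 0" by (rule B.independent)
    have "I \<subseteq> {k}" using z by (auto split: if_splits)
    then have "card I \<le> 1" using card_mono[of "{k}" I] by simp
    then show False using card_I by simp
  qed
  have Pid: "ideal P (K\<lparr>carrier := Rs j\<rparr>)" by (rule primeideal.axioms(1)[OF prime])
  have P_sub: "P \<subseteq> Rs j" and P_zero: "\<zero> \<in> P" and P_add: "\<And>a b. a \<in> P \<Longrightarrow> b \<in> P \<Longrightarrow> a \<oplus> b \<in> P"
    and P_mult: "\<And>s a. s \<in> Rs j \<Longrightarrow> a \<in> P \<Longrightarrow> s \<otimes> a \<in> P"
    using Pid unfolding ideal_subring_iff[OF A.subring_S] by simp_all
  have P_prime: "a \<in> P \<or> b \<in> P" if "a \<in> Rs j" "b \<in> Rs j" "a \<otimes> b \<in> P" for a b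
    using primeideal.I_prime[OF prime, of a b] that by simp
  have P_proper: "\<one> \<notin> P"
  proof
    assume one: "\<one> \<in> P"
    have "s \<in> P" if "s \<in> Rs j" for s using P_mult[OF that one] that A.S_carrier by simp
    then have "Rs j = P" using P_sub by blast
    then show False using primeideal.I_notcarr[OF prime] by simp
  qed
  note car = A.S_carrier
  let ?W = "localization K (Rs j) P"
  define N where "N = {a \<otimes> inv b | a b. a \<in> P \<and> b \<in> Rs j \<and> b \<notin> P}"
  have nz: "b \<noteq> \<zero>" if "b \<notin> P" for b using that P_zero by auto
  have W_sub: "Rs n \<subseteq> ?W" for n using un by blast
  have W_E: "\<exists>a b. a \<in> Rs j \<and> b \<in> Rs j \<and> b \<notin> P \<and> w = a \<otimes> inv b" if "w \<in> ?W" for w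
    using that unfolding localization_def by blast
  have N_mult: "w \<otimes> x \<in> N" if w: "w \<in> ?W" and x: "x \<in> N" for w x
  proof -
    obtain a b where ab: "a \<in> Rs j" "b \<in> Rs j" "b \<notin> P" "w = a \<otimes> inv b" using W_E[OF w] by blast
    obtain c e where ce: "c \<in> P" "e \<in> Rs j" "e \<notin> P" "x = c \<otimes> inv e" using x unfolding N_def by blast
    have c: "a \<in> carrier K" "b \<in> carrier K" "c \<in> carrier K" "e \<in> carrier K"
      using ab ce P_sub car by auto
    have i: "inv b \<in> carrier K" "inv e \<in> carrier K" using c nz ab ce by auto
    have "w \<otimes> x = (a \<otimes> c) \<otimes> (inv b \<otimes> inv e)" unfolding ab(4) ce(4) using c i by (simp add: m_ac)
    also have "inv b \<otimes> inv e = inv (b \<otimes> e)" using c nz ab ce by (simp add: inv_mult_K)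
    finally have "w \<otimes> x = (a \<otimes> c) \<otimes> inv (b \<otimes> e)" .
    moreover have "a \<otimes> c \<in> P" using P_mult ab ce by blast
    moreover have "b \<otimes> e \<in> Rs j" using ab ce A.S_mult by blast
    moreover have "b \<otimes> e \<notin> P" using P_prime ab ce by blast
    ultimately show ?thesis unfolding N_def by blast
  qed
  have N_int: "s \<in> P" if s: "s \<in> N" "s \<in> Rs j" for s
  proof -
    obtain c e where ce: "c \<in> P" "e \<in> Rs j" "e \<notin> P" "s = c \<otimes> inv e" using s unfolding N_def by blast
    then have "s \<otimes> e = c" using car P_sub nz by (auto simp: inv_cancel)
    then show ?thesis using P_prime[OF s(2) ce(2)] ce by auto
  qed
  have P_N: "P \<subseteq> N"
  proof
    fix a assume a: "a \<in> P"
    have "a = a \<otimes> inv \<one>" using a P_sub car by auto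
    then show "a \<in> N" unfolding N_def using a P_proper A.S_one by blast
  qed
  have W_inv: "inv w \<in> ?W" if w: "w \<in> ?W" "w \<notin> N" for w
  proof -
    obtain a b where ab: "a \<in> Rs j" "b \<in> Rs j" "b \<notin> P" "w = a \<otimes> inv b" using W_E[OF w(1)] by blast
    have aP: "a \<notin> P" using w(2) ab unfolding N_def by blast
    have "inv w = b \<otimes> inv a"
      unfolding ab(4) using ab(1,2) car nz[OF ab(3)] nz[OF aP] by (simp add: inv_mult_K inv_inv_K m_comm)
    then show ?thesis using ab aP unfolding localization_def by blast
  qed
  have min_notin: "y n (mi n) \<notin> N" if "j \<le> n" for n
  proof -
    have step: "y n (mi n) \<notin> N" if l: "l \<in> I" "y n l \<notin> N" for n l
    proof (cases "l = mi n")
      case False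
      have "y (Suc n) l \<otimes> y n (mi n) = y n l"
        using False l(1) mi_in y_props by (simp add: y_Suc inv_cancel)
      moreover have "y (Suc n) l \<in> ?W" using W_sub y_props(1)[OF l(1)] by blast
      ultimately show ?thesis using N_mult l(2) by metis
    qed (use l in simp)
    show ?thesis using that
    proof (induct n rule: dec_induct)
      case base
      have "\<exists>l\<in>I. y j l \<notin> P"
      proof (rule ccontr)
        assume "\<not> ?thesis"
        then have all: "\<And>l. l \<in> I \<Longrightarrow> y j l \<in> P" by blast
        have max_P: "s \<in> P" if "s \<in> Rs j" "val_gt 0 s" for s
          by (rule span_over_least[OF A.generate[OF that] P_zero]) (use all P_add P_mult in blast)
        have "?W \<subseteq> Rs j"
        proof
          fix w assume "w \<in> ?W"
          then obtain a b where ab: "a \<in> Rs j" "b \<in> Rs j" "b \<notin> P" "w = a \<otimes> inv b" using W_E by blast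
          have "b \<noteq> \<zero>" "v b = 0" using val_ge_0_cases[OF A.S_val[OF ab(2)]] max_P ab by auto
          then have "inv b \<in> Rs j" using A.S_inv ab by blast
          then show "w \<in> Rs j" using ab A.S_mult by blast
        qed
        then have all_in: "y n (mi n) \<in> Rs j" for n using W_sub y_props(1) mi_in by blast
        have "v (y j (mi j)) \<le> v (y n (mi n))" for n
          using quadratic_step.max_ideal_val[OF blowup_step all_in[of n]] y_props mi_in
          by (auto simp: val_ge_def val_gt_def)
        then have "v (y j (mi j)) \<le> v (y n l)" if "l \<in> I" for n l
          using mi_min[OF that] order_trans by blast
        then have "v (y j (mi j)) \<le> 0" using lim[OF mi_in[of 0]] mi_in by (intro LIMSEQ_le_const) auto
        then show False using y_props(4)[OF mi_in, of j] by (simp add: not_le[symmetric])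
      qed
      then obtain l where l: "l \<in> I" "y j l \<notin> P" by blast
      then have "y j l \<notin> N" using N_int y_props(1) by blast
      then show ?case using step l by blast
    next
      case (step n)
      have "y (Suc n) (mi n) \<notin> N" using step by (simp add: y_Suc)
      then show ?case using \<open>\<And>n l. l \<in> I \<Longrightarrow> y n l \<notin> N \<Longrightarrow> y n (mi n) \<notin> N\<close>[OF mi_in] by blast
    qed
  qed
  have never: "y i l \<notin> P" if "l \<in> I" "i = j" for i l
  proof
    assume yP: "y i l \<in> P"
    have "y n l \<in> N" if "j \<le> n" for n
      using that
    proof (induct n rule: dec_induct)
      case base
      then show ?case using yP P_N \<open>i = j\<close> by blast
    next
      case (step n)
      have ne: "l \<noteq> mi n" using step min_notin by auto
      have "inv (y n (mi n)) \<in> ?W" using W_inv min_notin[OF step(1)] W_sub y_props(1)[OF mi_in] by blast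
      then have "inv (y n (mi n)) \<otimes> y n l \<in> N" using N_mult step by blast
      then show ?case using ne \<open>l \<in> I\<close> y_props mi_in by (simp add: y_Suc m_comm)
    qed
    moreover obtain n where "j \<le> n" "mi n = l" using often[OF \<open>l \<in> I\<close>] by blast
    ultimately show False using min_notin by blast
  qed
  have mon_notin: "M j a \<notin> P" for a
  proof -
    have pow: "y j l [^] (n::nat) \<notin> P" if "l \<in> I" for l n
    proof (induct n)
      case (Suc n)
      then show ?case using P_prime[OF A.y_pow_in[OF that] y_props(1)[OF that]] never that by auto
    qed (use P_proper in simp)
    have "(\<Otimes>l\<in>J. y j l [^] a l) \<in> Rs j \<and> (\<Otimes>l\<in>J. y j l [^] a l) \<notin> P" if "finite J" "J \<subseteq> I" for J
      using that
    proof (induct J)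
      case empty
      then show ?case using P_proper A.S_one by simp
    next
      case (insert l J)
      have "(\<Otimes>l\<in>insert l J. y j l [^] a l) = y j l [^] a l \<otimes> (\<Otimes>l\<in>J. y j l [^] a l)"
        using insert y_props(2) by (intro finprod_insert) auto
      moreover have q: "y j l [^] a l \<in> Rs j" "y j l [^] a l \<notin> P" using insert A.y_pow_in pow by auto
      moreover have r: "(\<Otimes>l\<in>J. y j l [^] a l) \<in> Rs j" "(\<Otimes>l\<in>J. y j l [^] a l) \<notin> P" using insert by auto
      ultimately show ?case using P_prime[OF q(1) r(1)] subringE(6)[OF A.subring_S q(1) r(1)] by metis
    qed
    then show ?thesis unfolding M_def using A.finite_I by blast
  qed
  obtain f where f: "f \<in> P" "f \<noteq> \<zero>"
    using A.height_one_nonzero[OF ht prime] P_zero by blast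
  have fR: "f \<in> Rs j" using f P_sub by blast
  obtain n a u where n: "j \<le> n" "u \<in> Rs n" "inv u \<in> Rs n" "u \<noteq> \<zero>" "f = u \<otimes> M j a"
  proof (rule eventually_monomial[of f j], goal_cases)
    case (1 l)
    show ?case by (rule lim[OF 1(2)])
  next
    case (2 k i)
    show ?case by (rule often[OF 2(2)])
  next
    case (5 n u a)
    show ?case by (rule 5(1)[OF 5(2-)])
  qed (rule fR, rule f(2))
  have uc: "u \<in> carrier K" using n independent_parameters.S_carrier[OF params] by blast
  have Mc: "M j a \<in> carrier K" "M j a \<in> Rs j" using A.mon_carrier A.mon_in unfolding mon_eq_M by auto
  have "inv u \<otimes> f \<in> N" using N_mult n(3) W_sub f(1) P_N by blast
  moreover have "inv u \<otimes> f = M j a" unfolding n(5) using uc n(4) Mc by (simp add: m_assoc[symmetric])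
  ultimately have "M j a \<in> P" using N_int[OF _ Mc(2)] by simp
  then show False using mon_notin by blast
qed

abbreviation total_value :: "nat \<Rightarrow> real" where
  "total_value n \<equiv> (\<Sum>l\<in>I. v (y n l))"

lemma decseq_v: "l \<in> I \<Longrightarrow> decseq (\<lambda>n. v (y n l))"
  by (rule decseq_SucI) (use v_Suc y_props(4) mi_in in \<open>simp add: less_imp_le\<close>)

text \<open>The partial sums telescope against the total value of the variables.\<close>

theorem value_sums:
  obtains T where "total_value \<longlonglongrightarrow> T" "0 \<le> T"
    "(\<lambda>i. v (y i (mi i))) sums ((total_value 0 - T) / (real (card I) - 1))"
    "T = 0 \<longleftrightarrow> (\<forall>l\<in>I. (\<lambda>n. v (y n l)) \<longlonglongrightarrow> 0)"
proof -
  have "\<exists>L. (\<lambda>n. v (y n l)) \<longlonglongrightarrow> L \<and> 0 \<le> L" if l: "l \<in> I" for l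
  proof -
    obtain L where L: "(\<lambda>n. v (y n l)) \<longlonglongrightarrow> L" "\<And>n. L \<le> v (y n l)"
      by (rule decseq_convergent[OF decseq_v[OF l], of 0]) (use y_props(4)[OF l] less_imp_le in auto)
    moreover have "0 \<le> L" by (rule LIMSEQ_le_const[OF L(1)]) (use y_props(4)[OF l] less_imp_le in auto)
    ultimately show ?thesis by blast
  qed
  then obtain L where L: "\<And>l. l \<in> I \<Longrightarrow> (\<lambda>n. v (y n l)) \<longlonglongrightarrow> L l" "\<And>l. l \<in> I \<Longrightarrow> 0 \<le> L l" by metis
  define T where "T = sum L I"
  have T: "total_value \<longlonglongrightarrow> T" unfolding T_def by (intro tendsto_sum L)
  have fin: "finite I" using independent_parameters.finite_I[OF params] .
  have "T = 0 \<longleftrightarrow> (\<forall>l\<in>I. L l = 0)" unfolding T_def using fin L(2) by (intro sum_nonneg_eq_0_iff)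
  also have "\<dots> \<longleftrightarrow> (\<forall>l\<in>I. (\<lambda>n. v (y n l)) \<longlonglongrightarrow> 0)"
    using L(1) LIMSEQ_unique by metis
  finally have iff: "T = 0 \<longleftrightarrow> (\<forall>l\<in>I. (\<lambda>n. v (y n l)) \<longlonglongrightarrow> 0)" .
  have c: "real (card I) - 1 > 0" using card_I by simp
  have "(\<Sum>i<n. v (y i (mi i))) = (total_value 0 - total_value n) / (real (card I) - 1)" for n
    using subtractive.sum_minima[where j = 0 and n = n] c by (simp add: field_simps)
  moreover have "(\<lambda>n. (total_value 0 - total_value n) / (real (card I) - 1)) \<longlonglongrightarrow> (total_value 0 - T) / (real (card I) - 1)"
    by (intro tendsto_intros T) (use c in auto)
  ultimately have "(\<lambda>i. v (y i (mi i))) sums ((total_value 0 - T) / (real (card I) - 1))"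
    unfolding sums_def by simp
  moreover have "0 \<le> T" unfolding T_def using L(2) by (intro sum_nonneg)
  ultimately show thesis using that T iff by blast
qed

theorem switching_iff:
  "switches_strongly_infinitely_often K Rs \<longleftrightarrow> (\<forall>l\<in>I. (\<lambda>n. v (y n l)) \<longlonglongrightarrow> 0)"
proof
  assume sw: "switches_strongly_infinitely_often K Rs"
  show "\<forall>l\<in>I. (\<lambda>n. v (y n l)) \<longlonglongrightarrow> 0"
  proof (rule ccontr)
    assume "\<not> ?thesis"
    then obtain k where k: "k \<in> I" "\<not> (\<lambda>n. v (y n k)) \<longlonglongrightarrow> 0" by blast
    obtain L where L: "(\<lambda>n. v (y n k)) \<longlonglongrightarrow> L" "\<And>n. L \<le> v (y n k)"
      by (rule decseq_convergent[OF decseq_v[OF k(1)], of 0]) (use y_props(4)[OF k(1)] less_imp_le in auto)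
    have "0 \<le> L" by (rule LIMSEQ_le_const[OF L(1)]) (use y_props(4)[OF k(1)] less_imp_le in auto)
    then have "0 < L" using L(1) k(2) by (cases "L = 0") auto
    obtain T where "(\<lambda>i. v (y i (mi i))) sums ((total_value 0 - T) / (real (card I) - 1))"
      by (rule value_sums)
    then have "(\<lambda>i. v (y i (mi i))) \<longlonglongrightarrow> 0" by (intro summable_LIMSEQ_zero) (rule sums_summable)
    then have "eventually (\<lambda>i. v (y i (mi i)) < L) sequentially" using \<open>0 < L\<close> by (rule order_tendstoD)
    then obtain j where j: "\<And>n. j \<le> n \<Longrightarrow> v (y n (mi n)) < L" by (auto simp: eventually_sequentially)
    have "mi n \<noteq> k" if "j \<le> n" for n using j[OF that] L(2)[of n] by auto
    then show False using never_minimal_imp_not_switching[OF k(1)] sw by blast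
  qed
qed (use vanishing_imp_switching in blast)

end

section \<open>The initial regular local ring\<close>

lemma (in field) local_unit:
  assumes S: "subring S R" and noeth: "noetherian_ring (sub S)"
    and loc: "local_ring (sub S)" and s: "s \<in> S" "s \<notin> max_ideal (sub S)"
  shows "\<exists>r\<in>S. r \<otimes> s = \<one>"
proof (rule ccontr)
  assume nonunit: "\<not> ?thesis"
  note iff = ideal_subring_iff[OF S]
  have car: "\<And>s. s \<in> S \<Longrightarrow> s \<in> carrier R" using subringE(1)[OF S] by blast
  let ?J = "{r \<otimes> s | r. r \<in> S}"
  have J: "ideal ?J (sub S)" unfolding iff
  proof (intro conjI ballI)
    show "?J \<subseteq> S" using s subringE(6)[OF S] by blast
    have "\<zero> = \<zero> \<otimes> s" using s car by simp
    then show "\<zero> \<in> ?J" using subringE(2)[OF S] by blast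
  next
    fix a b assume "a \<in> ?J" "b \<in> ?J"
    then obtain p q where "p \<in> S" "q \<in> S" "a = p \<otimes> s" "b = q \<otimes> s" by blast
    moreover then have "a \<oplus> b = (p \<oplus> q) \<otimes> s" using s car by (simp add: l_distr)
    ultimately show "a \<oplus> b \<in> ?J" using subringE(7)[OF S] by blast
  next
    fix t a assume "t \<in> S" "a \<in> ?J"
    then obtain p where "p \<in> S" "a = p \<otimes> s" by blast
    moreover then have "t \<otimes> a = (t \<otimes> p) \<otimes> s" using s car \<open>t \<in> S\<close> by (simp add: m_assoc)
    ultimately show "t \<otimes> a \<in> ?J" using subringE(6)[OF S] \<open>t \<in> S\<close> by blast
  qed
  have oneJ: "\<one> \<notin> ?J" using nonunit by auto
  have "\<one> \<otimes> s = s" using s car by simp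
  then have sJ: "s \<in> ?J" using subringE(3)[OF S] by (metis (mono_tags, lifting) mem_Collect_eq)
  define F where "F = {J. ideal J (sub S) \<and> \<one> \<notin> J \<and> s \<in> J}"
  have "?J \<in> F" using J oneJ sJ unfolding F_def by (simp only: mem_Collect_eq) simp
  then have "F \<noteq> {}" by auto
  then obtain M where M: "M \<in> F" and max: "\<And>J. J \<in> F \<Longrightarrow> M \<subseteq> J \<Longrightarrow> J = M"
    by (rule noetherian_maximal[OF noeth]) (auto simp: F_def)
  have Mi: "ideal M (sub S)" and M1: "\<one> \<notin> M" and Ms: "s \<in> M" using M by (simp_all add: F_def)
  have maxM: "maximalideal M (sub S)"
  proof (rule maximalidealI[OF Mi])
    show "carrier (sub S) \<noteq> M" using M1 subringE(3)[OF S] by auto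
    fix J assume J: "ideal J (sub S)" "M \<subseteq> J" "J \<subseteq> carrier (sub S)"
    show "J = M \<or> J = carrier (sub S)"
    proof (cases "\<one> \<in> J")
      case True
      have mult: "\<And>s a. s \<in> S \<Longrightarrow> a \<in> J \<Longrightarrow> s \<otimes> a \<in> J" using J(1) unfolding iff by simp
      have "s \<in> J" if "s \<in> S" for s using mult[OF that True] car[OF that] by simp
      then show ?thesis using J(3) by auto
    next
      case False
      then have "J \<in> F" using J(1,2) Ms unfolding F_def by (simp add: subset_iff)
      then show ?thesis using max J(2) by simp
    qed
  qed
  have ex1: "\<exists>!M. maximalideal M (sub S)" using loc by (simp add: local_ring_def)
  have "max_ideal (sub S) = M"
    unfolding max_ideal_def by (rule the1_equality[OF ex1 maxM])
  then show False using s Ms by simp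
qed

text \<open>A vanishing parameter would leave fewer than \<open>d\<close> generators of the maximal ideal. The independence
  of the values alone does not exclude it, as the value of zero is unspecified.\<close>

lemma regular_parameter_nonzero:
  fixes A (structure)
  assumes "ring A" "regular_local_ring A" "krull_dim A = enat d" and x: "x ` {1..d} \<subseteq> carrier A"
    and gen: "max_ideal A = Idl (x ` {1..d})" and k: "k \<in> {1..d}"
  shows "x k \<noteq> \<zero>"
proof
  assume xk: "x k = \<zero>"
  interpret ring A by fact
  let ?G = "x ` {1..d} - {\<zero>}"
  have "Idl ?G = Idl (x ` {1..d})"
  proof -
    have "?G \<subseteq> J \<longleftrightarrow> x ` {1..d} \<subseteq> J" if "ideal J A" for J
      using additive_subgroup.zero_closed[OF ideal.axioms(1)[OF that]] by auto
    then have "{J. ideal J A \<and> ?G \<subseteq> J} = {J. ideal J A \<and> x ` {1..d} \<subseteq> J}" by blast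
    then show ?thesis by (simp add: genideal_def)
  qed
  then have "\<exists>S \<subseteq> carrier A. finite S \<and> card S = card ?G \<and> Idl S = max_ideal A"
    using x gen by (intro exI[of _ ?G]) auto
  then have "(LEAST n. \<exists>S \<subseteq> carrier A. finite S \<and> card S = n \<and> Idl S = max_ideal A) \<le> card ?G"
    by (rule Least_le)
  then have "d \<le> card ?G" using assms(2,3) by (simp add: regular_local_ring_def)
  also have "?G \<subseteq> x ` ({1..d} - {k})" using xk by auto
  then have "card ?G \<le> card (x ` ({1..d} - {k}))" by (intro card_mono) auto
  also have "\<dots> \<le> card ({1..d} - {k})" by (rule card_image_le) simp
  also have "\<dots> < d" using k by (simp add: card_Diff_singleton)
  finally show False by simp
qed

lemma rationally_independent_int:
  assumes "rationally_independent I f" "(\<Sum>l\<in>I. of_int (c l) * f l) = 0"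
  shows "\<forall>l\<in>I. c l = (0::int)"
proof -
  have "(\<Sum>l\<in>I. of_rat (of_int (c l)) * f l) = 0" using assms(2) by simp
  moreover have "(\<Sum>l\<in>I. of_rat (of_int (c l)) * f l) = 0 \<longrightarrow> (\<forall>l\<in>I. (of_int (c l) :: rat) = 0)"
    using assms(1) unfolding rationally_independent_def by (rule spec)
  ultimately have "\<forall>l\<in>I. (of_int (c l) :: rat) = 0" by (rule mp[rotated])
  then show ?thesis by simp
qed

theorem theorem7p2:
  fixes K :: "('a, 'b) ring_scheme"
    and R V :: "'a set"
    and d :: nat
    and v :: "'a \<Rightarrow> real"
    and Rs :: "nat \<Rightarrow> 'a set"
    and x :: "nat \<Rightarrow> 'a"
    and s :: ereal
  assumes "fraction_field_of K R"
    and "regular_local_ring (K\<lparr>carrier := R\<rparr>)"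
    and "krull_dim (K\<lparr>carrier := R\<rparr>) = enat d"
    and "d \<ge> 2"
    and "real_valuation_domain K V v"
    and "birationally_dominates K V R"
    and "zero_dimensional_over K V R"
    and "local_quadratic_sequence K V R Rs"
    and "s = suminf (\<lambda>i. ereal (ideal_value K v (max_ideal (K\<lparr>carrier := Rs i\<rparr>))))"
    and "x ` {1..d} \<subseteq> R"
    and "max_ideal (K\<lparr>carrier := R\<rparr>) = Idl\<^bsub>K\<lparr>carrier := R\<rparr>\<^esub> (x ` {1..d})"
    and "rationally_independent {1..d} (\<lambda>k. v (x k))"
  shows "(s \<le> ereal ((\<Sum>k=1..d. v (x k)) / (real d - 1)) \<and> \<bar>s\<bar> \<noteq> \<infinity>) \<and>
    ((s = ereal ((\<Sum>k=1..d. v (x k)) / (real d - 1)) \<longleftrightarrow>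
        switches_strongly_infinitely_often K Rs) \<and>
     (switches_strongly_infinitely_often K Rs \<longleftrightarrow>
        (\<forall>k \<in> {1..d}. (\<lambda>n. v (induced_vars K v d x n k)) \<longlonglongrightarrow> 0)))"
proof -
  have fieldK: "field K" and subR: "subring R K" using assms(1) by (simp_all add: fraction_field_of_def)
  have val: "valuation K v" and V: "V = valuation_ring K v"
    using assms(5) by (simp_all add: real_valuation_domain_def)
  interpret real_valued_field K v
    by (rule real_valued_field.intro[OF fieldK]) (simp add: real_valued_field_axioms_def val)
  let ?I = "{1..d}" let ?y = "induced_vars K v d x"
  note car = subsetD[OF subringE(1)[OF subR]]
  have RV: "R \<subseteq> valuation_ring K v" and maxVR: "max_ideal (K\<lparr>carrier := V\<rparr>) \<inter> R = max_ideal (K\<lparr>carrier := R\<rparr>)"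
    using assms(6) V by (simp_all add: birationally_dominates_def)
  have maxR: "max_ideal (K\<lparr>carrier := R\<rparr>) = {r \<in> R. val_gt 0 r}"
    using maxVR RV unfolding V max_ideal_dominated[OF valuation_ring_dominated] by auto
  have loc: "local_ring (K\<lparr>carrier := R\<rparr>)" and noeth: "noetherian_ring (K\<lparr>carrier := R\<rparr>)"
    using assms(2) by (simp_all add: regular_local_ring_def)
  have ringR: "ring (K\<lparr>carrier := R\<rparr>)" by (rule subring_is_ring[OF subR])
  have dom: "dominated R"
    unfolding dominated_def
  proof (intro conjI ballI impI)
    fix r assume r: "r \<in> R" "r \<noteq> \<zero>\<^bsub>K\<^esub>" "v r = 0"
    have "r \<notin> max_ideal (K\<lparr>carrier := R\<rparr>)" using r unfolding maxR by (simp add: val_gt_def)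
    then obtain t where t: "t \<in> R" "t \<otimes>\<^bsub>K\<^esub> r = \<one>\<^bsub>K\<^esub>" using local_unit[OF subR noeth loc r(1)] by blast
    have "inv\<^bsub>K\<^esub> r = t" by (rule comm_inv_char) (use t r car m_comm in auto)
    then show "inv\<^bsub>K\<^esub> r \<in> R" using t by simp
  qed (use subR RV in \<open>auto simp: valuation_ring_eq\<close>)
  have xR: "x l \<in> R" if "l \<in> ?I" for l using assms(10) that by auto
  have base: "independent_parameters K v ?I R x"
  proof (unfold_locales, goal_cases)
    case (4 l)
    then have "x l \<in> max_ideal (K\<lparr>carrier := R\<rparr>)"
      unfolding assms(11) using ring.genideal_self[OF ringR, of "x ` ?I"] assms(10) by auto
    then show ?case unfolding maxR by simp
  next
    case (5 l)
    then show ?case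
      using regular_parameter_nonzero[OF ringR assms(2,3) _ assms(11), of l] assms(10) by simp
  next
    case (6 r)
    have xc: "x ` ?I \<subseteq> carrier K" using assms(10) car by blast
    have sub: "span_over R (x ` ?I) \<subseteq> R"
    proof
      fix f assume "f \<in> span_over R (x ` ?I)"
      then show "f \<in> R"
        by (rule span_over_least) (use assms(10) subringE(2,6,7)[OF subR] in auto)
    qed
    have "ideal (span_over R (x ` ?I)) (K\<lparr>carrier := R\<rparr>)"
      unfolding ideal_subring_iff[OF subR]
      using sub span_over.zero span_over_add[OF subR xc] span_over_smult[OF subR xc] by simp
    moreover have "x ` ?I \<subseteq> span_over R (x ` ?I)" using span_over_base[OF xc subR] by blast
    ultimately have "max_ideal (K\<lparr>carrier := R\<rparr>) \<subseteq> span_over R (x ` ?I)"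
      unfolding assms(11) by (rule ring.genideal_minimal[OF ringR])
    then show ?case using 6 unfolding maxR by auto
  next
    case (7 c)
    then show ?case by (rule rationally_independent_int[OF assms(12)])
  qed (use dom xR in auto)
  define mi where "mi n = (THE k. k \<in> ?I \<and> (\<forall>l\<in>?I. v (?y n k) \<le> v (?y n l)))" for n
  have y_Suc: "?y (Suc n) = (\<lambda>l. if l = mi n then ?y n (mi n) else ?y n l \<otimes>\<^bsub>K\<^esub> inv\<^bsub>K\<^esub> (?y n (mi n)))" for n
    by (simp only: induced_vars.simps Let_def mi_def)
  have R0: "Rs 0 = R" and tr: "\<And>n. local_quadratic_transform K (valuation_ring K v) (Rs n) (Rs (Suc n))"
    using assms(8) V by (simp_all add: local_quadratic_sequence_def)
  have I_ne: "?I \<noteq> {}" using assms(4) by simp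
  have to_step: "quadratic_step K v ?I (Rs n) (?y n) (mi n) (Rs (Suc n))"
    if "independent_parameters K v ?I (Rs n) (?y n)" for n
    using independent_parameters.unique_minimum[OF that I_ne] tr[of n] that
    unfolding mi_def[symmetric] by (intro quadratic_step.intro quadratic_step_axioms.intro)
  have params: "independent_parameters K v ?I (Rs n) (?y n)" for n
  proof (induct n)
    case (Suc n)
    interpret Q: quadratic_step K v ?I "Rs n" "?y n" "mi n" "Rs (Suc n)" by (rule to_step[OF Suc])
    have "Q.z = ?y (Suc n)" unfolding Q.z_def y_Suc ..
    then show ?case using Q.Z.independent_parameters_axioms by simp
  qed (use base R0 in simp)
  note step = to_step[OF params]
  interpret Q: quadratic_sequence K v ?I Rs ?y mi
  proof (intro quadratic_sequence.intro quadratic_sequence_axioms.intro)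
    show "2 \<le> card ?I" using assms(4) by simp
    show "independent_parameters.monomially_closed K v ?I (Rs 0) (?y 0)"
      using independent_parameters.noetherian_monomially_closed[OF base noeth] R0 by simp
  qed (rule real_valued_field_axioms, rule step, rule y_Suc)
  define t where "t = (\<Sum>k=1..d. v (x k)) / (real d - 1)"
  obtain T where T: "0 \<le> T" and sums: "(\<lambda>i. v (?y i (mi i))) sums (((\<Sum>l\<in>?I. v (?y 0 l)) - T) / (real (card ?I) - 1))"
    and T0: "T = 0 \<longleftrightarrow> (\<forall>l\<in>?I. (\<lambda>n. v (?y n l)) \<longlonglongrightarrow> 0)"
    by (rule Q.value_sums)
  have "(\<lambda>i. ereal (v (?y i (mi i)))) sums ereal (t - T / (real d - 1))"
    using sums unfolding sums_ereal by (simp add: t_def diff_divide_distrib)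
  then have s: "s = ereal (t - T / (real d - 1))"
    unfolding assms(9) quadratic_step.ideal_value_eq[OF step] by (rule sums_unique[symmetric])
  have d: "0 < real d - 1" using assms(4) by simp
  have "s \<le> ereal t" "\<bar>s\<bar> \<noteq> \<infinity>" using s T d by simp_all
  moreover have "s = ereal t \<longleftrightarrow> T = 0" using s d by simp
  ultimately show ?thesis using T0 Q.switching_iff unfolding t_def by blast
qed

end
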